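(* (In ZFC.) The \(E\)-order is wellfounded: there is no sequence \(\langle U_i:i<\omega\rangle\) of uniform ultrafilters such that \(U_{i+1}<_E U_i\) for all \(i<\omega\).
   Context: For a countably complete ultrafilter \(U\), \(\mathrm{Ult}(V,U)\) is the transitive collapse of the ultrapower, \(j_U\) its embedding, \([\mathrm{id}]_U\) the class of the identity. A uniform ultrafilter is a countably complete ultrafilter \(U\) on \([\kappa]^n\) (the \(n\)-element subsets of an ordinal \(\kappa\)) with \(\kappa\) least such that \([\kappa]^n\in U\). Finite sets of ordinals are ordered by \(a<b\) iff the largest element of their symmetric difference lies in \(b\). An external comparison of \(\langle U_0,U_1\rangle\) is a pair \(\langle W_0,W_1\rangle\) where each \(W_i\) is an ultrafilter on the subsets of some set lying in \(\mathrm{Ult}(V,U_i)\) (not necessarily an element of \(\mathrm{Ult}(V,U_i)\)) which \((\mathrm{Ult}(V,U_i),W_i)\) thinks is countably complete, the ultrapowers \(\mathrm{Ult}(\mathrm{Ult}(V,U_i),W_i)\) formed with functions in \(\mathrm{Ult}(V,U_i)\) are equal, and \(j_{W_0}\circ j_{U_0}=j_{W_1}\circ j_{U_1}\). It is \(1\)-internal if \(W_1\in\mathrm{Ult}(V,U_1)\). The strict \(E\)-order: \(U_0<_E U_1\) iff there is a \(1\)-internal external comparison \(\langle W_0,W_1\rangle\) of \(\langle U_0,U_1\rangle\) with \(j_{W_0}([\mathrm{id}]_{U_0})<j_{W_1}([\mathrm{id}]_{U_1})\). *)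

theory Defs
  imports Main
begin

text \<open>
  A theorem of ZFC is rendered as a statement about every model of first-order ZFC whose universe
  is a type \<open>'v\<close> and whose membership relation is \<open>mem\<close>. No wellfoundedness of \<open>mem\<close> in
  the sense of the metatheory is assumed, and the schemes of Separation and Replacement are
  restricted to formulas of the language of set theory with parameters. Everything below is
  computed inside the model: the bound variables for sets range over the model, and
  finiteness, sequences and \<open>\<omega>\<close> are those of the model. Proper classes of the model
  are represented by metatheoretic sets \<open>'v set\<close>.
\<close>

datatype fm = Mem nat nat | Eq nat nat | Neg fm | Conj fm fm | Exi nat fm

primrec sat :: "('v \<Rightarrow> 'v \<Rightarrow> bool) \<Rightarrow> fm \<Rightarrow> (nat \<Rightarrow> 'v) \<Rightarrow> bool" where
  "sat mem (Mem i j) e \<longleftrightarrow> mem (e i) (e j)"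
| "sat mem (Eq i j) e \<longleftrightarrow> e i = e j"
| "sat mem (Neg p) e \<longleftrightarrow> \<not> sat mem p e"
| "sat mem (Conj p q) e \<longleftrightarrow> sat mem p e \<and> sat mem q e"
| "sat mem (Exi i p) e \<longleftrightarrow> (\<exists>x. sat mem p (e(i := x)))"

locale set_structure =
  fixes mem :: "'v \<Rightarrow> 'v \<Rightarrow> bool" (infix "\<epsilon>" 50)
begin

definition elts :: "'v \<Rightarrow> 'v set" where
  "elts x = {y. y \<epsilon> x}"

text \<open>The set of the model with the given elements; meaningful only if there is one.\<close>
definition mkset :: "'v set \<Rightarrow> 'v" where
  "mkset A = (THE x. elts x = A)"

text \<open>Class functions are the ones definable by a formula with parameters.\<close>
definition class_function :: "('v \<Rightarrow> 'v) \<Rightarrow> bool" where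
  "class_function F \<longleftrightarrow> (\<exists>p e. \<forall>x y. F x = y \<longleftrightarrow> sat mem p (e(0 := x, 1 := y)))"

definition empty :: 'v where
  "empty = mkset {}"

definition succ :: "'v \<Rightarrow> 'v" where
  "succ x = mkset (insert x (elts x))"

definition is_inductive :: "'v \<Rightarrow> bool" where
  "is_inductive w \<longleftrightarrow> empty \<epsilon> w \<and> (\<forall>x. x \<epsilon> w \<longrightarrow> succ x \<epsilon> w)"

definition omega :: 'v where
  "omega = mkset {x. \<forall>w. is_inductive w \<longrightarrow> x \<epsilon> w}"

definition pair :: "'v \<Rightarrow> 'v \<Rightarrow> 'v" where
  "pair x y = mkset {mkset {x}, mkset {x, y}}"

definition union :: "'v \<Rightarrow> 'v" where
  "union x = mkset (\<Union>y\<in>elts x. elts y)"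

definition is_function :: "'v \<Rightarrow> 'v \<Rightarrow> bool" where
  "is_function f X \<longleftrightarrow> (\<forall>p\<in>elts f. \<exists>x\<in>elts X. \<exists>y. p = pair x y)
     \<and> (\<forall>x\<in>elts X. \<exists>!y. pair x y \<epsilon> f)"

definition app :: "'v \<Rightarrow> 'v \<Rightarrow> 'v" where
  "app f x = (THE y. pair x y \<epsilon> f)"

definition is_bijection :: "'v \<Rightarrow> 'v \<Rightarrow> 'v \<Rightarrow> bool" where
  "is_bijection f X Y \<longleftrightarrow> is_function f X \<and> bij_betw (app f) (elts X) (elts Y)"

definition const_fun :: "'v \<Rightarrow> 'v \<Rightarrow> 'v" where
  "const_fun X a = mkset {pair x a | x. x \<epsilon> X}"

definition id_fun :: "'v \<Rightarrow> 'v" where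
  "id_fun X = mkset {pair x x | x. x \<epsilon> X}"

definition transitive_set :: "'v \<Rightarrow> bool" where
  "transitive_set x \<longleftrightarrow> (\<forall>y\<in>elts x. elts y \<subseteq> elts x)"

definition ordinal :: "'v \<Rightarrow> bool" where
  "ordinal x \<longleftrightarrow> transitive_set x \<and> (\<forall>y\<in>elts x. transitive_set y)"

text \<open>\<open>n_subsets \<kappa> n\<close> is \<open>[\<kappa>]\<^sup>n\<close>, for \<open>n\<close> in the \<open>\<omega>\<close> of the model.\<close>
definition n_subsets :: "'v \<Rightarrow> 'v \<Rightarrow> 'v" where
  "n_subsets \<kappa> n = mkset {a. elts a \<subseteq> elts \<kappa> \<and> (\<exists>f. is_bijection f n a)}"

definition fso_less :: "'v \<Rightarrow> 'v \<Rightarrow> bool" where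
  "fso_less a b \<longleftrightarrow> (\<exists>\<xi>. \<xi> \<epsilon> b \<and> \<not> \<xi> \<epsilon> a
     \<and> (\<forall>\<eta>\<in>(elts a - elts b) \<union> (elts b - elts a). \<eta> \<epsilon> \<xi> \<or> \<eta> = \<xi>))"

text \<open>
  \<open>W\<close> is an ultrafilter on the subsets of \<open>X\<close> lying in the transitive class \<open>N\<close>; \<open>W\<close> is
  a set but need not belong to \<open>N\<close>.
\<close>
definition ultrafilter_over :: "'v set \<Rightarrow> 'v \<Rightarrow> 'v \<Rightarrow> bool" where
  "ultrafilter_over N X W \<longleftrightarrow>
     X \<in> N \<and> elts W \<subseteq> {A \<in> N. elts A \<subseteq> elts X}
     \<and> X \<epsilon> W \<and> \<not> empty \<epsilon> W
     \<and> (\<forall>A B. A \<epsilon> W \<and> B \<in> N \<and> elts A \<subseteq> elts B \<and> elts B \<subseteq> elts X \<longrightarrow> B \<epsilon> W)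
     \<and> (\<forall>A B. A \<epsilon> W \<and> B \<epsilon> W \<longrightarrow> mkset (elts A \<inter> elts B) \<epsilon> W)
     \<and> (\<forall>A\<in>N. elts A \<subseteq> elts X \<longrightarrow> A \<epsilon> W \<or> mkset (elts X - elts A) \<epsilon> W)"

text \<open>Countable completeness of \<open>W\<close> in the sense of \<open>(N, W)\<close>: only sequences in \<open>N\<close> matter.\<close>
definition countably_complete :: "'v set \<Rightarrow> 'v \<Rightarrow> bool" where
  "countably_complete N W \<longleftrightarrow>
     (\<forall>s\<in>N. is_function s omega \<and> (\<forall>i\<in>elts omega. app s i \<epsilon> W)
        \<longrightarrow> mkset (\<Inter>i\<in>elts omega. elts (app s i)) \<epsilon> W)"

definition cc_ultrafilter :: "'v set \<Rightarrow> 'v \<Rightarrow> 'v \<Rightarrow> bool" where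
  "cc_ultrafilter N X W \<longleftrightarrow> ultrafilter_over N X W \<and> countably_complete N W"

definition uniform_ultrafilter :: "'v \<Rightarrow> bool" where
  "uniform_ultrafilter U \<longleftrightarrow>
     (\<exists>\<kappa> n. ordinal \<kappa> \<and> n \<epsilon> omega \<and> cc_ultrafilter UNIV (n_subsets \<kappa> n) U
        \<and> (\<forall>\<alpha>\<in>elts \<kappa>. \<not> n_subsets \<alpha> n \<epsilon> U))"

text \<open>
  Ultrapowers of a transitive class \<open>N\<close> by \<open>W\<close>, formed with the functions in \<open>N\<close>. The
  underlying set of \<open>W\<close> is recovered as \<open>union W\<close>.
\<close>
definition ult_functions :: "'v set \<Rightarrow> 'v \<Rightarrow> 'v set" where
  "ult_functions N W = {f \<in> N. is_function f (union W)}"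

definition ult_mem :: "'v \<Rightarrow> 'v \<Rightarrow> 'v \<Rightarrow> bool" where
  "ult_mem W f g \<longleftrightarrow> mkset {x. x \<epsilon> union W \<and> app f x \<epsilon> app g x} \<epsilon> W"

text \<open>
  \<open>c\<close> sends each function representing an element of the ultrapower to the image of that element
  under the transitive collapse. The equation gives functions that are equal modulo \<open>W\<close>
  the same value, since they have the same \<open>ult_mem\<close>-predecessors. Definability of \<open>c\<close> is what
  makes its values on \<open>ult_functions N W\<close> unique when the model is not wellfounded.
\<close>
definition ult_collapse :: "'v set \<Rightarrow> 'v \<Rightarrow> ('v \<Rightarrow> 'v) \<Rightarrow> bool" where
  "ult_collapse N W c \<longleftrightarrow> class_function c \<and>
     (\<forall>g\<in>ult_functions N W. elts (c g) = c ` {f \<in> ult_functions N W. ult_mem W f g})"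

definition Ult :: "'v set \<Rightarrow> 'v \<Rightarrow> ('v \<Rightarrow> 'v) \<Rightarrow> 'v set" where
  "Ult N W c = c ` ult_functions N W"

definition ult_embedding :: "'v \<Rightarrow> ('v \<Rightarrow> 'v) \<Rightarrow> 'v \<Rightarrow> 'v" where
  "ult_embedding W c a = c (const_fun (union W) a)"

definition id_class :: "'v \<Rightarrow> ('v \<Rightarrow> 'v) \<Rightarrow> 'v" where
  "id_class W c = c (id_fun (union W))"

text \<open>
  The collapses \<open>c\<^sub>i\<close> of \<open>Ult(V, U\<^sub>i)\<close> and \<open>d\<^sub>i\<close> of \<open>Ult(Ult(V, U\<^sub>i), W\<^sub>i)\<close> are carried along
  explicitly; they are determined by the ultrafilters.
\<close>
definition external_comparison ::
    "'v \<Rightarrow> ('v \<Rightarrow> 'v) \<Rightarrow> 'v \<Rightarrow> ('v \<Rightarrow> 'v) \<Rightarrow> 'v \<Rightarrow> ('v \<Rightarrow> 'v) \<Rightarrow> 'v \<Rightarrow> ('v \<Rightarrow> 'v) \<Rightarrow> bool" where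
  "external_comparison U\<^sub>0 c\<^sub>0 U\<^sub>1 c\<^sub>1 W\<^sub>0 d\<^sub>0 W\<^sub>1 d\<^sub>1 \<longleftrightarrow>
     ult_collapse UNIV U\<^sub>0 c\<^sub>0 \<and> ult_collapse UNIV U\<^sub>1 c\<^sub>1
     \<and> (\<exists>X\<^sub>0. cc_ultrafilter (Ult UNIV U\<^sub>0 c\<^sub>0) X\<^sub>0 W\<^sub>0)
     \<and> (\<exists>X\<^sub>1. cc_ultrafilter (Ult UNIV U\<^sub>1 c\<^sub>1) X\<^sub>1 W\<^sub>1)
     \<and> ult_collapse (Ult UNIV U\<^sub>0 c\<^sub>0) W\<^sub>0 d\<^sub>0 \<and> ult_collapse (Ult UNIV U\<^sub>1 c\<^sub>1) W\<^sub>1 d\<^sub>1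
     \<and> Ult (Ult UNIV U\<^sub>0 c\<^sub>0) W\<^sub>0 d\<^sub>0 = Ult (Ult UNIV U\<^sub>1 c\<^sub>1) W\<^sub>1 d\<^sub>1
     \<and> ult_embedding W\<^sub>0 d\<^sub>0 \<circ> ult_embedding U\<^sub>0 c\<^sub>0 = ult_embedding W\<^sub>1 d\<^sub>1 \<circ> ult_embedding U\<^sub>1 c\<^sub>1"

definition E_less :: "'v \<Rightarrow> 'v \<Rightarrow> bool" where
  "E_less U\<^sub>0 U\<^sub>1 \<longleftrightarrow>
     (\<exists>c\<^sub>0 c\<^sub>1 W\<^sub>0 d\<^sub>0 W\<^sub>1 d\<^sub>1. external_comparison U\<^sub>0 c\<^sub>0 U\<^sub>1 c\<^sub>1 W\<^sub>0 d\<^sub>0 W\<^sub>1 d\<^sub>1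
        \<and> W\<^sub>1 \<in> Ult UNIV U\<^sub>1 c\<^sub>1
        \<and> fso_less (ult_embedding W\<^sub>0 d\<^sub>0 (id_class U\<^sub>0 c\<^sub>0)) (ult_embedding W\<^sub>1 d\<^sub>1 (id_class U\<^sub>1 c\<^sub>1)))"

end

locale zfc_model = set_structure mem for mem :: "'v \<Rightarrow> 'v \<Rightarrow> bool" (infix "\<epsilon>" 50) +
  assumes extensionality: "\<And>x y. (\<forall>z. z \<epsilon> x \<longleftrightarrow> z \<epsilon> y) \<Longrightarrow> x = y"
    and foundation: "\<And>x. \<exists>y. y \<epsilon> x \<Longrightarrow> \<exists>y. y \<epsilon> x \<and> \<not> (\<exists>z. z \<epsilon> x \<and> z \<epsilon> y)"
    and pairing: "\<And>x y. \<exists>z. \<forall>w. w \<epsilon> z \<longleftrightarrow> w = x \<or> w = y"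
    and union_axiom: "\<And>x. \<exists>u. \<forall>z. z \<epsilon> u \<longleftrightarrow> (\<exists>y. y \<epsilon> x \<and> z \<epsilon> y)"
    and power_set: "\<And>x. \<exists>p. \<forall>z. z \<epsilon> p \<longleftrightarrow> (\<forall>w. w \<epsilon> z \<longrightarrow> w \<epsilon> x)"
    and infinity: "\<exists>w. (\<exists>x. x \<epsilon> w \<and> (\<forall>y. \<not> y \<epsilon> x))
      \<and> (\<forall>x. x \<epsilon> w \<longrightarrow> (\<exists>y. y \<epsilon> w \<and> (\<forall>z. z \<epsilon> y \<longleftrightarrow> z \<epsilon> x \<or> z = x)))"
    and separation: "\<And>p e a. \<exists>b. \<forall>x. x \<epsilon> b \<longleftrightarrow> x \<epsilon> a \<and> sat (\<epsilon>) p (e(0 := x))"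
    and replacement: "\<And>p e a. (\<forall>x. x \<epsilon> a \<longrightarrow> (\<exists>!y. sat (\<epsilon>) p (e(0 := x, 1 := y))))
      \<Longrightarrow> \<exists>b. \<forall>y. y \<epsilon> b \<longleftrightarrow> (\<exists>x. x \<epsilon> a \<and> sat (\<epsilon>) p (e(0 := x, 1 := y)))"
    and choice: "\<And>x. (\<forall>y. y \<epsilon> x \<longrightarrow> (\<exists>z. z \<epsilon> y))
        \<and> (\<forall>y y'. y \<epsilon> x \<and> y' \<epsilon> x \<and> y \<noteq> y' \<longrightarrow> \<not> (\<exists>z. z \<epsilon> y \<and> z \<epsilon> y'))
      \<Longrightarrow> \<exists>c. \<forall>y. y \<epsilon> x \<longrightarrow> (\<exists>!z. z \<epsilon> y \<and> z \<epsilon> c)"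

end

theory Submission
  imports Defs
begin

text \<open>
  Suppose \<open>U' <\<^sub>E U\<close> via \<open>\<langle>W\<^sub>0, W\<^sub>1\<rangle>\<close> with \<open>W\<^sub>1\<close> in \<open>M = Ult(V, U)\<close>. Write \<open>W\<^sub>1 = [a \<mapsto> w a]\<close> and let
  \<open>(a, y) \<mapsto> F (a, y)\<close> represent \<open>j\<^bsub>W\<^sub>0\<^esub>([id]\<^bsub>U'\<^esub>)\<close> in \<open>Ult(M, W\<^sub>1)\<close>. Pushing \<open>w a\<close> forward along \<open>F (a, -)\<close>
  gives filters \<open>K a\<close> such that \<open>U'\<close> is contained in the \<open>U\<close>-limit of the \<open>K a\<close>, and for \<open>U\<close>-almost all \<open>a\<close>
  the filter \<open>K a\<close> is countably complete and concentrates on the predecessors of \<open>a\<close>: the \<open>E\<close>-order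
  refines to a combinatorial order that no longer mentions ultrapowers.

  Given a descending sequence with such kernels \<open>K\<^sub>n\<close>, call \<open>a\<close> good at stage \<open>n\<close> if \<open>K\<^sub>n a\<close> is
  as above, and let \<open>R\<^sub>n\<close> be the set of the \<open>a\<close> that are hereditarily good along the kernels, to every finite
  depth. Countable completeness makes \<open>R\<^sub>0\<close> nonempty and gives every \<open>a\<close> in \<open>R\<^sub>n\<close> a predecessor
  in \<open>R\<^bsub>n+1\<^esub>\<close>, against the wellfoundedness of the order on finite sets of ordinals.

  The model may be nonstandard, so all recursions, inductions and choices take place in it and
  require the definability of the predicates involved.
\<close>

section \<open>Definability\<close>

text \<open>\<open>E_less\<close> quantifies over class functions, the collapses, so as it stands it
  is not a formula to which recursion or choice of the model could be applied. A kernel is a set,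
  and being a kernel is a first-order property; a descending sequence in the model therefore yields
  a sequence of kernels in the model.

  The two sides of a comparison enter asymmetrically. \<open>W\<^sub>0\<close> may lie outside its
  ultrapower and then has no representing function; it enters through the image of the seed, which
  the equality of the targets places in the other iterated ultrapower and the commutation relates to
  the sets in \<open>U'\<close>. \<open>W\<^sub>1\<close> has a representing function, which is what
  1-internality provides, and the kernels are made from its fibres.

  That \<open>U'\<close> is contained in the limit lets a large set at one stage be pulled back to a
  large set at the preceding stage. Largeness travels in this direction only, which is why
  hereditary goodness is built up by depth.\<close>

primrec ren :: "(nat \<Rightarrow> nat) \<Rightarrow> fm \<Rightarrow> fm" where
  "ren \<rho> (Mem i j) = Mem (\<rho> i) (\<rho> j)"
| "ren \<rho> (Eq i j) = Eq (\<rho> i) (\<rho> j)"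
| "ren \<rho> (Neg p) = Neg (ren \<rho> p)"
| "ren \<rho> (Conj p q) = Conj (ren \<rho> p) (ren \<rho> q)"
| "ren \<rho> (Exi i p) = Exi (\<rho> i) (ren \<rho> p)"

text \<open>Bound variables are named, so a renaming that is not injective could make the quantifier
  over \<open>\<rho> i\<close> capture another variable.\<close>

lemma sat_ren: "inj \<rho> \<Longrightarrow> sat m (ren \<rho> p) e \<longleftrightarrow> sat m p (e \<circ> \<rho>)"
proof (induction p arbitrary: e)
  case (Exi i p)
  have "e(\<rho> i := x) \<circ> \<rho> = (e \<circ> \<rho>)(i := x)" for x
    using Exi.prems by (auto simp: fun_eq_iff inj_def)
  then show ?case using Exi.IH[OF Exi.prems] by (simp only: ren.simps sat.simps)
qed auto

context set_structure
begin

definition atomic_term :: "((nat \<Rightarrow> 'v) \<Rightarrow> 'v) \<Rightarrow> bool" where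
  "atomic_term t \<longleftrightarrow> (\<exists>i. t = (\<lambda>e. e i)) \<or> (\<exists>a. t = (\<lambda>e. a))"

text \<open>
  The constant atomic terms are the parameters. Bound variables are de Bruijn indices, so that the
  closure rules can be applied by \<open>intro\<close> to predicates written with ordinary quantifiers.
\<close>
inductive definable :: "((nat \<Rightarrow> 'v) \<Rightarrow> bool) \<Rightarrow> bool" where
  mem: "atomic_term s \<Longrightarrow> atomic_term t \<Longrightarrow> definable (\<lambda>e. s e \<epsilon> t e)"
| eq: "atomic_term s \<Longrightarrow> atomic_term t \<Longrightarrow> definable (\<lambda>e. s e = t e)"
| neg: "definable P \<Longrightarrow> definable (\<lambda>e. \<not> P e)"
| conj: "definable P \<Longrightarrow> definable Q \<Longrightarrow> definable (\<lambda>e. P e \<and> Q e)"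
| ex: "definable (\<lambda>e. P (\<lambda>i. e (Suc i)) (e 0)) \<Longrightarrow> definable (\<lambda>e. \<exists>x. P e x)"

definition definable_term :: "((nat \<Rightarrow> 'v) \<Rightarrow> 'v) \<Rightarrow> bool" where
  "definable_term t \<longleftrightarrow> definable (\<lambda>e. t (\<lambda>i. e (Suc i)) = e 0)"

lemma atomic_lift: "atomic_term t \<Longrightarrow> atomic_term (\<lambda>e. t (\<lambda>i. e (Suc i)))"
  by (auto simp: atomic_term_def)

lemma atomic_var [intro, simp]: "atomic_term (\<lambda>e. e i)"
  and atomic_const [intro, simp]: "atomic_term (\<lambda>e. a)"
  by (auto simp: atomic_term_def)

text \<open>Covers weakening and exchange of de Bruijn variables as well as the insertion of
  parameters. Under a quantifier, index 0 is kept and the substituted terms are lifted.\<close>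

lemma definable_subst:
  "definable P \<Longrightarrow> (\<And>i. atomic_term (t i)) \<Longrightarrow> definable (\<lambda>e. P (\<lambda>i. t i e))"
proof (induction P arbitrary: t rule: definable.induct)
  case (mem s s')
  then show ?case by (auto simp: atomic_term_def intro!: definable.mem)
next
  case (eq s s')
  then show ?case by (auto simp: atomic_term_def intro!: definable.eq)
next
  case (neg P)
  show ?case by (rule definable.neg, rule neg.IH, rule neg.prems)
next
  case (conj P Q)
  show ?case by (rule definable.conj; (rule conj.IH, rule conj.prems))
next
  case (ex P)
  let ?t = "\<lambda>i. case i of 0 \<Rightarrow> (\<lambda>e. e 0) | Suc k \<Rightarrow> (\<lambda>e. t k (\<lambda>i. e (Suc i)))"
  have "atomic_term (?t i)" for i
    using ex.prems by (auto split: nat.split intro: atomic_lift)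
  from ex.IH[of ?t, OF this] show ?case
    by (intro definable.ex) (simp del: atomic_var atomic_const)
qed

text \<open>Formulas of the model's language have named variables. Allowing an atomic term in the
  place of every variable lets the quantifier over \<open>k\<close> redirect \<open>k\<close> to the
  bound index 0.\<close>

lemma definable_sat: "(\<And>i. atomic_term (t i)) \<Longrightarrow> definable (\<lambda>e. sat (\<epsilon>) p (\<lambda>i. t i e))"
proof (induction p arbitrary: t)
  case (Exi k p)
  let ?t = "\<lambda>i. if i = k then (\<lambda>e. e 0) else (\<lambda>e. t i (\<lambda>i. e (Suc i)))"
  have "atomic_term (?t i)" for i
    using Exi.prems by (auto intro: atomic_lift)
  from Exi.IH[of ?t, OF this]
  have "definable (\<lambda>e. sat (\<epsilon>) p ((\<lambda>i. t i (\<lambda>i. e (Suc i)))(k := e 0)))"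
    by (rule back_subst[of definable])
       (auto simp: fun_eq_iff intro!: arg_cong[of _ _ "sat (\<epsilon>) p"])
  then show ?case by (auto intro: definable.ex)
next
  case (Neg p)
  then show ?case by (simp add: definable.neg)
next
  case (Conj p q)
  then show ?case by (simp add: definable.conj)
qed (auto intro: definable.mem definable.eq)

text \<open>\<open>sat\<close> has a single environment, which must hold both the variables and the
  parameters of a definable predicate; interleaving keeps infinitely many places free for
  each.\<close>

definition mix :: "(nat \<Rightarrow> 'a) \<Rightarrow> (nat \<Rightarrow> 'a) \<Rightarrow> nat \<Rightarrow> 'a" where
  "mix e r i = (if even i then e (i div 2) else r (i div 2))"

lemma mix_even [simp]: "mix e r (2 * i) = e i"
  and mix_odd [simp]: "mix e r (Suc (2 * i)) = r i"
  and mix_0 [simp]: "mix e r 0 = e 0"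
  by (simp_all add: mix_def)

lemma even_odd_cases:
  fixes i :: nat
  obtains j where "i = 2 * j" | j where "i = Suc (2 * j)"
  by (metis evenE oddE Suc_eq_plus1)

text \<open>The converse of \<open>definable_sat\<close>: it makes the axiom schemes applicable to
  definable predicates. Subformulas come with their own parameters, which have to be renamed apart
  before they are combined.\<close>

lemma definable_repr: "definable P \<Longrightarrow> \<exists>p r. \<forall>e. P e \<longleftrightarrow> sat (\<epsilon>) p (mix e r)"
proof (induction P rule: definable.induct)
  have at2: "\<exists>i j r. \<forall>e. mix e r i = s e \<and> mix e r j = t e"
    if s: "atomic_term s" and t: "atomic_term t" for s t
  proof -
    obtain k a where k: "\<forall>e r. r 0 = a \<longrightarrow> mix e r k = s e"
      using s unfolding atomic_term_def by (metis mix_even mix_odd)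
    obtain l b where l: "\<forall>e r. r 1 = b \<longrightarrow> mix e r l = t e"
      using t unfolding atomic_term_def by (metis mix_even mix_odd)
    show ?thesis
      using k l by (intro exI[of _ k] exI[of _ l] exI[of _ "\<lambda>i. if i = 0 then a else b"]) simp
  qed
  {
    case (mem s t)
    then obtain i j r where "\<forall>e. mix e r i = s e \<and> mix e r j = t e" using at2 by blast
    then show ?case by (intro exI[of _ "Mem i j"] exI[of _ r]) simp
  next
    case (eq s t)
    then obtain i j r where "\<forall>e. mix e r i = s e \<and> mix e r j = t e" using at2 by blast
    then show ?case by (intro exI[of _ "Eq i j"] exI[of _ r]) simp
  }
next
  case (neg P)
  then obtain p r where "\<forall>e. P e \<longleftrightarrow> sat (\<epsilon>) p (mix e r)" by blast
  then show ?case by (intro exI[of _ "Neg p"] exI[of _ r]) simp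
next
  case (conj P Q)
  then obtain p r q s where
    p: "\<And>e. P e \<longleftrightarrow> sat (\<epsilon>) p (mix e r)" and
    q: "\<And>e. Q e \<longleftrightarrow> sat (\<epsilon>) q (mix e s)" by blast
  \<comment> \<open>\<open>f\<close> and \<open>g\<close> fix the places of variables; they send
    parameter \<open>j\<close> of \<open>p\<close> to parameter \<open>2 * j\<close> and parameter
    \<open>j\<close> of \<open>q\<close> to parameter \<open>Suc (2 * j)\<close>, where
    \<open>mix r s\<close> has them.\<close>
  define f :: "nat \<Rightarrow> nat" where "f i = mix (\<lambda>j. 2 * j) (\<lambda>j. Suc (2 * (2 * j))) i" for i
  define g :: "nat \<Rightarrow> nat" where "g i = mix (\<lambda>j. 2 * j) (\<lambda>j. Suc (2 * Suc (2 * j))) i" for i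
  have "f i = f j \<Longrightarrow> i = j" for i j
    by (rule even_odd_cases[of i]; rule even_odd_cases[of j]; simp add: f_def; presburger)
  then have f: "inj f" by (auto simp: inj_def)
  have "g i = g j \<Longrightarrow> i = j" for i j
    by (rule even_odd_cases[of i]; rule even_odd_cases[of j]; simp add: g_def; presburger)
  then have g: "inj g" by (auto simp: inj_def)
  have f1: "mix e (mix r s) \<circ> f = mix e r" for e
  proof
    fix i show "(mix e (mix r s) \<circ> f) i = mix e r i"
      by (rule even_odd_cases[of i]; simp only: o_apply f_def mix_even mix_odd)
  qed
  have g1: "mix e (mix r s) \<circ> g = mix e s" for e
  proof
    fix i show "(mix e (mix r s) \<circ> g) i = mix e s i"
      by (rule even_odd_cases[of i]; simp only: o_apply g_def mix_even mix_odd)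
  qed
  show ?case
    by (intro exI[of _ "Conj (ren f p) (ren g q)"] exI[of _ "mix r s"])
       (simp add: sat_ren f g f1 g1 p q)
next
  case (ex P)
  then obtain p r where p: "\<And>e. P (\<lambda>i. e (Suc i)) (e 0) \<longleftrightarrow> sat (\<epsilon>) p (mix e r)" by blast
  \<comment> \<open>The bound variable, at place 0 in \<open>p\<close>, moves to place 1, the first
    parameter place; the other variables shift down by one and the parameters up by one to make
    room.\<close>
  define f :: "nat \<Rightarrow> nat" where
    "f i = mix (case_nat 1 (\<lambda>j. 2 * j)) (\<lambda>j. Suc (2 * Suc j)) i" for i
  have "f i = f j \<Longrightarrow> i = j" for i j
    by (rule even_odd_cases[of i]; rule even_odd_cases[of j]; simp add: f_def split: nat.splits; presburger)
  then have f: "inj f" by (auto simp: inj_def)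
  have "P e x \<longleftrightarrow> sat (\<epsilon>) (ren f p) ((mix e (case_nat x r))(1 := x))" for e x
  proof -
    have "((mix e (case_nat x r))(1 := x) \<circ> f) i = mix (case_nat x e) r i" for i
    proof (rule even_odd_cases[of i])
      fix j assume i: "i = 2 * j"
      have "Suc 0 \<noteq> 2 * k" for k :: nat by presburger
      then show ?thesis unfolding i by (cases j) (simp_all add: f_def del: mult_Suc_right)
    qed (simp add: f_def del: mult_Suc_right)
    then have "(mix e (case_nat x r))(1 := x) \<circ> f = mix (case_nat x e) r" by auto
    then show ?thesis using p[of "case_nat x e"] by (simp add: sat_ren f)
  qed
  \<comment> \<open>Parameter 0 sits at place 1 and is overwritten by the quantifier, so its value,
    here \<open>undefined\<close>, is arbitrary.\<close>
  moreover have "(mix e (case_nat x r))(1 := x) = (mix e (case_nat undefined r))(1 := x)" for e x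
  proof
    fix i
    show "((mix e (case_nat x r))(1 := x)) i = ((mix e (case_nat undefined r))(1 := x)) i"
      by (rule even_odd_cases[of i]) (auto split: nat.split)
  qed
  ultimately show ?case
    by (intro exI[of _ "Exi 1 (ren f p)"] exI[of _ "case_nat undefined r"]) simp
qed

end

named_theorems definable_intros

section \<open>Closure rules for definable predicates and terms\<close>

context set_structure
begin

lemma definable_shift1:
  assumes "definable (\<lambda>e. P (\<lambda>i. e (Suc i)) (e 0))"
  shows "definable (\<lambda>e. P (\<lambda>i. e (Suc (Suc i))) (e 0))"
  using definable_subst[OF assms, of "case_nat (\<lambda>e. e 0) (\<lambda>i e. e (Suc (Suc i)))"]
  by (simp split: nat.split)

lemma definable_term_shift:
  "definable_term t \<Longrightarrow> definable_term (\<lambda>e. t (\<lambda>i. e (Suc i)))"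
  unfolding definable_term_def by (rule definable_shift1)

lemmas definable_term_shifts = definable_term_shift
  definable_term_shift[THEN definable_term_shift]
  definable_term_shift[THEN definable_term_shift, THEN definable_term_shift]

text \<open>Substituting a definable term amounts to
  \<open>\<exists>x. t e = x \<and> P e x\<close>; this extends the rules from atomic terms to all
  definable ones.\<close>

lemma definable_let:
  assumes "definable (\<lambda>e. P (\<lambda>i. e (Suc i)) (e 0))" and "definable_term t"
  shows "definable (\<lambda>e. P e (t e))"
proof -
  have "definable (\<lambda>e. \<exists>x. t e = x \<and> P e x)"
    using assms unfolding definable_term_def by (intro definable.ex definable.conj)
  then show ?thesis by simp
qed

lemma definable_Not [definable_intros]: "definable P \<Longrightarrow> definable (\<lambda>e. \<not> P e)"
  by (rule definable.neg)

lemma definable_And [definable_intros]: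
  "definable P \<Longrightarrow> definable Q \<Longrightarrow> definable (\<lambda>e. P e \<and> Q e)"
  by (rule definable.conj)

lemma definable_Ex [definable_intros]:
  "definable (\<lambda>e. P (\<lambda>i. e (Suc i)) (e 0)) \<Longrightarrow> definable (\<lambda>e. \<exists>x. P e x)"
  by (rule definable.ex)

lemma definable_closed: "definable (\<lambda>e. b)"
proof -
  have T: "definable (\<lambda>e. e 0 = e 0)" by (rule definable.eq) simp_all
  show ?thesis using T definable.neg[OF T] by (cases b) simp_all
qed

lemma definable_Or [definable_intros]:
  "definable P \<Longrightarrow> definable Q \<Longrightarrow> definable (\<lambda>e. P e \<or> Q e)"
  using definable.neg[OF definable.conj[OF definable.neg definable.neg], of P Q] by simp

lemma definable_Imp [definable_intros]:
  "definable P \<Longrightarrow> definable Q \<Longrightarrow> definable (\<lambda>e. P e \<longrightarrow> Q e)"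
  using definable.neg[OF definable.conj[OF _ definable.neg], of P Q] by simp

lemma definable_Iff [definable_intros]:
  "definable P \<Longrightarrow> definable Q \<Longrightarrow> definable (\<lambda>e. P e \<longleftrightarrow> Q e)"
  unfolding iff_conv_conj_imp by (intro definable_intros)

lemma definable_All [definable_intros]:
  "definable (\<lambda>e. P (\<lambda>i. e (Suc i)) (e 0)) \<Longrightarrow> definable (\<lambda>e. \<forall>x. P e x)"
  using definable.neg[OF definable.ex[OF definable.neg], of P] by simp

lemma definable_term_var [definable_intros]: "definable_term (\<lambda>e. e i)"
  unfolding definable_term_def by (rule definable.eq) simp_all

lemma definable_term_const [definable_intros]: "definable_term (\<lambda>e. a)"
  unfolding definable_term_def by (rule definable.eq) simp_all

lemma definable_mem [definable_intros]:
  assumes "definable_term s" "definable_term t"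
  shows "definable (\<lambda>e. s e \<epsilon> t e)"
  by (rule definable_let[where P = "\<lambda>e x. x \<epsilon> t e", OF _ assms(1)],
      rule definable_let[where P = "\<lambda>e x. e 0 \<epsilon> x" and t = "\<lambda>e. t (\<lambda>i. e (Suc i))",
        OF _ definable_term_shift[OF assms(2)]], rule definable.mem) simp_all

lemma definable_eq [definable_intros]:
  assumes "definable_term s" "definable_term t"
  shows "definable (\<lambda>e. s e = t e)"
  by (rule definable_let[where P = "\<lambda>e x. x = t e", OF _ assms(1)],
      rule definable_let[where P = "\<lambda>e x. e 0 = x" and t = "\<lambda>e. t (\<lambda>i. e (Suc i))",
        OF _ definable_term_shift[OF assms(2)]], rule definable.eq) simp_all

lemma definable_term_let:
  assumes "definable_term (\<lambda>e. s (\<lambda>i. e (Suc i)) (e 0))" and t: "definable_term t"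
  shows "definable_term (\<lambda>e. s e (t e))"
  unfolding definable_term_def
proof (rule definable_let[where P = "\<lambda>e x. s (\<lambda>i. e (Suc i)) x = e 0", OF _ definable_term_shift[OF t]])
  show "definable (\<lambda>e. s (\<lambda>i. e (Suc (Suc i))) (e 0) = e (Suc 0))"
    using definable_subst[OF assms(1)[unfolded definable_term_def],
        of "case_nat (\<lambda>e. e (Suc 0)) (case_nat (\<lambda>e. e 0) (\<lambda>i e. e (Suc (Suc i))))"]
    by (simp split: nat.split)
qed

lemma elts_iff [simp]: "x \<in> elts a \<longleftrightarrow> x \<epsilon> a"
  by (simp add: elts_def)

lemma definable_in_elts [definable_intros]:
  "definable_term s \<Longrightarrow> definable_term t \<Longrightarrow> definable (\<lambda>e. s e \<in> elts (t e))"
  unfolding elts_iff by (rule definable_mem)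

lemma definable_ball [definable_intros]:
  assumes "definable_term t" "definable (\<lambda>e. P (\<lambda>i. e (Suc i)) (e 0))"
  shows "definable (\<lambda>e. \<forall>x\<in>elts (t e). P e x)"
  unfolding Ball_def using assms by (intro definable_intros definable_term_shift)

lemma definable_bex [definable_intros]:
  assumes "definable_term t" "definable (\<lambda>e. P (\<lambda>i. e (Suc i)) (e 0))"
  shows "definable (\<lambda>e. \<exists>x\<in>elts (t e). P e x)"
  unfolding Bex_def using assms by (intro definable_intros definable_term_shift)

lemma definable_subset [definable_intros]:
  assumes "definable_term s" "definable_term t"
  shows "definable (\<lambda>e. elts (s e) \<subseteq> elts (t e))"
  unfolding subset_iff using assms by (intro definable_intros definable_term_shift)

definition definable_pred where "definable_pred P \<longleftrightarrow> definable (\<lambda>e. P (e 0))"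
definition definable_rel where "definable_rel P \<longleftrightarrow> definable (\<lambda>e. P (e 0) (e (Suc 0)))"
definition definable_fun where "definable_fun F \<longleftrightarrow> definable_term (\<lambda>e. F (e 0))"
definition definable_op where "definable_op F \<longleftrightarrow> definable_term (\<lambda>e. F (e 0) (e (Suc 0)))"

lemma definable_ex1 [definable_intros]:
  assumes "definable (\<lambda>e. P (\<lambda>i. e (Suc i)) (e 0))"
  shows "definable (\<lambda>e. \<exists>!x. P e x)"
proof -
  have "definable (\<lambda>e. P (\<lambda>i. e (Suc (Suc i))) (e 0))"
    using definable_shift1[OF assms] .
  then have "definable (\<lambda>e. \<exists>x. P e x \<and> (\<forall>y. P e y \<longrightarrow> y = x))"
    using assms by (intro definable_intros)
  then show ?thesis by (simp add: Ex1_def)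
qed

lemma definable_predD:
  assumes "definable_pred P" "definable_term t"
  shows "definable (\<lambda>e. P (t e))"
  by (rule definable_let[where P = "\<lambda>e x. P x", OF _ assms(2)])
     (use assms(1) in \<open>simp add: definable_pred_def\<close>)

lemma definable_relD:
  assumes "definable_rel P" "definable_term s" "definable_term t"
  shows "definable (\<lambda>e. P (s e) (t e))"
proof (rule definable_let[where P = "\<lambda>e x. P x (t e)", OF _ assms(2)],
    rule definable_let[where P = "\<lambda>e x. P (e 0) x" and t = "\<lambda>e. t (\<lambda>i. e (Suc i))",
        OF _ definable_term_shift[OF assms(3)]])
  show "definable (\<lambda>e. P (e (Suc 0)) (e 0))"
    using definable_subst[OF assms(1)[unfolded definable_rel_def],
        of "case_nat (\<lambda>e. e (Suc 0)) (\<lambda>i e. e 0)"]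
    by (simp split: nat.split)
qed

lemma definable_funD:
  assumes "definable_fun F" "definable_term t"
  shows "definable_term (\<lambda>e. F (t e))"
  by (rule definable_term_let[where s = "\<lambda>e x. F x", OF _ assms(2)])
     (use assms(1) in \<open>simp add: definable_fun_def\<close>)

lemma definable_opD:
  assumes "definable_op F" "definable_term s" "definable_term t"
  shows "definable_term (\<lambda>e. F (s e) (t e))"
proof (rule definable_term_let[where s = "\<lambda>e x. F x (t e)", OF _ assms(2)],
    rule definable_term_let[where s = "\<lambda>e x. F (e 0) x" and t = "\<lambda>e. t (\<lambda>i. e (Suc i))",
        OF _ definable_term_shift[OF assms(3)]])
  show "definable_term (\<lambda>e. F (e (Suc 0)) (e 0))"
    unfolding definable_term_def
    using definable_subst[OF assms(1)[unfolded definable_op_def definable_term_def],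
        of "case_nat (\<lambda>e. e 0) (case_nat (\<lambda>e. e (Suc (Suc 0))) (\<lambda>i e. e (Suc 0)))"]
    by (simp split: nat.split)
qed

lemma class_function_definable: "class_function F \<Longrightarrow> definable_fun F"
proof -
  assume "class_function F"
  then obtain p e where pe: "\<And>x y. F x = y \<longleftrightarrow> sat (\<epsilon>) p (e(0 := x, 1 := y))"
    by (auto simp: class_function_def)
  \<comment> \<open>The formula has the argument at 0 and the value at 1, the graph of a definable
    term has them the other way round; all other variables become parameters.\<close>
  let ?t = "case_nat (\<lambda>e. e (Suc 0)) (case_nat (\<lambda>e. e 0) (\<lambda>i _. e (Suc (Suc i))))"
  have *: "definable (\<lambda>e. sat (\<epsilon>) p (\<lambda>i. ?t i e))"
    by (rule definable_sat) (auto split: nat.split)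
  have "(\<lambda>i. ?t i e') = e(0 := e' (Suc 0), 1 := e' 0)" for e'
    by (auto simp: fun_eq_iff split: nat.split)
  with * show ?thesis by (simp add: definable_fun_def definable_term_def pe)
qed


section \<open>Set constructions by comprehension\<close>

definition small :: "'v set \<Rightarrow> bool" where
  "small A \<longleftrightarrow> (\<exists>x. elts x = A)"

definition sep :: "'v \<Rightarrow> ('v \<Rightarrow> bool) \<Rightarrow> 'v" where
  "sep X P = mkset {x. x \<epsilon> X \<and> P x}"

definition iun :: "'v \<Rightarrow> ('v \<Rightarrow> 'v) \<Rightarrow> 'v" where
  "iun X F = mkset {z. \<exists>x. x \<epsilon> X \<and> z \<epsilon> F x}"

definition lam :: "'v \<Rightarrow> ('v \<Rightarrow> 'v) \<Rightarrow> 'v" where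
  "lam X F = mkset {p. \<exists>x. x \<epsilon> X \<and> p = pair x (F x)}"

definition cart :: "'v \<Rightarrow> 'v \<Rightarrow> 'v" where
  "cart X Y = mkset {p. \<exists>x y. x \<epsilon> X \<and> y \<epsilon> Y \<and> p = pair x y}"

definition powset :: "'v \<Rightarrow> 'v" where
  "powset X = mkset {z. elts z \<subseteq> elts X}"

text \<open>
  Agrees with \<open>app\<close> on functions; unlike \<open>app\<close>, it is definable on all arguments, because \<open>THE\<close>
  is unspecified when uniqueness fails.
\<close>
definition ap :: "'v \<Rightarrow> 'v \<Rightarrow> 'v" where
  "ap f x = mkset {t. \<exists>y. pair x y \<epsilon> f \<and> t \<epsilon> y}"

end

section \<open>Sets in the model\<close>

context zfc_model
begin

lemma elts_inject: "elts x = elts y \<longleftrightarrow> x = y"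
  using extensionality by (auto simp: elts_def set_eq_iff)

lemma mkset_elts [simp]: "mkset (elts x) = x"
  by (auto simp: mkset_def elts_inject)

lemma elts_mkset: "small A \<Longrightarrow> elts (mkset A) = A"
  by (auto simp: small_def)

lemma mem_mkset: "small A \<Longrightarrow> x \<epsilon> mkset A \<longleftrightarrow> x \<in> A"
  using elts_mkset by (metis elts_iff)

lemma small_iff: "small A \<longleftrightarrow> (\<exists>b. \<forall>x. x \<epsilon> b \<longleftrightarrow> x \<in> A)"
  by (auto simp: small_def set_eq_iff)

lemma mkset_eqI: "elts y = A \<Longrightarrow> mkset A = y"
  by auto

lemma small_elts [simp]: "small (elts x)"
  by (auto simp: small_def)

text \<open>If no set has the given extension, the description reduces to the fixed unspecified
  value \<open>THE x. False\<close>, which serves as a parameter. A case distinction thus yields a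
  formula for the graph even when the extension is a proper class.\<close>

lemma definable_mkset [definable_intros]:
  assumes "definable (\<lambda>e. P (\<lambda>i. e (Suc i)) (e 0))"
  shows "definable_term (\<lambda>e. mkset {x. P e x})"
proof -
  have eq: "mkset {x. Q x} = y \<longleftrightarrow>
      (\<forall>x. x \<epsilon> y \<longleftrightarrow> Q x) \<or> \<not> (\<exists>z. \<forall>x. x \<epsilon> z \<longleftrightarrow> Q x) \<and> (THE x. False) = y" for Q y
  proof (cases "\<exists>z. elts z = {x. Q x}")
    case True
    then obtain z where z: "{x. Q x} = elts z" by blast
    then have "Q x \<longleftrightarrow> x \<epsilon> z" for x by (auto simp: elts_def)
    then have "(\<forall>x. x \<epsilon> y \<longleftrightarrow> Q x) \<longleftrightarrow> z = y" for y using extensionality by auto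
    then show ?thesis unfolding z mkset_elts by blast
  next
    case False
    then have "mkset {x. Q x} = (THE x. False)" by (simp add: mkset_def)
    with False show ?thesis by (auto simp: elts_def)
  qed
  show ?thesis
    unfolding definable_term_def eq
    by (intro definable_intros definable_shift1[OF definable_shift1[OF assms]] definable_shift1[OF assms])
qed

lemma definable_sep [definable_intros]:
  assumes "definable_term X" "definable (\<lambda>e. P (\<lambda>i. e (Suc i)) (e 0))"
  shows "definable_term (\<lambda>e. sep (X e) (P e))"
  unfolding sep_def using assms(2) by (intro definable_intros definable_term_shifts[OF assms(1)])

lemma definable_iun [definable_intros]:
  assumes "definable_term X" "definable_term (\<lambda>e. F (\<lambda>i. e (Suc i)) (e 0))"
  shows "definable_term (\<lambda>e. iun (X e) (F e))"
  unfolding iun_def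
proof (intro definable_intros definable_term_shifts[OF assms(1)] assms)
  show "definable_term (\<lambda>e. F (\<lambda>i. e (Suc (Suc i))) (e 0))"
    using definable_subst[OF assms(2)[unfolded definable_term_def],
        of "case_nat (\<lambda>e. e 0) (case_nat (\<lambda>e. e (Suc 0)) (\<lambda>i e. e (Suc (Suc (Suc i)))))"]
    by (simp add: definable_term_def split: nat.split)
qed

lemma definable_union [definable_intros]:
  assumes "definable_term X"
  shows "definable_term (\<lambda>e. union (X e))"
proof -
  have eq: "union x = iun x (\<lambda>y. y)" for x
    unfolding union_def iun_def by (rule arg_cong[of _ _ mkset]) auto
  show ?thesis unfolding eq by (intro definable_intros assms)
qed

lemma definable_succ [definable_intros]:
  assumes "definable_term X"
  shows "definable_term (\<lambda>e. succ (X e))"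
proof -
  have eq: "succ x = mkset {z. z = x \<or> z \<epsilon> x}" for x
    unfolding succ_def by (rule arg_cong[of _ _ mkset]) auto
  show ?thesis unfolding eq by (intro definable_intros assms[THEN definable_term_shifts(1)] assms[THEN definable_term_shifts(2)])
qed

lemma definable_pair [definable_intros]:
  assumes "definable_term s" "definable_term t"
  shows "definable_term (\<lambda>e. pair (s e) (t e))"
proof -
  have eq: "pair x y = mkset {z. z = mkset {w. w = x} \<or> z = mkset {w. w = x \<or> w = y}}" for x y
  proof -
    have "{w. w = x} = {x}" "{w. w = x \<or> w = y} = {x, y}" "{z. z = a \<or> z = b} = {a, b}" for a b
      by auto
    then show ?thesis unfolding pair_def by metis
  qed
  show ?thesis unfolding eq by (intro definable_intros assms[THEN definable_term_shifts(1)] assms[THEN definable_term_shifts(2)])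
qed

lemma definable_lam [definable_intros]:
  assumes "definable_term X" "definable_term (\<lambda>e. F (\<lambda>i. e (Suc i)) (e 0))"
  shows "definable_term (\<lambda>e. lam (X e) (F e))"
  unfolding lam_def
proof (intro definable_intros definable_term_shifts[OF assms(1)] assms)
  show "definable_term (\<lambda>e. F (\<lambda>i. e (Suc (Suc i))) (e 0))"
    using definable_subst[OF assms(2)[unfolded definable_term_def],
        of "case_nat (\<lambda>e. e 0) (case_nat (\<lambda>e. e (Suc 0)) (\<lambda>i e. e (Suc (Suc (Suc i)))))"]
    by (simp add: definable_term_def split: nat.split)
qed

lemma definable_cart [definable_intros]:
  assumes "definable_term X" "definable_term Y"
  shows "definable_term (\<lambda>e. cart (X e) (Y e))"
  unfolding cart_def by (intro definable_intros assms[THEN definable_term_shifts(1)] assms[THEN definable_term_shifts(2)]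
      assms[THEN definable_term_shifts(3)])

lemma definable_powset [definable_intros]:
  assumes "definable_term X"
  shows "definable_term (\<lambda>e. powset (X e))"
  unfolding powset_def by (intro definable_intros assms[THEN definable_term_shifts(1)] assms[THEN definable_term_shifts(2)]
      assms[THEN definable_term_shifts(3)])

lemma definable_ap [definable_intros]:
  assumes "definable_term f" "definable_term x"
  shows "definable_term (\<lambda>e. ap (f e) (x e))"
  unfolding ap_def by (intro definable_intros assms[THEN definable_term_shifts(1)] assms[THEN definable_term_shifts(2)]
      assms[THEN definable_term_shifts(3)])

section \<open>Separation, replacement and elementary operations for definable predicates\<close>

lemma mix_upd: "mix (u(i := x)) r = (mix u r)(2 * i := x)"
proof
  fix k show "mix (u(i := x)) r k = ((mix u r)(2 * i := x)) k"
  proof (rule even_odd_cases[of k])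
    fix j assume k: "k = Suc (2 * j)"
    have "Suc (2 * j) \<noteq> 2 * i" by presburger
    then show ?thesis unfolding k by simp
  qed simp
qed

lemma small_sep: "definable_pred P \<Longrightarrow> small {x. x \<epsilon> a \<and> P x}"
proof -
  assume "definable_pred P"
  then obtain p r where p: "\<And>e. P (e 0) \<longleftrightarrow> sat (\<epsilon>) p (mix e r)"
    unfolding definable_pred_def using definable_repr by blast
  have "mix ((\<lambda>_. a)(0 := x)) r = (mix (\<lambda>_. a) r)(0 := x)" for x
    by (simp add: mix_upd)
  then have "P x \<longleftrightarrow> sat (\<epsilon>) p ((mix (\<lambda>_. a) r)(0 := x))" for x
    using p[of "(\<lambda>_. a)(0 := x)"] by simp
  then show ?thesis
    using separation[of a p "mix (\<lambda>_. a) r"] by (auto simp: small_def elts_def)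
qed

lemma small_image: "definable_fun F \<Longrightarrow> small (F ` elts a)"
proof -
  assume F: "definable_fun F"
  have "definable (\<lambda>e. F (e 0) = e (Suc 0))"
    by (intro definable_intros definable_funD[OF F])
  then obtain p r where p: "\<And>e. F (e 0) = e (Suc 0) \<longleftrightarrow> sat (\<epsilon>) p (mix e r)"
    using definable_repr by blast
  \<comment> \<open>\<open>mix\<close> puts variable 1 at place 2, whereas the replacement scheme
    expects the value at place 1; \<open>f\<close> exchanges the two.\<close>
  define f :: "nat \<Rightarrow> nat" where "f = id(1 := 2, 2 := 1)"
  have f: "inj f" by (auto simp: inj_def f_def)
  define E where "E = mix (\<lambda>_. a) r \<circ> f"
  have "f (f i) = i" for i by (simp add: f_def)
  then have "E(0 := x, 1 := y) \<circ> f = mix ((\<lambda>_. a)(0 := x, 1 := y)) r" for x y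
    unfolding mix_upd by (auto simp: fun_eq_iff E_def) (simp_all add: f_def split: if_splits)
  then have s: "F x = y \<longleftrightarrow> sat (\<epsilon>) (ren f p) (E(0 := x, 1 := y))" for x y
    using p[of "(\<lambda>_. a)(0 := x, 1 := y)"] by (simp add: sat_ren f)
  show ?thesis
    using replacement[of a "ren f p" E] unfolding s[symmetric]
    by (auto simp: small_iff image_iff Bex_def eq_commute)
qed

lemma small_empty [simp]: "small {}"
  using infinity by (auto simp: small_def elts_def)

lemma small_doubleton [simp]: "small {x, y}"
  using pairing[of x y] by (auto simp: small_def elts_def)

lemma small_singleton [simp]: "small {x}"
  using small_doubleton[of x x] by simp

lemma small_Union: "small (\<Union>y\<in>elts x. elts y)"
  using union_axiom[of x] by (auto simp: small_iff Bex_def)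

lemma small_Un: "small A \<Longrightarrow> small B \<Longrightarrow> small (A \<union> B)"
proof -
  assume "small A" "small B"
  then obtain a b where "elts a = A" "elts b = B" by (auto simp: small_def)
  then show ?thesis
    using small_Union[of "mkset {a, b}"] by (simp add: elts_mkset)
qed

lemma small_insert: "small A \<Longrightarrow> small (insert x A)"
  using small_Un[of "{x}" A] by simp

lemma small_Pow: "small {z. elts z \<subseteq> elts x}"
  using power_set[of x] by (simp add: small_iff subset_iff)

lemma small_subset:
  assumes "A \<subseteq> elts a" "definable_pred (\<lambda>x. x \<in> A)"
  shows "small A"
proof -
  have "A = {x. x \<epsilon> a \<and> x \<in> A}" using assms(1) by (auto simp: elts_def)
  then show ?thesis using small_sep[OF assms(2), of a] by simp
qed

lemma mem_empty [simp]: "\<not> x \<epsilon> empty"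
  by (simp add: empty_def mem_mkset)

lemma elts_empty [simp]: "elts empty = {}"
  by (auto simp: elts_def)

lemma mem_succ [simp]: "x \<epsilon> succ y \<longleftrightarrow> x = y \<or> x \<epsilon> y"
  by (simp add: succ_def mem_mkset small_insert)

lemma mem_union: "x \<epsilon> union y \<longleftrightarrow> (\<exists>z. z \<epsilon> y \<and> x \<epsilon> z)"
  by (auto simp: union_def mem_mkset small_Union)

lemma mem_powset [simp]: "x \<epsilon> powset y \<longleftrightarrow> elts x \<subseteq> elts y"
  by (simp add: powset_def mem_mkset small_Pow)

lemma mem_sep: "definable_pred P \<Longrightarrow> x \<epsilon> sep a P \<longleftrightarrow> x \<epsilon> a \<and> P x"
  by (simp add: sep_def mem_mkset small_sep)

lemma mem_iun: "definable_fun F \<Longrightarrow> z \<epsilon> iun X F \<longleftrightarrow> (\<exists>x. x \<epsilon> X \<and> z \<epsilon> F x)"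
proof -
  assume F: "definable_fun F"
  have "{z. \<exists>x. x \<epsilon> X \<and> z \<epsilon> F x} = (\<Union>y\<in>elts (mkset (F ` elts X)). elts y)"
    by (auto simp: elts_mkset[OF small_image[OF F]])
  then show ?thesis unfolding iun_def by (simp only: mem_mkset[OF small_Union]) (auto simp: elts_mkset[OF small_image[OF F]])
qed

lemma mem_lam: "definable_fun F \<Longrightarrow> p \<epsilon> lam X F \<longleftrightarrow> (\<exists>x. x \<epsilon> X \<and> p = pair x (F x))"
proof -
  assume F: "definable_fun F"
  have "definable_fun (\<lambda>x. pair x (F x))"
    unfolding definable_fun_def by (intro definable_intros definable_funD[OF F])
  from small_image[OF this, of X] have "small {p. \<exists>x. x \<epsilon> X \<and> p = pair x (F x)}"
    by (rule back_subst[of small]) auto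
  then show ?thesis by (simp add: lam_def mem_mkset)
qed

lemma pair_inject [simp]: "pair x y = pair x' y' \<longleftrightarrow> x = x' \<and> y = y'"
proof -
  have inj: "mkset A = mkset B \<longleftrightarrow> A = B" if "small A" "small B" for A B
    using elts_mkset[OF that(1)] elts_mkset[OF that(2)] by metis
  have "mkset {x} = mkset {x', y'} \<longleftrightarrow> {x} = {x', y'}" "mkset {x, y} = mkset {x', y'} \<longleftrightarrow> {x, y} = {x', y'}"
    "mkset {x} = mkset {x'} \<longleftrightarrow> {x} = {x'}" "mkset {x, y} = mkset {x'} \<longleftrightarrow> {x, y} = {x'}"
    by (rule inj; simp)+
  then have "{mkset {x}, mkset {x, y}} = {mkset {x'}, mkset {x', y'}} \<longleftrightarrow> x = x' \<and> y = y'"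
    unfolding doubleton_eq_iff by auto
  then show ?thesis unfolding pair_def by (simp add: inj)
qed

lemma mem_cart [simp]: "p \<epsilon> cart X Y \<longleftrightarrow> (\<exists>x y. x \<epsilon> X \<and> y \<epsilon> Y \<and> p = pair x y)"
proof -
  have F: "definable_fun (\<lambda>x. mkset {p. \<exists>y. y \<epsilon> Y \<and> p = pair x y})"
    unfolding definable_fun_def by (intro definable_intros)
  have "small (pair x ` elts Y)" for x
    by (rule small_image) (unfold definable_fun_def, intro definable_intros)
  moreover have "pair x ` elts Y = {p. \<exists>y. y \<epsilon> Y \<and> p = pair x y}" for x by auto
  ultimately have s: "small {p. \<exists>y. y \<epsilon> Y \<and> p = pair x y}" for x by metis
  have eq: "elts (iun X (\<lambda>x. mkset {p. \<exists>y. y \<epsilon> Y \<and> p = pair x y}))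
      = {p. \<exists>x y. x \<epsilon> X \<and> y \<epsilon> Y \<and> p = pair x y}"
    unfolding set_eq_iff elts_iff mem_iun[OF F] mem_mkset[OF s] by blast
  show ?thesis unfolding cart_def eq[symmetric] mkset_elts mem_iun[OF F] mem_mkset[OF s] by blast
qed

lemma ap_eqI: "pair x y \<epsilon> f \<Longrightarrow> (\<And>z. pair x z \<epsilon> f \<Longrightarrow> z = y) \<Longrightarrow> ap f x = y"
  unfolding ap_def by (intro mkset_eqI set_eqI, unfold elts_iff mem_Collect_eq) blast

lemma ap_lam [simp]: "definable_fun F \<Longrightarrow> x \<epsilon> X \<Longrightarrow> ap (lam X F) x = F x"
  by (rule ap_eqI) (auto simp: mem_lam)

lemma is_function_lam: "definable_fun F \<Longrightarrow> is_function (lam X F) X"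
  by (auto simp: is_function_def mem_lam)

lemma is_functionD:
  assumes "is_function f X" "x \<epsilon> X"
  shows "pair x y \<epsilon> f \<longleftrightarrow> y = ap f x" and "app f x = ap f x"
proof -
  obtain z where z: "pair x z \<epsilon> f" "\<And>y. pair x y \<epsilon> f \<Longrightarrow> y = z"
    using assms unfolding is_function_def Ball_def elts_iff by metis
  then have "ap f x = z" by (rule ap_eqI)
  then show "pair x y \<epsilon> f \<longleftrightarrow> y = ap f x" using z by metis
  show "app f x = ap f x" unfolding app_def \<open>ap f x = z\<close> using z by (intro the_equality)
qed

lemma app_lam: "definable_fun F \<Longrightarrow> x \<epsilon> X \<Longrightarrow> app (lam X F) x = F x"
  by (simp add: is_functionD(2)[OF is_function_lam])

lemma is_function_eq_lam: "is_function f X \<Longrightarrow> f = lam X (ap f)"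
proof (rule extensionality, rule allI)
  fix p assume f: "is_function f X"
  have F: "definable_fun (ap f)" unfolding definable_fun_def by (intro definable_intros)
  show "p \<epsilon> f \<longleftrightarrow> p \<epsilon> lam X (ap f)"
    using f is_functionD(1)[OF f] unfolding mem_lam[OF F] is_function_def Ball_def Bex_def elts_iff
    by metis
qed

lemma definable_is_function [definable_intros]:
  assumes "definable_term f" "definable_term X"
  shows "definable (\<lambda>e. is_function (f e) (X e))"
  unfolding is_function_def by (intro definable_intros assms assms[THEN definable_term_shifts(1)] assms[THEN definable_term_shifts(2)]
      assms[THEN definable_term_shifts(3)])

lemma lam_cong: "(\<And>x. x \<epsilon> X \<Longrightarrow> F x = G x) \<Longrightarrow> lam X F = lam X G"
  unfolding lam_def by (rule arg_cong[of _ _ mkset]) auto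

section \<open>The natural numbers of the model, recursion, class foundation and choice\<close>

lemma definable_is_inductive [definable_intros]:
  assumes "definable_term w"
  shows "definable (\<lambda>e. is_inductive (w e))"
  unfolding is_inductive_def by (intro definable_intros assms definable_term_shift[OF assms])

lemma mem_omega: "x \<epsilon> omega \<longleftrightarrow> (\<forall>w. is_inductive w \<longrightarrow> x \<epsilon> w)"
proof -
  obtain w where w: "\<exists>x. x \<epsilon> w \<and> (\<forall>y. \<not> y \<epsilon> x)"
    "\<And>x. x \<epsilon> w \<Longrightarrow> \<exists>y. y \<epsilon> w \<and> (\<forall>z. z \<epsilon> y \<longleftrightarrow> z \<epsilon> x \<or> z = x)"
    using infinity by blast
  have "empty \<epsilon> w" using w(1) extensionality[of _ empty] by fastforce
  moreover have "succ x \<epsilon> w" if x: "x \<epsilon> w" for x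
  proof -
    obtain y where "y \<epsilon> w" "\<forall>z. z \<epsilon> y \<longleftrightarrow> z \<epsilon> x \<or> z = x" using w(2)[OF x] by blast
    moreover then have "y = succ x" by (intro extensionality) auto
    ultimately show ?thesis by simp
  qed
  ultimately have "is_inductive w" by (simp add: is_inductive_def)
  moreover have "definable_pred (\<lambda>x. \<forall>w. is_inductive w \<longrightarrow> x \<epsilon> w)"
    unfolding definable_pred_def by (intro definable_intros)
  ultimately have "small {x. \<forall>w. is_inductive w \<longrightarrow> x \<epsilon> w}"
    by (intro small_subset[of _ w]) (auto simp: elts_def)
  then show ?thesis by (simp add: omega_def mem_mkset)
qed

lemma empty_omega [simp]: "empty \<epsilon> omega"
  and succ_omega: "n \<epsilon> omega \<Longrightarrow> succ n \<epsilon> omega"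
  by (auto simp: mem_omega is_inductive_def)

text \<open>The set of all \<open>n\<close> in \<omega> with \<open>P n\<close> must exist in the
  model, so \<open>P\<close> has to be definable; a nonstandard \<omega> admits no induction for
  arbitrary predicates.\<close>

lemma omega_induct:
  assumes "n \<epsilon> omega" "P empty" "\<And>n. n \<epsilon> omega \<Longrightarrow> P n \<Longrightarrow> P (succ n)" "definable_pred P"
  shows "P n"
proof -
  have "is_inductive (sep omega P)"
    using assms(2,3) by (auto simp: is_inductive_def mem_sep[OF assms(4)] succ_omega)
  then show ?thesis using assms(1) mem_omega mem_sep[OF assms(4)] by blast
qed

lemma omega_transitive: "n \<epsilon> omega \<Longrightarrow> m \<epsilon> n \<Longrightarrow> m \<epsilon> omega"
proof -
  assume n: "n \<epsilon> omega"
  have "\<forall>m. m \<epsilon> n \<longrightarrow> m \<epsilon> omega"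
    by (rule omega_induct[OF n]) (auto simp: definable_pred_def intro!: definable_intros)
  then show "m \<epsilon> n \<Longrightarrow> m \<epsilon> omega" by blast
qed

lemma mem_irrefl: "\<not> x \<epsilon> x"
  using foundation[of "mkset {x}"] by (auto simp: mem_mkset)

lemma mem_asym: "x \<epsilon> y \<Longrightarrow> \<not> y \<epsilon> x"
  using foundation[of "mkset {x, y}"] by (auto simp: mem_mkset)

lemma succ_inject [simp]: "succ x = succ y \<longleftrightarrow> x = y"
  using mem_asym by (metis mem_succ)

lemma succ_neq_empty [simp]: "succ x \<noteq> empty" "empty \<noteq> succ x"
  by (metis mem_empty mem_succ)+

text \<open>\<open>R n y\<close> is witnessed by a derivation: a set of pairs containing
  \<open>(n, y)\<close>, each member of which is the initial pair or the successor of some member.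
  Derivations are not assumed to be functions; existence and uniqueness of the value come from
  induction on \<open>n\<close>.\<close>

lemma omega_recursion:
  assumes F: "definable_fun F"
  obtains g where "definable_fun g" "g empty = x0" "\<And>n. n \<epsilon> omega \<Longrightarrow> g (succ n) = F (g n)"
proof -
  define R where "R n y \<longleftrightarrow> (\<exists>s. pair n y \<epsilon> s \<and> (\<forall>p. p \<epsilon> s \<longrightarrow> p = pair empty x0
      \<or> (\<exists>k v. pair k v \<epsilon> s \<and> p = pair (succ k) (F v))))" for n y
  have R: "definable (\<lambda>e. R (s e) (t e))" if "definable_term s" "definable_term t" for s t
    unfolding R_def by (intro definable_intros that[THEN definable_term_shifts(1)]
        that[THEN definable_term_shifts(2)] definable_funD[OF F])
  have R0: "R empty x0"
    unfolding R_def by (intro exI[of _ "mkset {pair empty x0}"]) (simp add: mem_mkset)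
  have R0D: "y = x0" if "R empty y" for y
    using that unfolding R_def by (metis pair_inject succ_neq_empty(2))
  have RS: "R (succ n) (F y)" if Rn: "R n y" for n y
  proof -
    obtain s where s1: "pair n y \<epsilon> s" and s2: "\<forall>p. p \<epsilon> s \<longrightarrow> p = pair empty x0
      \<or> (\<exists>k v. pair k v \<epsilon> s \<and> p = pair (succ k) (F v))" using Rn unfolding R_def by blast
    have t: "p \<epsilon> mkset (insert (pair (succ n) (F y)) (elts s))
        \<longleftrightarrow> p = pair (succ n) (F y) \<or> p \<epsilon> s" for p
      by (simp add: mem_mkset small_insert)
    show ?thesis unfolding R_def
      by (rule exI[of _ "mkset (insert (pair (succ n) (F y)) (elts s))"]) (use s1 s2 t in metis)
  qed
  have RSD: "\<exists>v. R n v \<and> y = F v" if "R (succ n) y" for n y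
    using that unfolding R_def by (metis pair_inject succ_inject succ_neq_empty(1))
  have ex1: "\<exists>!y. R n y" if "n \<epsilon> omega" for n
    using that
  proof (rule omega_induct)
    show "\<exists>!y. R empty y" using R0 R0D by blast
    show "\<exists>!y. R n y \<Longrightarrow> \<exists>!y. R (succ n) y" for n using RS RSD by metis
    show "definable_pred (\<lambda>n. \<exists>!y. R n y)"
      unfolding definable_pred_def by (intro definable_intros R)
  qed
  define g where "g n = mkset {t. \<exists>y. R n y \<and> t \<epsilon> y}" for n
  have g: "g n = y" if "n \<epsilon> omega" "R n y" for n y
    unfolding g_def using ex1[OF that(1)] that(2) by (intro mkset_eqI) (auto simp: elts_def)
  show ?thesis
  proof (rule that)
    show "definable_fun g"
      unfolding definable_fun_def g_def by (intro definable_intros R)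
    show "g empty = x0" by (rule g) (simp_all add: R0)
    fix n assume n: "n \<epsilon> omega"
    then obtain y where "R n y" using ex1 by blast
    then show "g (succ n) = F (g n)" using g n RS succ_omega by metis
  qed
qed

lemma transitive_closure:
  obtains t where "x \<epsilon> t" "\<And>y z. y \<epsilon> t \<Longrightarrow> z \<epsilon> y \<Longrightarrow> z \<epsilon> t"
proof -
  have "definable_fun union" unfolding definable_fun_def by (intro definable_intros)
  from omega_recursion[OF this, of "mkset {x}"]
  obtain g where g: "definable_fun g" "g empty = mkset {x}"
    "\<And>n. n \<epsilon> omega \<Longrightarrow> g (succ n) = union (g n)" by metis
  show ?thesis
  proof (rule that[of "iun omega g"])
    show "x \<epsilon> iun omega g"
      unfolding mem_iun[OF g(1)] using g(2) by (intro exI[of _ empty]) (simp add: mem_mkset)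
    show "z \<epsilon> iun omega g" if "y \<epsilon> iun omega g" "z \<epsilon> y" for y z
      using that g(3) unfolding mem_iun[OF g(1)] by (metis mem_union succ_omega)
  qed
qed

text \<open>In a transitive set containing \<open>x\<close>, elements of members are members, so a
  minimal element of the part satisfying \<open>P\<close> has no element at all satisfying
  \<open>P\<close>.\<close>

lemma class_foundation:
  assumes "definable_pred P" "P x"
  obtains y where "P y" "\<And>z. z \<epsilon> y \<Longrightarrow> \<not> P z"
proof -
  obtain t where t: "x \<epsilon> t" "\<And>y z. y \<epsilon> t \<Longrightarrow> z \<epsilon> y \<Longrightarrow> z \<epsilon> t"
    using transitive_closure by blast
  have "\<exists>y. y \<epsilon> sep t P" using t assms by (auto simp: mem_sep)
  from foundation[OF this] show ?thesis using that t assms(1) by (auto simp: mem_sep)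
qed

lemma class_induct:
  assumes "definable_pred P" "\<And>x. (\<And>y. y \<epsilon> x \<Longrightarrow> P y) \<Longrightarrow> P x"
  shows "P x"
proof (rule ccontr)
  assume "\<not> P x"
  moreover have "definable_pred (\<lambda>x. \<not> P x)"
    using assms(1) unfolding definable_pred_def by (rule definable_Not)
  ultimately obtain y where "\<not> P y" "\<And>z. z \<epsilon> y \<Longrightarrow> \<not> \<not> P z"
    using class_foundation[of "\<lambda>x. \<not> P x"] by metis
  then show False using assms(2) by blast
qed

text \<open>The axiom of choice is applied to the sets of pairs \<open>(x, z)\<close> with \<open>P x z\<close>, which are disjoint.\<close>
lemma choice_fun:
  assumes P: "definable_rel P" and B: "definable_fun B"
  obtains F where "definable_fun F"
    "\<And>x. x \<epsilon> X \<Longrightarrow> \<exists>z. z \<epsilon> B x \<and> P x z \<Longrightarrow> F x \<epsilon> B x \<and> P x (F x)"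
proof -
  define Y where "Y x = mkset {p. \<exists>z. (z \<epsilon> B x \<and> P x z) \<and> p = pair x z}" for x
  have Yd: "definable_fun Y" unfolding definable_fun_def Y_def
    by (intro definable_intros definable_funD[OF B] definable_relD[OF P])
  have Y: "p \<epsilon> Y x \<longleftrightarrow> (\<exists>z. (z \<epsilon> B x \<and> P x z) \<and> p = pair x z)" for p x
  proof -
    have "definable_pred (P x)" unfolding definable_pred_def by (intro definable_intros definable_relD[OF P])
    then have s: "pair x ` elts (sep (B x) (P x)) = {p. \<exists>z. (z \<epsilon> B x \<and> P x z) \<and> p = pair x z}"
      by (auto simp: mem_sep)
    have "definable_fun (pair x)" unfolding definable_fun_def by (intro definable_intros)
    from small_image[OF this, of "sep (B x) (P x)"] show ?thesis
      unfolding s by (simp add: Y_def mem_mkset)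
  qed
  have Y': "definable_pred (\<lambda>y. \<exists>z. z \<epsilon> y)" unfolding definable_pred_def by (intro definable_intros)
  define \<Y> where "\<Y> = sep (mkset (Y ` elts X)) (\<lambda>y. \<exists>z. z \<epsilon> y)"
  have \<Y>: "y \<epsilon> \<Y> \<longleftrightarrow> (\<exists>x. x \<epsilon> X \<and> y = Y x) \<and> (\<exists>z. z \<epsilon> y)" for y
    unfolding \<Y>_def mem_sep[OF Y'] by (auto simp: mem_mkset small_image[OF Yd])
  obtain c where c: "\<And>y. y \<epsilon> \<Y> \<Longrightarrow> \<exists>!z. z \<epsilon> y \<and> z \<epsilon> c"
  proof -
    have "\<not> (\<exists>z. z \<epsilon> y \<and> z \<epsilon> y')" if "y \<epsilon> \<Y> \<and> y' \<epsilon> \<Y> \<and> y \<noteq> y'" for y y'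
      using that unfolding \<Y> by (auto simp: Y)
    then show thesis using choice[of \<Y>] \<Y> that by blast
  qed
  define F where "F x = mkset {t. \<exists>z. (z \<epsilon> B x \<and> P x z) \<and> pair x z \<epsilon> c \<and> t \<epsilon> z}" for x
  show ?thesis
  proof (rule that)
    show "definable_fun F" unfolding definable_fun_def F_def
      by (intro definable_intros definable_funD[OF B] definable_relD[OF P])
    fix x assume x: "x \<epsilon> X" "\<exists>z. z \<epsilon> B x \<and> P x z"
    then have "Y x \<epsilon> \<Y>" unfolding \<Y> by (auto simp: Y)
    then have "\<exists>!p. p \<epsilon> Y x \<and> p \<epsilon> c" by (rule c)
    then obtain z where z: "z \<epsilon> B x" "P x z" "pair x z \<epsilon> c"
      and u: "\<And>z'. z' \<epsilon> B x \<Longrightarrow> P x z' \<Longrightarrow> pair x z' \<epsilon> c \<Longrightarrow> z' = z"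
      unfolding Y by (metis pair_inject)
    have "F x = z"
      unfolding F_def by (intro mkset_eqI set_eqI, unfold elts_iff mem_Collect_eq) (use z u in blast)
    with z show "F x \<epsilon> B x \<and> P x (F x)" by simp
  qed
qed


lemmas definable_defs = definable_pred_def definable_rel_def definable_fun_def definable_op_def

definition un :: "'v \<Rightarrow> 'v \<Rightarrow> 'v" where
  "un x y = mkset {z. z \<epsilon> x \<or> z \<epsilon> y}"

lemma mem_un [simp]: "z \<epsilon> un x y \<longleftrightarrow> z \<epsilon> x \<or> z \<epsilon> y"
proof -
  have "elts x \<union> elts y = {z. z \<epsilon> x \<or> z \<epsilon> y}" by auto
  then have "small {z. z \<epsilon> x \<or> z \<epsilon> y}" using small_Un[of "elts x" "elts y"] by simp
  then show ?thesis by (simp add: un_def mem_mkset)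
qed

lemma definable_un [definable_intros]:
  assumes "definable_term s" "definable_term t"
  shows "definable_term (\<lambda>e. un (s e) (t e))"
  unfolding un_def by (intro definable_intros assms[THEN definable_term_shift])

lemma fso_less_iff:
  "fso_less a b \<longleftrightarrow> (\<exists>\<xi>. \<xi> \<epsilon> b \<and> \<not> \<xi> \<epsilon> a
     \<and> (\<forall>\<eta>. (\<eta> \<epsilon> a \<and> \<not> \<eta> \<epsilon> b) \<or> (\<eta> \<epsilon> b \<and> \<not> \<eta> \<epsilon> a) \<longrightarrow> \<eta> \<epsilon> \<xi> \<or> \<eta> = \<xi>))"
  unfolding fso_less_def Ball_def Un_iff Diff_iff elts_iff by (rule refl)

lemma definable_fso_less [definable_intros]:
  assumes "definable_term s" "definable_term t"
  shows "definable (\<lambda>e. fso_less (s e) (t e))"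
  unfolding fso_less_iff by (intro definable_intros assms[THEN definable_term_shifts(1)]
      assms[THEN definable_term_shifts(2)])

lemma mem_doubleton [simp]: "z \<epsilon> mkset {x, y} \<longleftrightarrow> z = x \<or> z = y"
  by (simp add: mem_mkset)

lemma mem_singleton [simp]: "z \<epsilon> mkset {x} \<longleftrightarrow> z = x"
  by (simp add: mem_mkset)

lemma mem_pair: "z \<epsilon> pair x y \<longleftrightarrow> z = mkset {x, x} \<or> z = mkset {x, y}"
  by (simp add: pair_def)

lemma definable_doubleton [definable_intros]:
  assumes "definable_term s" "definable_term t"
  shows "definable_term (\<lambda>e. mkset {s e, t e})"
proof -
  have eq: "mkset {x, y} = mkset {z. z = x \<or> z = y}" for x y
    by (rule arg_cong[of _ _ mkset]) auto
  show ?thesis unfolding eq by (intro definable_intros assms[THEN definable_term_shift])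
qed

lemma sep_eqI:
  assumes "definable_pred P" "\<And>x. x \<in> A \<longleftrightarrow> x \<epsilon> X \<and> P x"
  shows "mkset A = sep X P"
proof (rule mkset_eqI, rule set_eqI)
  fix x show "x \<in> elts (sep X P) \<longleftrightarrow> x \<in> A" using assms by (simp add: mem_sep)
qed

lemma sep_cong: "(\<And>x. x \<epsilon> X \<Longrightarrow> P x \<longleftrightarrow> Q x) \<Longrightarrow> sep X P = sep X Q"
  unfolding sep_def by (rule arg_cong[of _ _ mkset]) auto

lemma is_function_ext:
  assumes "is_function f X" "is_function g X" "\<And>x. x \<epsilon> X \<Longrightarrow> ap f x = ap g x"
  shows "f = g"
  using is_function_eq_lam[OF assms(1)] is_function_eq_lam[OF assms(2)] lam_cong[of X "ap f" "ap g"] assms(3)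
  by metis

lemma const_fun_eq_lam: "const_fun X a = lam X (\<lambda>_. a)"
  unfolding const_fun_def lam_def by (rule arg_cong[of _ _ mkset]) auto

lemma id_fun_eq_lam: "id_fun X = lam X (\<lambda>x. x)"
  unfolding id_fun_def lam_def by (rule arg_cong[of _ _ mkset]) auto

section \<open>Countably complete ultrafilters and kernels\<close>

lemma cc_ultrafilterD:
  assumes "cc_ultrafilter N X W"
  shows "X \<in> N" "A \<epsilon> W \<Longrightarrow> A \<in> N" "A \<epsilon> W \<Longrightarrow> elts A \<subseteq> elts X" "X \<epsilon> W" "\<not> empty \<epsilon> W"
    "A \<epsilon> W \<Longrightarrow> B \<in> N \<Longrightarrow> elts A \<subseteq> elts B \<Longrightarrow> elts B \<subseteq> elts X \<Longrightarrow> B \<epsilon> W"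
    "A \<epsilon> W \<Longrightarrow> B \<epsilon> W \<Longrightarrow> mkset (elts A \<inter> elts B) \<epsilon> W"
    "A \<in> N \<Longrightarrow> elts A \<subseteq> elts X \<Longrightarrow> A \<epsilon> W \<or> mkset (elts X - elts A) \<epsilon> W"
    "s \<in> N \<Longrightarrow> is_function s omega \<Longrightarrow> (\<And>i. i \<epsilon> omega \<Longrightarrow> app s i \<epsilon> W)
      \<Longrightarrow> mkset (\<Inter>i\<in>elts omega. elts (app s i)) \<epsilon> W"
proof -
  have uf: "ultrafilter_over N X W" and cc: "countably_complete N W"
    using assms by (auto simp: cc_ultrafilter_def)
  note u = uf[unfolded ultrafilter_over_def]
  have "elts W \<subseteq> {A \<in> N. elts A \<subseteq> elts X}" using u by blast
  moreover have "A \<epsilon> W \<longleftrightarrow> A \<in> elts W" by simp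
  ultimately show "A \<epsilon> W \<Longrightarrow> A \<in> N" "A \<epsilon> W \<Longrightarrow> elts A \<subseteq> elts X" by blast+
  show "X \<in> N" "X \<epsilon> W" "\<not> empty \<epsilon> W"
    "A \<epsilon> W \<Longrightarrow> B \<in> N \<Longrightarrow> elts A \<subseteq> elts B \<Longrightarrow> elts B \<subseteq> elts X \<Longrightarrow> B \<epsilon> W"
    "A \<epsilon> W \<Longrightarrow> B \<epsilon> W \<Longrightarrow> mkset (elts A \<inter> elts B) \<epsilon> W"
    "A \<in> N \<Longrightarrow> elts A \<subseteq> elts X \<Longrightarrow> A \<epsilon> W \<or> mkset (elts X - elts A) \<epsilon> W"
    using u by blast+
  show "s \<in> N \<Longrightarrow> is_function s omega \<Longrightarrow> (\<And>i. i \<epsilon> omega \<Longrightarrow> app s i \<epsilon> W)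
      \<Longrightarrow> mkset (\<Inter>i\<in>elts omega. elts (app s i)) \<epsilon> W"
    using cc unfolding countably_complete_def by simp
qed

lemma cc_ultrafilter_union:
  assumes "cc_ultrafilter N X W"
  shows "union W = X"
  using cc_ultrafilterD(3,4)[OF assms] by (intro extensionality) (auto simp: mem_union subset_iff)

lemma cc_ultrafilter_sequence:
  assumes W: "cc_ultrafilter N X W" and s: "s \<in> N" "is_function s omega"
    and mem: "\<And>i. i \<epsilon> omega \<Longrightarrow> ap s i \<epsilon> W"
  shows "sep X (\<lambda>x. \<forall>i\<in>elts omega. x \<epsilon> ap s i) \<epsilon> W"
proof -
  have app: "app s i = ap s i" if "i \<epsilon> omega" for i using is_functionD(2)[OF s(2) that] .
  have d: "definable_pred (\<lambda>x. \<forall>i\<in>elts omega. x \<epsilon> ap s i)"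
    unfolding definable_defs by (intro definable_intros)
  have "mkset (\<Inter>i\<in>elts omega. elts (app s i)) = sep X (\<lambda>x. \<forall>i\<in>elts omega. x \<epsilon> ap s i)"
    by (rule sep_eqI[OF d])
       (use app cc_ultrafilterD(3)[OF W mem[OF empty_omega]] in \<open>auto simp: subset_iff\<close>)
  then show ?thesis using cc_ultrafilterD(9)[OF W s] mem app by simp
qed

text \<open>Uncurrying, written as a set of elements of values so that it is a definable term; it is
  \<open>empty\<close> off the pairs.\<close>

definition unc :: "('v \<Rightarrow> 'v \<Rightarrow> 'v) \<Rightarrow> 'v \<Rightarrow> 'v" where
  "unc H p = mkset {t. \<exists>x y. p = pair x y \<and> t \<epsilon> H x y}"

lemma unc_pair [simp]: "unc H (pair x y) = H x y"
  unfolding unc_def by (rule mkset_eqI, rule set_eqI) simp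

lemma definable_unc: "definable_op H \<Longrightarrow> definable_fun (unc H)"
proof -
  assume H: "definable_op H"
  show ?thesis unfolding definable_fun_def unc_def by (intro definable_intros definable_opD[OF H])
qed

text \<open>The disjoint sum of the sets \<open>b a\<close>, which becomes the index set of the
  iterated ultrapower. The form \<open>mkset {a, a}\<close> is the singleton in the shape for which
  a definability rule exists.\<close>

definition pairs :: "'v \<Rightarrow> ('v \<Rightarrow> 'v) \<Rightarrow> 'v" where
  "pairs X b = iun X (\<lambda>a. cart (mkset {a, a}) (b a))"

lemma mem_pairs: "definable_fun b \<Longrightarrow> p \<epsilon> pairs X b \<longleftrightarrow> (\<exists>a y. a \<epsilon> X \<and> y \<epsilon> b a \<and> p = pair a y)"
proof -
  assume b: "definable_fun b"
  have "definable_fun (\<lambda>a. cart (mkset {a, a}) (b a))"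
    unfolding definable_fun_def by (intro definable_intros definable_funD[OF b])
  from mem_iun[OF this, of p X] show ?thesis unfolding pairs_def by auto
qed

text \<open>\<open>K\<close> codes a family of collections of sets by its pairs
  \<open>(a, A)\<close>. Countable completeness and concentration on the predecessors are merged
  into one condition: countably many members have a common point below \<open>a\<close>.\<close>

definition good :: "'v \<Rightarrow> 'v \<Rightarrow> bool" where
  "good K a \<longleftrightarrow> (\<forall>s. (\<forall>i\<in>elts omega. pair a (ap s i) \<epsilon> K)
    \<longrightarrow> (\<exists>z. fso_less z a \<and> (\<forall>i\<in>elts omega. z \<epsilon> ap s i)))"

text \<open>
  \<open>K\<close> codes a family of filters \<open>K a\<close> such that \<open>U'\<close> is contained in the limit of the \<open>K a\<close> along \<open>U\<close>
  and, for almost all \<open>a\<close>, \<open>K a\<close> is countably complete and concentrates on the predecessors of \<open>a\<close>.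
\<close>
definition kernel :: "'v \<Rightarrow> 'v \<Rightarrow> 'v \<Rightarrow> bool" where
  "kernel U' U K \<longleftrightarrow> (\<forall>A. A \<epsilon> U' \<longrightarrow> sep (union U) (\<lambda>a. pair a A \<epsilon> K) \<epsilon> U) \<and> sep (union U) (good K) \<epsilon> U"

lemma definable_good [definable_intros]:
  assumes "definable_term s" "definable_term t"
  shows "definable (\<lambda>e. good (s e) (t e))"
  unfolding good_def by (intro definable_intros assms[THEN definable_term_shifts(1)]
    assms[THEN definable_term_shifts(2)] assms[THEN definable_term_shifts(3)])

lemma definable_kernel [definable_intros]:
  assumes "definable_term s" "definable_term t" "definable_term u"
  shows "definable (\<lambda>e. kernel (s e) (t e) (u e))"
  unfolding kernel_def by (intro definable_intros assms assms[THEN definable_term_shifts(1)]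
    assms[THEN definable_term_shifts(2)] assms[THEN definable_term_shifts(3)])

end

section \<open>Ultrafilter quantifiers and transitive collapses\<close>

context zfc_model
begin

text \<open>
  The induction that makes the transitive collapse injective modulo \<open>E\<close>; foundation applies to the
  class of bad values because the collapse is definable.
\<close>
lemma collapse_inj:
  assumes c: "definable_fun c" and S: "definable_pred S" and E: "definable_rel E"
    and coll: "\<And>g. S g \<Longrightarrow> elts (c g) = c ` {f. S f \<and> M f g}"
    and ext: "\<And>f g. S f \<Longrightarrow> S g \<Longrightarrow> \<not> E f g \<Longrightarrow> \<exists>z. S z \<and> (M z f \<and> \<not> M z g \<or> M z g \<and> \<not> M z f)"
    and cong: "\<And>z z' g. S z \<Longrightarrow> S z' \<Longrightarrow> S g \<Longrightarrow> E z z' \<Longrightarrow> M z' g \<Longrightarrow> M z g"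
    and fg: "S f" "S g" "c f = c g"
  shows "E f g"
proof (rule ccontr)
  assume nE: "\<not> E f g"
  define P where "P v \<longleftrightarrow> (\<exists>f g. S f \<and> S g \<and> c f = v \<and> c g = v \<and> \<not> E f g)" for v
  have "definable_pred P"
    unfolding P_def definable_pred_def
    by (intro definable_intros definable_predD[OF S] definable_funD[OF c] definable_relD[OF E])
  moreover have "P (c f)" using fg nE by (auto simp: P_def)
  ultimately obtain v where v: "P v" "\<And>u. u \<epsilon> v \<Longrightarrow> \<not> P u"
    using class_foundation[of P "c f"] by metis
  obtain f g where f: "S f" "c f = v" and g: "S g" "c g = v" and "\<not> E f g"
    using v(1) unfolding P_def by metis
  then obtain z where z: "S z" "M z f \<and> \<not> M z g \<or> M z g \<and> \<not> M z f" using ext by metis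
  then obtain h where h: "S h" "c h = v" "M z h"
    and k: "\<exists>k. S k \<and> c k = v \<and> \<not> M z k" using f g by metis
  from k obtain k where k: "S k" "c k = v" "\<not> M z k" by metis
  have "c z \<in> elts (c h)" unfolding coll[OF h(1)] using z(1) h(3) by blast
  then have zv: "c z \<epsilon> v" using h(2) by simp
  then have "c z \<in> elts (c k)" using k(2) by simp
  then obtain z' where z': "S z'" "M z' k" "c z' = c z" unfolding coll[OF k(1)] by auto
  then have "\<not> E z z'" using cong[OF z(1) z'(1) k(1)] k(3) by blast
  then have "P (c z)" using z(1) z' unfolding P_def by metis
  with v(2)[OF zv] show False by simp
qed

end

text \<open>
  \<open>A\<close> is an ultrafilter quantifier over \<open>I\<close>, and \<open>cc\<close> collapses the ultrapower that it
  defines from the functions on \<open>I\<close>. This covers both \<open>Ult(V, U)\<close> and the iterated ultrapower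
  \<open>Ult(Ult(V, U), W)\<close> for \<open>W\<close> in \<open>Ult(V, U)\<close>.
\<close>

locale ultra_quantifier = zfc_model mem for mem :: "'v \<Rightarrow> 'v \<Rightarrow> bool" (infix "\<epsilon>" 50) +
  fixes I :: 'v and A :: "('v \<Rightarrow> bool) \<Rightarrow> bool" and cc :: "'v \<Rightarrow> 'v"
  assumes A_mono: "\<And>P Q. A P \<Longrightarrow> (\<And>i. i \<epsilon> I \<Longrightarrow> P i \<Longrightarrow> Q i) \<Longrightarrow> definable_pred P \<Longrightarrow> definable_pred Q \<Longrightarrow> A Q"
    and A_conj: "\<And>P Q. A P \<Longrightarrow> A Q \<Longrightarrow> definable_pred P \<Longrightarrow> definable_pred Q \<Longrightarrow> A (\<lambda>i. P i \<and> Q i)"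
    and A_not: "\<And>P. definable_pred P \<Longrightarrow> A (\<lambda>i. \<not> P i) \<longleftrightarrow> \<not> A P"
    and A_definable: "\<And>P. definable (\<lambda>e. P (\<lambda>i. e (Suc i)) (e 0)) \<Longrightarrow> definable (\<lambda>e. A (P e))"
    and cc_definable: "definable_fun cc"
    and cc_collapse: "\<And>g. is_function g I \<Longrightarrow>
      elts (cc g) = cc ` {f. is_function f I \<and> A (\<lambda>i. ap f i \<epsilon> ap g i)}"
begin

text \<open>Naming elements of the collapse by class functions allows representatives to be written
  with \<open>\<lambda>\<close>; their restrictions to \<open>I\<close> are the functions that are
  collapsed.\<close>

definition cls :: "('v \<Rightarrow> 'v) \<Rightarrow> 'v" where
  "cls F = cc (lam I F)"

lemma definable_ap_fun: "definable_fun (ap f)"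
  unfolding definable_defs by (intro definable_intros)

text \<open>The locale does not state that the whole index set is large. By \<open>A_not\<close>,
  \<open>A\<close> holds of one of the two constant predicates, and monotonicity leads from either
  of them to \<open>P\<close>.\<close>

lemma A_all: "(\<And>i. i \<epsilon> I \<Longrightarrow> P i) \<Longrightarrow> definable_pred P \<Longrightarrow> A P"
proof -
  assume P: "\<And>i. i \<epsilon> I \<Longrightarrow> P i" "definable_pred P"
  have F: "definable_pred (\<lambda>_. False)" and T: "definable_pred (\<lambda>_. \<not> False)"
    unfolding definable_pred_def by (rule definable_closed)+
  have "A (\<lambda>_. False) \<or> A (\<lambda>_. \<not> False)" using A_not[OF F] by blast
  then show "A P" using A_mono[OF _ _ F P(2)] A_mono[OF _ _ T P(2)] P(1) by blast
qed

lemma A_ex: "A P \<Longrightarrow> definable_pred P \<Longrightarrow> \<exists>i. i \<epsilon> I \<and> P i"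
proof (rule ccontr)
  assume P: "A P" "definable_pred P" "\<nexists>i. i \<epsilon> I \<and> P i"
  have "definable_pred (\<lambda>i. \<not> P i)" using P(2) unfolding definable_pred_def by (rule definable_Not)
  then have "A (\<lambda>i. \<not> P i)" using P(3) by (intro A_all) auto
  then show False using A_not P by blast
qed

lemma A_or: "A (\<lambda>i. P i \<or> Q i) \<Longrightarrow> definable_pred P \<Longrightarrow> definable_pred Q \<Longrightarrow> A P \<or> A Q"
proof (rule ccontr)
  assume a: "A (\<lambda>i. P i \<or> Q i)" "definable_pred P" "definable_pred Q" "\<not> (A P \<or> A Q)"
  have d: "definable_pred (\<lambda>i. \<not> P i)" "definable_pred (\<lambda>i. \<not> Q i)" "definable_pred (\<lambda>i. P i \<or> Q i)"
    "definable_pred (\<lambda>i. \<not> P i \<and> \<not> Q i)" 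
    unfolding definable_pred_def by (intro definable_intros a(2,3)[unfolded definable_pred_def])+
  have "A (\<lambda>i. \<not> P i)" "A (\<lambda>i. \<not> Q i)" using a by (simp_all add: A_not)
  then have "A (\<lambda>i. \<not> P i \<and> \<not> Q i)" by (rule A_conj[OF _ _ d(1,2)])
  from A_conj[OF this a(1) d(4,3)] have "A (\<lambda>i. (\<not> P i \<and> \<not> Q i) \<and> (P i \<or> Q i))" .
  then have "\<exists>i. i \<epsilon> I \<and> (\<not> P i \<and> \<not> Q i) \<and> (P i \<or> Q i)"
    by (rule A_ex) (unfold definable_pred_def, intro definable_intros a(2,3)[unfolded definable_pred_def])
  then show False by blast
qed

text \<open>The existential step in Los's theorem. \<open>B\<close> bounds the witnesses by sets, as
  the axiom of choice requires.\<close>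

lemma A_choice:
  assumes P: "definable_rel P" and B: "definable_fun B" and ex: "A (\<lambda>i. \<exists>z. z \<epsilon> B i \<and> P i z)"
  shows "\<exists>F. definable_fun F \<and> A (\<lambda>i. F i \<epsilon> B i \<and> P i (F i))"
proof -
  obtain F where F: "definable_fun F"
    "\<And>x. x \<epsilon> I \<Longrightarrow> \<exists>z. z \<epsilon> B x \<and> P x z \<Longrightarrow> F x \<epsilon> B x \<and> P x (F x)"
    using choice_fun[OF P B] by metis
  have "A (\<lambda>i. F i \<epsilon> B i \<and> P i (F i))"
    by (rule A_mono[OF ex]) (use F(2) in blast, unfold definable_defs,
        (intro definable_intros definable_relD[OF P] definable_funD[OF B] definable_funD[OF F(1)])+)
  with F(1) show ?thesis by blast
qed

text \<open>The ultrapower is extensional: if two functions differ almost everywhere, a choice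
  function into the symmetric differences stays on one fixed side almost everywhere, by
  \<open>A_or\<close>.\<close>

lemma cc_inj:
  assumes f: "is_function f I" and g: "is_function g I" and eq: "cc f = cc g"
  shows "A (\<lambda>i. ap f i = ap g i)"
proof (rule collapse_inj[OF cc_definable _ _ _ _ _ f g eq, where E = "\<lambda>f g. A (\<lambda>i. ap f i = ap g i)"
      and M = "\<lambda>f g. A (\<lambda>i. ap f i \<epsilon> ap g i)"])
  show "definable_pred (\<lambda>f. is_function f I)" "definable_rel (\<lambda>f g. A (\<lambda>i. ap f i = ap g i))"
    unfolding definable_defs by (intro definable_intros A_definable)+
  show "elts (cc g) = cc ` {f. is_function f I \<and> A (\<lambda>i. ap f i \<epsilon> ap g i)}" if "is_function g I" for g
    using that by (rule cc_collapse)
  show "A (\<lambda>i. ap z i \<epsilon> ap g i)" if "A (\<lambda>i. ap z i = ap z' i)" "A (\<lambda>i. ap z' i \<epsilon> ap g i)" for z z' g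
  proof (rule A_mono[OF A_conj[OF that]])
  qed (auto simp: definable_defs intro!: definable_intros)
  show "\<exists>z. is_function z I \<and> (A (\<lambda>i. ap z i \<epsilon> ap f i) \<and> \<not> A (\<lambda>i. ap z i \<epsilon> ap g i)
      \<or> A (\<lambda>i. ap z i \<epsilon> ap g i) \<and> \<not> A (\<lambda>i. ap z i \<epsilon> ap f i))"
    if ne: "\<not> A (\<lambda>i. ap f i = ap g i)" for f g
  proof -
    have "A (\<lambda>i. \<not> ap f i = ap g i)"
      using ne by (subst A_not) (auto simp: definable_defs intro!: definable_intros)
    then have "A (\<lambda>i. \<exists>z. z \<epsilon> un (ap f i) (ap g i) \<and> (z \<epsilon> ap f i \<longleftrightarrow> \<not> z \<epsilon> ap g i))"
    proof (rule A_mono)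
      fix i assume "\<not> ap f i = ap g i"
      then obtain z where "z \<epsilon> ap f i \<longleftrightarrow> \<not> z \<epsilon> ap g i" using extensionality by blast
      then show "\<exists>z. z \<epsilon> un (ap f i) (ap g i) \<and> (z \<epsilon> ap f i \<longleftrightarrow> \<not> z \<epsilon> ap g i)"
        by (intro exI[of _ z]) auto
    qed (unfold definable_defs, (intro definable_intros)+)
    then have "\<exists>Z. definable_fun Z \<and>
        A (\<lambda>i. Z i \<epsilon> un (ap f i) (ap g i) \<and> (Z i \<epsilon> ap f i \<longleftrightarrow> \<not> Z i \<epsilon> ap g i))"
      by (rule A_choice[rotated 2]) (unfold definable_defs, (intro definable_intros)+)
    then obtain Z where Z: "definable_fun Z"
      "A (\<lambda>i. Z i \<epsilon> un (ap f i) (ap g i) \<and> (Z i \<epsilon> ap f i \<longleftrightarrow> \<not> Z i \<epsilon> ap g i))" by blast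
    note d = definable_intros definable_funD[OF Z(1)]
    have "A (\<lambda>i. (Z i \<epsilon> ap f i \<and> \<not> Z i \<epsilon> ap g i) \<or> (Z i \<epsilon> ap g i \<and> \<not> Z i \<epsilon> ap f i))"
      by (rule A_mono[OF Z(2)]) (force, unfold definable_defs, (intro d)+)
    then have "A (\<lambda>i. Z i \<epsilon> ap f i \<and> \<not> Z i \<epsilon> ap g i) \<or> A (\<lambda>i. Z i \<epsilon> ap g i \<and> \<not> Z i \<epsilon> ap f i)"
      by (rule A_or) (unfold definable_defs, (intro d)+)
    moreover have "A (\<lambda>i. ap (lam I Z) i \<epsilon> ap h i) \<and> \<not> A (\<lambda>i. ap (lam I Z) i \<epsilon> ap k i)"
      if hk: "A (\<lambda>i. Z i \<epsilon> ap h i \<and> \<not> Z i \<epsilon> ap k i)" for h k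
    proof
      show "A (\<lambda>i. ap (lam I Z) i \<epsilon> ap h i)"
        by (rule A_mono[OF hk]) (simp add: Z(1), unfold definable_defs, (intro d)+)
      have "A (\<lambda>i. \<not> ap (lam I Z) i \<epsilon> ap k i)"
        by (rule A_mono[OF hk]) (simp add: Z(1), unfold definable_defs, (intro d)+)
      then show "\<not> A (\<lambda>i. ap (lam I Z) i \<epsilon> ap k i)"
        by (subst (asm) A_not) (unfold definable_defs, (intro d)+)
    qed
    ultimately show ?thesis using is_function_lam[OF Z(1)] by blast
  qed
qed

lemma cls_eqD:
  assumes F: "definable_fun F" and G: "definable_fun G" and eq: "cls F = cls G"
  shows "A (\<lambda>i. F i = G i)"
proof (rule A_mono)
  show "A (\<lambda>i. ap (lam I F) i = ap (lam I G) i)"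
    using eq unfolding cls_def by (intro cc_inj is_function_lam F G)
qed (simp add: F G, unfold definable_defs, (intro definable_intros definable_funD[OF F] definable_funD[OF G])+)

lemma mem_cls:
  assumes G: "definable_fun G"
  shows "x \<epsilon> cls G \<longleftrightarrow> (\<exists>F. definable_fun F \<and> x = cls F \<and> A (\<lambda>i. F i \<epsilon> G i))"
proof
  assume "x \<epsilon> cls G"
  then have "x \<in> elts (cc (lam I G))" by (simp add: cls_def)
  then obtain f where f: "is_function f I" "x = cc f" "A (\<lambda>i. ap f i \<epsilon> ap (lam I G) i)"
    unfolding cc_collapse[OF is_function_lam[OF G]] by blast
  have "x = cls (ap f)" using f(2) is_function_eq_lam[OF f(1)] by (simp add: cls_def)
  moreover have "A (\<lambda>i. ap f i \<epsilon> G i)"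
    by (rule A_mono[OF f(3)]) (simp add: G, unfold definable_defs,
        (intro definable_intros definable_funD[OF G])+)
  ultimately show "\<exists>F. definable_fun F \<and> x = cls F \<and> A (\<lambda>i. F i \<epsilon> G i)"
    using definable_ap_fun by blast
next
  assume "\<exists>F. definable_fun F \<and> x = cls F \<and> A (\<lambda>i. F i \<epsilon> G i)"
  then obtain F where F: "definable_fun F" "x = cls F" "A (\<lambda>i. F i \<epsilon> G i)" by blast
  have "A (\<lambda>i. ap (lam I F) i \<epsilon> ap (lam I G) i)"
    by (rule A_mono[OF F(3)]) (simp add: F(1) G, unfold definable_defs,
        (intro definable_intros definable_funD[OF F(1)] definable_funD[OF G])+)
  then have "x \<in> elts (cc (lam I G))"
    unfolding cc_collapse[OF is_function_lam[OF G]] F(2) cls_def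
    using is_function_lam[OF F(1)] by blast
  then show "x \<epsilon> cls G" by (simp add: cls_def)
qed

text \<open>For the forward direction, the element is represented by some \<open>H\<close> with the
  same collapse as \<open>F\<close>; injectivity of the collapse makes \<open>F\<close> and
  \<open>H\<close> agree almost everywhere.\<close>

lemma cls_mem:
  assumes F: "definable_fun F" and G: "definable_fun G"
  shows "cls F \<epsilon> cls G \<longleftrightarrow> A (\<lambda>i. F i \<epsilon> G i)"
proof
  assume "cls F \<epsilon> cls G"
  then obtain H where H: "definable_fun H" "cls F = cls H" "A (\<lambda>i. H i \<epsilon> G i)"
    using mem_cls[OF G] by blast
  note d = definable_intros definable_funD[OF F] definable_funD[OF G] definable_funD[OF H(1)]
  from cls_eqD[OF F H(1,2)] H(3) have "A (\<lambda>i. F i = H i \<and> H i \<epsilon> G i)"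
    by (rule A_conj) (unfold definable_defs, (intro d)+)
  then show "A (\<lambda>i. F i \<epsilon> G i)"
    by (rule A_mono) (simp, unfold definable_defs, (intro d)+)
qed (use mem_cls[OF G] F in blast)

lemma cls_eq:
  assumes F: "definable_fun F" and G: "definable_fun G"
  shows "cls F = cls G \<longleftrightarrow> A (\<lambda>i. F i = G i)"
proof
  have sub: "x \<epsilon> cls G" if FG: "A (\<lambda>i. F i = G i)" "definable_fun F" "definable_fun G"
    "x \<epsilon> cls F" for F G x
  proof -
    obtain H where H: "definable_fun H" "x = cls H" "A (\<lambda>i. H i \<epsilon> F i)"
      using FG mem_cls by blast
    note d = definable_intros definable_funD[OF FG(2)] definable_funD[OF FG(3)] definable_funD[OF H(1)]
    have "A (\<lambda>i. F i = G i \<and> H i \<epsilon> F i)"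
      by (rule A_conj[OF FG(1) H(3)]) (unfold definable_defs, (intro d)+)
    then have "A (\<lambda>i. H i \<epsilon> G i)"
      by (rule A_mono) (metis, unfold definable_defs, (intro d)+)
    then show ?thesis using H cls_mem FG by blast
  qed
  assume eq: "A (\<lambda>i. F i = G i)"
  have eq': "A (\<lambda>i. G i = F i)"
    by (rule A_mono[OF eq]) (simp, unfold definable_defs,
        (intro definable_intros definable_funD[OF F] definable_funD[OF G])+)
  show "cls F = cls G"
    using sub[OF eq F G] sub[OF eq' G F] by (intro extensionality) blast
qed (rule cls_eqD[OF F G])

text \<open>Los's theorem for this formula, by contradiction. Let \<open>K\<close> represent the
  witness \<open>\<xi>\<close>. Where the order fails, \<open>K i\<close> is not a witness, so some
  point of the symmetric difference is neither below nor equal to \<open>K i\<close>; the class of a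
  choice \<open>H\<close> of such points contradicts the property of \<open>\<xi>\<close>.\<close>

lemma fso_less_cls:
  assumes F: "definable_fun F" and G: "definable_fun G" and less: "fso_less (cls F) (cls G)"
  shows "A (\<lambda>i. fso_less (F i) (G i))"
proof (rule ccontr)
  assume "\<not> A (\<lambda>i. fso_less (F i) (G i))"
  moreover note d0 = definable_intros definable_funD[OF F] definable_funD[OF G]
  moreover have dless: "definable_pred (\<lambda>i. fso_less (F i) (G i))"
    unfolding definable_defs by (intro d0)
  ultimately have nl: "A (\<lambda>i. \<not> fso_less (F i) (G i))" by (simp add: A_not)
  obtain \<xi> where \<xi>: "\<xi> \<epsilon> cls G" "\<not> \<xi> \<epsilon> cls F"
    "\<And>\<eta>. \<eta> \<epsilon> cls F \<and> \<not> \<eta> \<epsilon> cls G \<or> \<eta> \<epsilon> cls G \<and> \<not> \<eta> \<epsilon> cls F \<Longrightarrow> \<eta> \<epsilon> \<xi> \<or> \<eta> = \<xi>"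
    using less unfolding fso_less_def by auto
  obtain K where K: "definable_fun K" "\<xi> = cls K" "A (\<lambda>i. K i \<epsilon> G i)"
    using \<xi>(1) mem_cls[OF G] by blast
  note d = d0 definable_funD[OF K(1)]
  have "\<not> A (\<lambda>i. K i \<epsilon> F i)" using \<xi>(2) K cls_mem F by blast
  moreover have "definable_pred (\<lambda>i. K i \<epsilon> F i)" unfolding definable_defs by (intro d)
  ultimately have KF: "A (\<lambda>i. \<not> K i \<epsilon> F i)" by (simp add: A_not)
  have "A (\<lambda>i. (K i \<epsilon> G i \<and> \<not> K i \<epsilon> F i) \<and> \<not> fso_less (F i) (G i))"
    by (intro A_conj K(3) KF nl; unfold definable_defs; intro d)
  then have "A (\<lambda>i. \<exists>\<eta>. \<eta> \<epsilon> un (F i) (G i) \<and> ((\<eta> \<epsilon> F i \<longleftrightarrow> \<not> \<eta> \<epsilon> G i) \<and> \<not> \<eta> \<epsilon> K i \<and> \<eta> \<noteq> K i))"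
    by (rule A_mono) (unfold fso_less_def, force, unfold definable_defs fso_less_def[symmetric], (intro d)+)
  then have "\<exists>H. definable_fun H \<and> A (\<lambda>i. H i \<epsilon> un (F i) (G i) \<and>
      ((H i \<epsilon> F i \<longleftrightarrow> \<not> H i \<epsilon> G i) \<and> \<not> H i \<epsilon> K i \<and> H i \<noteq> K i))"
    by (rule A_choice[rotated 2]) (unfold definable_defs, (intro d)+)
  then obtain H where H: "definable_fun H" "A (\<lambda>i. H i \<epsilon> un (F i) (G i) \<and>
      ((H i \<epsilon> F i \<longleftrightarrow> \<not> H i \<epsilon> G i) \<and> \<not> H i \<epsilon> K i \<and> H i \<noteq> K i))" by blast
  note d = d definable_funD[OF H(1)]
  have "A (\<lambda>i. \<not> H i \<epsilon> K i)" "A (\<lambda>i. \<not> H i = K i)"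
    by (rule A_mono[OF H(2)]; (force | (unfold definable_defs, (intro d)+)))+
  moreover have "definable_pred (\<lambda>i. H i \<epsilon> K i)" "definable_pred (\<lambda>i. H i = K i)"
    unfolding definable_defs by (intro d)+
  ultimately have "\<not> A (\<lambda>i. H i \<epsilon> K i)" "\<not> A (\<lambda>i. H i = K i)"
    by (simp_all add: A_not)
  then have H1: "\<not> (cls H \<epsilon> \<xi> \<or> cls H = \<xi>)"
    using cls_mem[OF H(1) K(1)] cls_eq[OF H(1) K(1)] K(2) by blast
  have "A (\<lambda>i. (H i \<epsilon> F i \<and> \<not> H i \<epsilon> G i) \<or> (H i \<epsilon> G i \<and> \<not> H i \<epsilon> F i))"
    by (rule A_mono[OF H(2)]) (force, unfold definable_defs, (intro d)+)
  then have "A (\<lambda>i. H i \<epsilon> F i \<and> \<not> H i \<epsilon> G i) \<or> A (\<lambda>i. H i \<epsilon> G i \<and> \<not> H i \<epsilon> F i)"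
    by (rule A_or) (unfold definable_defs, (intro d)+)
  moreover have "cls H \<epsilon> cls P \<and> \<not> cls H \<epsilon> cls Q"
    if PQ: "A (\<lambda>i. H i \<epsilon> P i \<and> \<not> H i \<epsilon> Q i)" "definable_fun P" "definable_fun Q" for P Q
  proof
    note d = d definable_funD[OF PQ(2)] definable_funD[OF PQ(3)]
    have "A (\<lambda>i. H i \<epsilon> P i)"
      by (rule A_mono[OF PQ(1)]) (force, unfold definable_defs, (intro d)+)
    then show "cls H \<epsilon> cls P" using cls_mem[OF H(1) PQ(2)] by blast
    have "A (\<lambda>i. \<not> H i \<epsilon> Q i)"
      by (rule A_mono[OF PQ(1)]) (force, unfold definable_defs, (intro d)+)
    then have "\<not> A (\<lambda>i. H i \<epsilon> Q i)"
      by (subst (asm) A_not) (unfold definable_defs, (intro d)+)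
    then show "\<not> cls H \<epsilon> cls Q" using cls_mem[OF H(1) PQ(3)] by blast
  qed
  ultimately show False using \<xi>(3) H1 F G by blast
qed

lemma definable_cls [definable_intros]:
  "definable_term (\<lambda>e. F (\<lambda>i. e (Suc i)) (e 0)) \<Longrightarrow> definable_term (\<lambda>e. cls (F e))"
  unfolding cls_def by (intro definable_funD[OF cc_definable] definable_intros)

section \<open>Pairs and functions in the ultrapower\<close>

lemma cls_doubleton:
  assumes F: "definable_fun F" and G: "definable_fun G"
  shows "cls (\<lambda>i. mkset {F i, G i}) = mkset {cls F, cls G}"
proof (rule extensionality, rule allI)
  fix x
  note d = definable_intros definable_funD[OF F] definable_funD[OF G]
  have FG: "definable_fun (\<lambda>i. mkset {F i, G i})" unfolding definable_defs by (intro d)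
  have "x \<epsilon> cls (\<lambda>i. mkset {F i, G i}) \<longleftrightarrow> (\<exists>H. definable_fun H \<and> x = cls H \<and> A (\<lambda>i. H i = F i \<or> H i = G i))"
    unfolding mem_cls[OF FG] by simp
  also have "\<dots> \<longleftrightarrow> x = cls F \<or> x = cls G"
  proof
    assume "\<exists>H. definable_fun H \<and> x = cls H \<and> A (\<lambda>i. H i = F i \<or> H i = G i)"
    then obtain H where H: "definable_fun H" "x = cls H" "A (\<lambda>i. H i = F i \<or> H i = G i)" by blast
    have "A (\<lambda>i. H i = F i) \<or> A (\<lambda>i. H i = G i)"
      by (rule A_or[OF H(3)]) (unfold definable_defs, (intro d definable_funD[OF H(1)])+)
    then show "x = cls F \<or> x = cls G" using cls_eq H F G by metis
  next
    have "A (\<lambda>i. F i = F i \<or> F i = G i)" "A (\<lambda>i. G i = F i \<or> G i = G i)"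
      by (rule A_all, blast, unfold definable_defs, intro d)+
    then show "x = cls F \<or> x = cls G \<Longrightarrow> \<exists>H. definable_fun H \<and> x = cls H \<and> A (\<lambda>i. H i = F i \<or> H i = G i)"
      using F G by blast
  qed
  finally show "x \<epsilon> cls (\<lambda>i. mkset {F i, G i}) \<longleftrightarrow> x \<epsilon> mkset {cls F, cls G}" by simp
qed

lemma cls_pair:
  assumes F: "definable_fun F" and G: "definable_fun G"
  shows "cls (\<lambda>i. pair (F i) (G i)) = pair (cls F) (cls G)"
proof -
  note d = definable_intros definable_funD[OF F] definable_funD[OF G]
  have p: "pair x y = mkset {mkset {x, x}, mkset {x, y}}" for x y by (simp add: pair_def)
  have "definable_fun (\<lambda>i. mkset {F i, F i})" "definable_fun (\<lambda>i. mkset {F i, G i})"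
    unfolding definable_defs by (intro d)+
  then show ?thesis unfolding p using F G by (simp only: cls_doubleton)
qed

definition is_cls :: "'v \<Rightarrow> bool" where
  "is_cls x \<longleftrightarrow> (\<exists>F. definable_fun F \<and> x = cls F)"

lemma is_cls_transitive: "is_cls x \<Longrightarrow> y \<epsilon> x \<Longrightarrow> is_cls y"
  using mem_cls unfolding is_cls_def by blast

text \<open>A family of functions represents the function sending \<open>cls y\<close> to
  \<open>cls (\<lambda>a. H a (y a))\<close>. A member of its graph is a class of pairs, and
  \<open>A_choice\<close> picks out the first components.\<close>

lemma mem_cls_lam:
  assumes b: "definable_fun b" and H: "definable_op H"
  shows "p \<epsilon> cls (\<lambda>a. lam (b a) (H a)) \<longleftrightarrow>
    (\<exists>y. definable_fun y \<and> A (\<lambda>a. y a \<epsilon> b a) \<and> p = pair (cls y) (cls (\<lambda>a. H a (y a))))"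
proof -
  note d0 = definable_intros definable_funD[OF b] definable_opD[OF H]
  have Ha: "definable_fun (H a)" for a unfolding definable_defs by (intro d0)
  have L: "definable_fun (\<lambda>a. lam (b a) (H a))" unfolding definable_defs by (intro d0)
  show ?thesis
  proof
    assume "p \<epsilon> cls (\<lambda>a. lam (b a) (H a))"
    then obtain P where P: "definable_fun P" "p = cls P" "A (\<lambda>a. \<exists>y. y \<epsilon> b a \<and> P a = pair y (H a y))"
      unfolding mem_cls[OF L] mem_lam[OF Ha] by blast
    note d = d0 definable_funD[OF P(1)]
    have "\<exists>y. definable_fun y \<and> A (\<lambda>a. y a \<epsilon> b a \<and> P a = pair (y a) (H a (y a)))"
      by (rule A_choice[OF _ b P(3)]) (unfold definable_defs, intro d)
    then obtain y where y: "definable_fun y" "A (\<lambda>a. y a \<epsilon> b a \<and> P a = pair (y a) (H a (y a)))" by blast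
    note d = d definable_funD[OF y(1)]
    have yb: "A (\<lambda>a. y a \<epsilon> b a)" and "A (\<lambda>a. P a = pair (y a) (H a (y a)))"
      by (rule A_mono[OF y(2)]; (blast | (unfold definable_defs, intro d)))+
    moreover have Hy: "definable_fun (\<lambda>a. pair (y a) (H a (y a)))" "definable_fun (\<lambda>a. H a (y a))"
      unfolding definable_defs by (intro d)+
    ultimately have "p = pair (cls y) (cls (\<lambda>a. H a (y a)))"
      using cls_eq[OF P(1) Hy(1)] P(2) cls_pair[OF y(1) Hy(2)] by simp
    with y(1) yb show "\<exists>y. definable_fun y \<and> A (\<lambda>a. y a \<epsilon> b a) \<and> p = pair (cls y) (cls (\<lambda>a. H a (y a)))"
      by blast
  next
    assume "\<exists>y. definable_fun y \<and> A (\<lambda>a. y a \<epsilon> b a) \<and> p = pair (cls y) (cls (\<lambda>a. H a (y a)))"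
    then obtain y where y: "definable_fun y" "A (\<lambda>a. y a \<epsilon> b a)" "p = pair (cls y) (cls (\<lambda>a. H a (y a)))"
      by blast
    note d = d0 definable_funD[OF y(1)]
    have Hy: "definable_fun (\<lambda>a. H a (y a))" "definable_fun (\<lambda>a. pair (y a) (H a (y a)))"
      unfolding definable_defs by (intro d)+
    have "A (\<lambda>a. pair (y a) (H a (y a)) \<epsilon> lam (b a) (H a))"
      by (rule A_mono[OF y(2)]) (simp add: mem_lam[OF Ha], unfold definable_defs, (intro d)+)
    then show "p \<epsilon> cls (\<lambda>a. lam (b a) (H a))"
      unfolding y(3) cls_pair[OF y(1) Hy(1), symmetric] using cls_mem[OF Hy(2) L] by blast
  qed
qed

lemma is_function_cls_lam:
  assumes b: "definable_fun b" and H: "definable_op H"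
  shows "is_function (cls (\<lambda>a. lam (b a) (H a))) (cls b)"
  unfolding is_function_def Ball_def elts_iff
proof (intro conjI allI impI)
  note m = mem_cls_lam[OF b H]
  fix p assume "p \<epsilon> cls (\<lambda>a. lam (b a) (H a))"
  then obtain y where "definable_fun y" "A (\<lambda>a. y a \<epsilon> b a)" "p = pair (cls y) (cls (\<lambda>a. H a (y a)))"
    unfolding m by blast
  then show "\<exists>x\<in>elts (cls b). \<exists>y. p = pair x y" using cls_mem b by (metis elts_iff)
next
  note m = mem_cls_lam[OF b H]
  fix x assume "x \<epsilon> cls b"
  then obtain y where y: "definable_fun y" "A (\<lambda>a. y a \<epsilon> b a)" "x = cls y"
    using mem_cls[OF b] by blast
  show "\<exists>!z. pair x z \<epsilon> cls (\<lambda>a. lam (b a) (H a))"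
  proof (rule ex1I)
    show "pair x (cls (\<lambda>a. H a (y a))) \<epsilon> cls (\<lambda>a. lam (b a) (H a))"
      unfolding m using y by blast
    fix z assume "pair x z \<epsilon> cls (\<lambda>a. lam (b a) (H a))"
    then obtain y' where y': "definable_fun y'" "x = cls y'" "z = cls (\<lambda>a. H a (y' a))"
      unfolding m by auto
    note d = definable_intros definable_opD[OF H] definable_funD[OF y(1)] definable_funD[OF y'(1)]
    have "A (\<lambda>a. y' a = y a)" using cls_eqD[OF y'(1) y(1)] y(3) y'(2) by simp
    then have "A (\<lambda>a. H a (y' a) = H a (y a))"
      by (rule A_mono) (simp, unfold definable_defs, (intro d)+)
    moreover have "definable_fun (\<lambda>a. H a (y a))" "definable_fun (\<lambda>a. H a (y' a))"
      unfolding definable_defs by (intro d)+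
    ultimately show "z = cls (\<lambda>a. H a (y a))" unfolding y'(3) using cls_eq by blast
  qed
qed

lemma ap_cls_lam:
  assumes b: "definable_fun b" and H: "definable_op H" and y: "definable_fun y" "A (\<lambda>a. y a \<epsilon> b a)"
  shows "ap (cls (\<lambda>a. lam (b a) (H a))) (cls y) = cls (\<lambda>a. H a (y a))"
proof -
  have "cls y \<epsilon> cls b" using cls_mem[OF y(1) b] y(2) by blast
  moreover have "pair (cls y) (cls (\<lambda>a. H a (y a))) \<epsilon> cls (\<lambda>a. lam (b a) (H a))"
    unfolding mem_cls_lam[OF b H] using y by blast
  ultimately show ?thesis using is_functionD(1)[OF is_function_cls_lam[OF b H]] by metis
qed

text \<open>The sets \<open>h a\<close> are not assumed to be functions. If the value at
  \<open>y a\<close> were ambiguous almost everywhere, a choice \<open>u\<close> of second values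
  would give the function \<open>cls h\<close> two values at \<open>cls y\<close>.\<close>

lemma ap_cls:
  assumes b: "definable_fun b" and h: "definable_fun h" and f: "is_function (cls h) (cls b)"
    and y: "definable_fun y" "A (\<lambda>a. y a \<epsilon> b a)"
  shows "ap (cls h) (cls y) = cls (\<lambda>a. ap (h a) (y a))"
proof -
  have yb: "cls y \<epsilon> cls b" using cls_mem[OF y(1) b] y(2) by blast
  define z where "z = ap (cls h) (cls y)"
  have z: "pair (cls y) u \<epsilon> cls h \<longleftrightarrow> u = z" for u using is_functionD(1)[OF f yb] by (simp add: z_def)
  have "is_cls (cls h)" using h by (auto simp: is_cls_def)
  moreover have "pair (cls y) z \<epsilon> cls h" using z by simp
  moreover have "mkset {cls y, z} \<epsilon> pair (cls y) z" by (simp add: mem_pair)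
  moreover have "z \<epsilon> mkset {cls y, z}" by simp
  ultimately have "is_cls z" using is_cls_transitive by metis
  then obtain v where v: "definable_fun v" "z = cls v" by (auto simp: is_cls_def)
  note d = definable_intros definable_funD[OF h] definable_funD[OF y(1)] definable_funD[OF v(1)]
  have P: "definable_fun (\<lambda>a. pair (y a) (v a))" and Ap: "definable_fun (\<lambda>a. ap (h a) (y a))"
    unfolding definable_defs by (intro d)+
  have "cls (\<lambda>a. pair (y a) (v a)) \<epsilon> cls h" using z v by (simp add: cls_pair y(1))
  then have Ah: "A (\<lambda>a. pair (y a) (v a) \<epsilon> h a)" using cls_mem[OF P h] by blast
  have "A (\<lambda>a. ap (h a) (y a) = v a)"
  proof (rule ccontr)
    assume "\<not> A (\<lambda>a. ap (h a) (y a) = v a)"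
    moreover have "definable_pred (\<lambda>a. ap (h a) (y a) = v a)" unfolding definable_defs by (intro d)
    ultimately have "A (\<lambda>a. \<not> ap (h a) (y a) = v a)" by (simp add: A_not)
    with Ah have "A (\<lambda>a. pair (y a) (v a) \<epsilon> h a \<and> \<not> ap (h a) (y a) = v a)"
      by (rule A_conj) (unfold definable_defs, (intro d)+)
    then have "A (\<lambda>a. \<exists>u. u \<epsilon> union (union (h a)) \<and> (pair (y a) u \<epsilon> h a \<and> u \<noteq> v a))"
    proof (rule A_mono)
      fix a assume "pair (y a) (v a) \<epsilon> h a \<and> \<not> ap (h a) (y a) = v a"
      then obtain u where u: "pair (y a) u \<epsilon> h a" "u \<noteq> v a" using ap_eqI by metis
      \<comment> \<open>Both components of a Kuratowski pair lie in the double union, which bounds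
        the choice of \<open>u\<close>.\<close>
      moreover have "u \<epsilon> union (union (h a))"
        unfolding mem_union using u(1) by (meson mem_doubleton mem_pair)
      ultimately show "\<exists>u. u \<epsilon> union (union (h a)) \<and> (pair (y a) u \<epsilon> h a \<and> u \<noteq> v a)" by blast
    qed (unfold definable_defs, (intro d)+)
    then have "\<exists>u. definable_fun u \<and> A (\<lambda>a. u a \<epsilon> union (union (h a)) \<and> (pair (y a) (u a) \<epsilon> h a \<and> u a \<noteq> v a))"
      by (rule A_choice[rotated 2]) (unfold definable_defs, (intro d)+)
    then obtain u where u: "definable_fun u"
      "A (\<lambda>a. u a \<epsilon> union (union (h a)) \<and> (pair (y a) (u a) \<epsilon> h a \<and> u a \<noteq> v a))" by blast
    note d = d definable_funD[OF u(1)]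
    have u1: "A (\<lambda>a. pair (y a) (u a) \<epsilon> h a)" and u2: "A (\<lambda>a. \<not> u a = v a)"
      by (rule A_mono[OF u(2)]; (blast | (unfold definable_defs, intro d)))+
    have "definable_fun (\<lambda>a. pair (y a) (u a))" unfolding definable_defs by (intro d)
    from cls_mem[OF this h] u1 have "pair (cls y) (cls u) \<epsilon> cls h" by (simp add: cls_pair y(1) u(1))
    then have "A (\<lambda>a. u a = v a)" using z v cls_eqD[OF u(1) v(1)] by simp
    moreover have "definable_pred (\<lambda>a. u a = v a)" unfolding definable_defs by (intro d)
    ultimately show False using u2 by (simp add: A_not)
  qed
  then show ?thesis using cls_eq[OF Ap v(1)] v(2) z_def by simp
qed

text \<open>Only \<open>cls h\<close> is known to be a function on \<open>cls b\<close>; restricting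
  \<open>ap (h a)\<close> to \<open>b a\<close> yields a representative whose fibres are functions
  with the right domains.\<close>

lemma is_function_eq_cls_lam:
  assumes b: "definable_fun b" and h: "definable_fun h" and f: "is_function (cls h) (cls b)"
  shows "cls h = cls (\<lambda>a. lam (b a) (ap (h a)))"
proof (rule is_function_ext[OF f])
  have H: "definable_op (\<lambda>a. ap (h a))"
    unfolding definable_defs by (intro definable_intros definable_funD[OF h])
  show "is_function (cls (\<lambda>a. lam (b a) (ap (h a)))) (cls b)" by (rule is_function_cls_lam[OF b H])
  fix x assume "x \<epsilon> cls b"
  then obtain y where y: "definable_fun y" "x = cls y" "A (\<lambda>a. y a \<epsilon> b a)"
    using mem_cls[OF b] by blast
  show "ap (cls h) x = ap (cls (\<lambda>a. lam (b a) (ap (h a)))) x"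
    unfolding y(2) ap_cls[OF b h f y(1,3)] ap_cls_lam[OF b H y(1,3)] ..
qed

lemma const_fun_cls:
  assumes b: "definable_fun b" and g: "definable_fun g"
  shows "const_fun (cls b) (cls g) = cls (\<lambda>a. lam (b a) (\<lambda>_. g a))"
proof (rule is_function_ext)
  have H: "definable_op (\<lambda>a _. g a)" unfolding definable_defs by (intro definable_intros definable_funD[OF g])
  have K: "definable_fun (\<lambda>_. cls g)" unfolding definable_defs by (intro definable_intros)
  show "is_function (const_fun (cls b) (cls g)) (cls b)"
    unfolding const_fun_eq_lam by (rule is_function_lam[OF K])
  show "is_function (cls (\<lambda>a. lam (b a) (\<lambda>_. g a))) (cls b)" by (rule is_function_cls_lam[OF b H])
  fix x assume x: "x \<epsilon> cls b"
  then obtain y where y: "definable_fun y" "x = cls y" "A (\<lambda>a. y a \<epsilon> b a)"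
    using mem_cls[OF b] by blast
  show "ap (const_fun (cls b) (cls g)) x = ap (cls (\<lambda>a. lam (b a) (\<lambda>_. g a))) x"
    using ap_cls_lam[OF b H y(1,3)] x by (simp add: const_fun_eq_lam ap_lam[OF K] y(2))
qed

end

section \<open>Ultrapowers and iterated ultrapowers\<close>

locale ultrapower = zfc_model mem for mem :: "'v \<Rightarrow> 'v \<Rightarrow> bool" (infix "\<epsilon>" 50) +
  fixes X U :: 'v and c :: "'v \<Rightarrow> 'v"
  assumes cc_U: "cc_ultrafilter UNIV X U" and collapse_c: "ult_collapse UNIV U c"
begin

definition ae :: "('v \<Rightarrow> bool) \<Rightarrow> bool" where
  "ae P \<longleftrightarrow> sep X P \<epsilon> U"

lemma union_U: "union U = X"
  by (rule cc_ultrafilter_union[OF cc_U])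

sublocale U: ultra_quantifier mem X ae c
proof unfold_locales
  note U = cc_ultrafilterD[OF cc_U]
  show not: "ae (\<lambda>i. \<not> P i) \<longleftrightarrow> \<not> ae P" if P: "definable_pred P" for P
  proof -
    have nP: "definable_pred (\<lambda>i. \<not> P i)" using P unfolding definable_pred_def by (rule definable_Not)
    have "mkset (elts X - elts (sep X P)) = sep X (\<lambda>i. \<not> P i)"
      by (rule sep_eqI[OF nP]) (auto simp: mem_sep[OF P])
    moreover have "sep X P \<epsilon> U \<or> mkset (elts X - elts (sep X P)) \<epsilon> U"
      by (rule U(8)) (auto simp: mem_sep[OF P])
    moreover have "mkset (elts (sep X P) \<inter> elts (sep X (\<lambda>i. \<not> P i))) = empty"
      by (rule mkset_eqI) (auto simp: mem_sep[OF P] mem_sep[OF nP])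
    moreover note U(5) U(7)[of "sep X P" "sep X (\<lambda>i. \<not> P i)"]
    ultimately show ?thesis unfolding ae_def by metis
  qed
  show "ae Q" if "ae P" "\<And>i. i \<epsilon> X \<Longrightarrow> P i \<Longrightarrow> Q i" "definable_pred P" "definable_pred Q" for P Q
  proof -
    have "elts (sep X P) \<subseteq> elts (sep X Q)" "elts (sep X Q) \<subseteq> elts X"
      using that by (auto simp: mem_sep)
    then show ?thesis using U(6) that(1) unfolding ae_def by blast
  qed
  show "ae (\<lambda>i. P i \<and> Q i)" if PQ: "ae P" "ae Q" "definable_pred P" "definable_pred Q" for P Q
  proof -
    have d: "definable_pred (\<lambda>i. P i \<and> Q i)"
      using PQ(3,4) unfolding definable_pred_def by (rule definable_And)
    have "mkset (elts (sep X P) \<inter> elts (sep X Q)) = sep X (\<lambda>i. P i \<and> Q i)"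
      by (rule sep_eqI[OF d]) (auto simp: mem_sep PQ)
    then show ?thesis using U(7) PQ unfolding ae_def by metis
  qed
  show "definable (\<lambda>e. ae (P e))" if "definable (\<lambda>e. P (\<lambda>i. e (Suc i)) (e 0))" for P
    unfolding ae_def by (intro definable_intros that)
  show "definable_fun c"
    using collapse_c unfolding ult_collapse_def by (blast intro: class_function_definable)
  show "elts (c g) = c ` {f. is_function f X \<and> ae (\<lambda>i. ap f i \<epsilon> ap g i)}" if g: "is_function g X" for g
  proof -
    have "ult_mem U f g \<longleftrightarrow> ae (\<lambda>i. ap f i \<epsilon> ap g i)" if f: "is_function f X" for f
    proof -
      have "mkset {x. x \<epsilon> X \<and> app f x \<epsilon> app g x} = sep X (\<lambda>x. ap f x \<epsilon> ap g x)"
        by (rule sep_eqI) (auto simp: is_functionD(2)[OF f] is_functionD(2)[OF g] definable_defs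
            intro!: definable_intros)
      then show ?thesis unfolding ult_mem_def union_U ae_def by simp
    qed
    then have "{f \<in> ult_functions UNIV U. ult_mem U f g} = {f. is_function f X \<and> ae (\<lambda>i. ap f i \<epsilon> ap g i)}"
      unfolding ult_functions_def union_U by auto
    then show ?thesis
      using collapse_c g unfolding ult_collapse_def ult_functions_def union_U by auto
  qed
qed

lemma Ult_iff: "x \<in> Ult UNIV U c \<longleftrightarrow> U.is_cls x"
proof
  assume "x \<in> Ult UNIV U c"
  then obtain f where "is_function f X" "x = c f"
    by (auto simp: Ult_def ult_functions_def union_U)
  then have "x = U.cls (ap f)" using is_function_eq_lam unfolding U.cls_def by metis
  then show "U.is_cls x" using U.definable_ap_fun by (auto simp: U.is_cls_def)
next
  assume "U.is_cls x"
  then obtain F where "definable_fun F" "x = U.cls F" by (auto simp: U.is_cls_def)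
  then show "x \<in> Ult UNIV U c"
    using is_function_lam by (auto simp: Ult_def ult_functions_def union_U U.cls_def)
qed

text \<open>Countable completeness of \<open>U\<close> for predicates; uniform definability in
  \<open>i\<close> makes the sequence of the sets \<open>sep X (P i)\<close> an element of the
  model.\<close>

lemma ae_omega:
  assumes P: "definable_rel P" and ae: "\<And>i. i \<epsilon> omega \<Longrightarrow> ae (P i)"
  shows "ae (\<lambda>a. \<forall>i\<in>elts omega. P i a)"
proof -
  define s where "s = lam omega (\<lambda>i. sep X (P i))"
  have d: "definable_fun (\<lambda>i. sep X (P i))"
    unfolding definable_defs by (intro definable_intros definable_relD[OF P])
  have dP: "definable_pred (P i)" for i
    unfolding definable_defs by (intro definable_intros definable_relD[OF P])
  have s: "ap s i = sep X (P i)" if "i \<epsilon> omega" for i unfolding s_def by (rule ap_lam[OF d that])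
  have "is_function s omega" unfolding s_def by (rule is_function_lam[OF d])
  from cc_ultrafilter_sequence[OF cc_U _ this] have "sep X (\<lambda>x. \<forall>i\<in>elts omega. x \<epsilon> ap s i) \<epsilon> U"
    using ae s unfolding ae_def by simp
  moreover have "sep X (\<lambda>x. \<forall>i\<in>elts omega. x \<epsilon> ap s i) = sep X (\<lambda>x. \<forall>i\<in>elts omega. P i x)"
    by (rule sep_cong) (simp add: s mem_sep[OF dP])
  ultimately show ?thesis unfolding ae_def by simp
qed

text \<open>A function into \<open>\<omega>\<close> is constant almost everywhere, so \<open>j\<close> fixes \<open>\<omega>\<close> pointwise and as a set.\<close>
lemma cls_const_omega_subset:
  assumes N: "elts N \<subseteq> elts omega"
  shows "x \<epsilon> U.cls (\<lambda>_. N) \<longleftrightarrow> (\<exists>k. k \<epsilon> N \<and> x = U.cls (\<lambda>_. k))"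
proof -
  have dc: "definable_fun (\<lambda>_. k)" for k unfolding definable_defs by (intro definable_intros)
  show ?thesis
  proof
    assume "x \<epsilon> U.cls (\<lambda>_. N)"
    then obtain F where F: "definable_fun F" "x = U.cls F" "ae (\<lambda>a. F a \<epsilon> N)"
      using U.mem_cls[OF dc] by blast
    note d = definable_intros definable_funD[OF F(1)]
    have "\<exists>k. k \<epsilon> N \<and> ae (\<lambda>a. F a = k)"
    proof (rule ccontr)
      assume no: "\<nexists>k. k \<epsilon> N \<and> ae (\<lambda>a. F a = k)"
      have "ae (\<lambda>a. \<forall>k\<in>elts omega. k \<epsilon> N \<longrightarrow> \<not> F a = k)"
      proof (rule ae_omega)
        show "definable_rel (\<lambda>k a. k \<epsilon> N \<longrightarrow> \<not> F a = k)" unfolding definable_defs by (intro d)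
        fix k
        have dk: "definable_pred (\<lambda>a. F a = k)" unfolding definable_defs by (intro d)
        show "ae (\<lambda>a. k \<epsilon> N \<longrightarrow> \<not> F a = k)"
        proof (cases "k \<epsilon> N")
          case True
          then show ?thesis using no U.A_not[OF dk] by simp
        next
          case False
          then show ?thesis by (intro U.A_all) (simp, unfold definable_defs, intro d)
        qed
      qed
      then have "ae (\<lambda>a. (\<forall>k\<in>elts omega. k \<epsilon> N \<longrightarrow> \<not> F a = k) \<and> F a \<epsilon> N)"
        by (rule U.A_conj[OF _ F(3)]) (unfold definable_defs, (intro d)+)
      then have "\<exists>a. a \<epsilon> X \<and> (\<forall>k\<in>elts omega. k \<epsilon> N \<longrightarrow> \<not> F a = k) \<and> F a \<epsilon> N"
        by (rule U.A_ex) (unfold definable_defs, intro d)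
      then show False using N by auto
    qed
    then show "\<exists>k. k \<epsilon> N \<and> x = U.cls (\<lambda>_. k)" using U.cls_eq[OF F(1) dc] F(2) by blast
  next
    assume "\<exists>k. k \<epsilon> N \<and> x = U.cls (\<lambda>_. k)"
    then obtain k where k: "k \<epsilon> N" "x = U.cls (\<lambda>_. k)" by blast
    have "ae (\<lambda>_. k \<epsilon> N)"
      by (rule U.A_all) (simp add: k(1), unfold definable_defs, intro definable_intros)
    then show "x \<epsilon> U.cls (\<lambda>_. N)" using U.cls_mem[OF dc dc] k(2) by blast
  qed
qed

lemma cls_const_omega_mem: "n \<epsilon> omega \<Longrightarrow> U.cls (\<lambda>_. n) = n"
proof -
  have "n \<epsilon> omega \<longrightarrow> U.cls (\<lambda>_. n) = n"
  proof (rule class_induct)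
    show "definable_pred (\<lambda>n. n \<epsilon> omega \<longrightarrow> U.cls (\<lambda>_. n) = n)"
      unfolding definable_defs by (intro definable_intros U.definable_cls)
    fix n assume IH: "\<And>k. k \<epsilon> n \<Longrightarrow> k \<epsilon> omega \<longrightarrow> U.cls (\<lambda>_. k) = k"
    show "n \<epsilon> omega \<longrightarrow> U.cls (\<lambda>_. n) = n"
    proof
      assume n: "n \<epsilon> omega"
      then have "elts n \<subseteq> elts omega" using omega_transitive by auto
      then show "U.cls (\<lambda>_. n) = n"
        using IH omega_transitive[OF n]
        by (intro extensionality allI) (unfold cls_const_omega_subset, metis)
    qed
  qed
  then show "n \<epsilon> omega \<Longrightarrow> U.cls (\<lambda>_. n) = n" by blast
qed

lemma cls_const_omega: "U.cls (\<lambda>_. omega) = omega"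
  using cls_const_omega_mem by (intro extensionality allI) (simp add: cls_const_omega_subset, metis)

lemma embedding_eq: "ult_embedding U c A = U.cls (\<lambda>_. A)"
  unfolding ult_embedding_def union_U const_fun_eq_lam U.cls_def ..

lemma id_class_eq: "id_class U c = U.cls (\<lambda>a. a)"
  unfolding id_class_def union_U id_fun_eq_lam U.cls_def ..

end

text \<open>The functions \<open>b\<close> and \<open>w\<close> represent the underlying set and the
  ultrafilter. Having such a \<open>w\<close> means that the ultrafilter is an element of the first
  ultrapower.\<close>

locale iterated_ultrapower = ultrapower mem X U c
  for mem :: "'v \<Rightarrow> 'v \<Rightarrow> bool" (infix "\<epsilon>" 50) and X U c +
  fixes b w d :: "'v \<Rightarrow> 'v"
  assumes b: "definable_fun b" and w: "definable_fun w"
    and cc_W: "cc_ultrafilter (Ult UNIV U c) (U.cls b) (U.cls w)"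
    and collapse_d: "ult_collapse (Ult UNIV U c) (U.cls w) d"
begin

lemma union_W: "union (U.cls w) = U.cls b"
  by (rule cc_ultrafilter_union[OF cc_W])

text \<open>The \<open>U\<close>-sum of the \<open>w a\<close>, a family of subsets of
  \<open>pairs X b\<close>, expressed as a quantifier.\<close>

definition aae :: "('v \<Rightarrow> bool) \<Rightarrow> bool" where
  "aae P \<longleftrightarrow> ae (\<lambda>a. sep (b a) (\<lambda>y. P (pair a y)) \<epsilon> w a)"

definition ext :: "('v \<Rightarrow> bool) \<Rightarrow> 'v" where
  "ext P = U.cls (\<lambda>a. sep (b a) (\<lambda>y. P (pair a y)))"

definition rep :: "'v \<Rightarrow> 'v" where
  "rep h = U.cls (\<lambda>a. lam (b a) (\<lambda>y. ap h (pair a y)))"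

lemma definable_slice: "definable_pred P \<Longrightarrow> definable_fun (\<lambda>a. sep (b a) (\<lambda>y. P (pair a y)))"
proof -
  assume P: "definable_pred P"
  show ?thesis unfolding definable_defs by (intro definable_intros definable_funD[OF b] definable_predD[OF P])
qed

lemma aae_iff: "definable_pred P \<Longrightarrow> aae P \<longleftrightarrow> ext P \<epsilon> U.cls w"
  unfolding aae_def ext_def using U.cls_mem[OF definable_slice w] by blast

lemma ext_in_Ult: "definable_pred P \<Longrightarrow> ext P \<in> Ult UNIV U c"
  unfolding Ult_iff ext_def U.is_cls_def using definable_slice by blast

lemma mem_ext:
  assumes P: "definable_pred P" and y: "definable_fun y"
  shows "U.cls y \<epsilon> ext P \<longleftrightarrow> ae (\<lambda>a. y a \<epsilon> b a \<and> P (pair a (y a)))"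
proof -
  have "definable_pred (\<lambda>y. P (pair a y))" for a
    unfolding definable_defs by (intro definable_intros definable_predD[OF P])
  then show ?thesis
    unfolding ext_def U.cls_mem[OF y definable_slice[OF P]] by (simp add: mem_sep)
qed

lemma mem_ext_iff:
  assumes P: "definable_pred P"
  shows "x \<epsilon> ext P \<longleftrightarrow> (\<exists>y. definable_fun y \<and> x = U.cls y \<and> ae (\<lambda>a. y a \<epsilon> b a \<and> P (pair a (y a))))"
proof -
  have "x \<epsilon> ext P \<Longrightarrow> \<exists>y. definable_fun y \<and> x = U.cls y"
    unfolding ext_def using U.mem_cls[OF definable_slice[OF P]] by blast
  then show ?thesis using mem_ext[OF P] by blast
qed

lemma definable_ext_pred:
  assumes P: "definable_pred P" and y: "definable_fun y"
  shows "definable_pred (\<lambda>a. y a \<epsilon> b a \<and> P (pair a (y a)))" "definable_pred (\<lambda>a. P (pair a (y a)))"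
    "definable_pred (\<lambda>a. y a \<epsilon> b a)"
  unfolding definable_defs
  by (intro definable_intros definable_predD[OF P] definable_funD[OF b] definable_funD[OF y])+

lemma ext_subset: "definable_pred P \<Longrightarrow> elts (ext P) \<subseteq> elts (U.cls b)"
proof
  fix x assume P: "definable_pred P" and "x \<in> elts (ext P)"
  then obtain y where y: "definable_fun y" "x = U.cls y" "ae (\<lambda>a. y a \<epsilon> b a \<and> P (pair a (y a)))"
    using mem_ext_iff by auto
  then have "ae (\<lambda>a. y a \<epsilon> b a)"
    using U.A_mono[OF y(3) _ definable_ext_pred(1)[OF P y(1)] definable_ext_pred(3)[OF P y(1)]] by blast
  then show "x \<in> elts (U.cls b)" using U.cls_mem[OF y(1) b] y(2) by simp
qed

text \<open>Functions of the ultrapower on \<open>cls b\<close> correspond to functions on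
  \<open>pairs X b\<close> by uncurrying. The fibres of an arbitrary representative \<open>F\<close>
  need not be functions; \<open>is_function_eq_cls_lam\<close> repairs this.\<close>

lemma ult_functions_rep:
  "f \<in> ult_functions (Ult UNIV U c) (U.cls w) \<longleftrightarrow> (\<exists>h. is_function h (pairs X b) \<and> f = rep h)"
proof
  assume "f \<in> ult_functions (Ult UNIV U c) (U.cls w)"
  then obtain F where F: "definable_fun F" "f = U.cls F" "is_function (U.cls F) (U.cls b)"
    by (auto simp: ult_functions_def union_W Ult_iff U.is_cls_def)
  have "definable_op (\<lambda>a y. ap (F a) y)"
    unfolding definable_defs by (intro definable_intros definable_funD[OF F(1)])
  then have u: "definable_fun (unc (\<lambda>a y. ap (F a) y))" by (rule definable_unc)
  define h where "h = lam (pairs X b) (unc (\<lambda>a y. ap (F a) y))"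
  have "ap h (pair a y) = ap (F a) y" if "a \<epsilon> X" "y \<epsilon> b a" for a y
    unfolding h_def using that by (subst ap_lam[OF u]) (auto simp: mem_pairs[OF b])
  then have "lam (b a) (\<lambda>y. ap h (pair a y)) = lam (b a) (ap (F a))" if "a \<epsilon> X" for a
    using that by (intro lam_cong) auto
  then have "rep h = U.cls (\<lambda>a. lam (b a) (ap (F a)))"
    unfolding rep_def U.cls_def by (intro arg_cong[of _ _ c], rule lam_cong) simp
  then have "rep h = f" unfolding F(2) using U.is_function_eq_cls_lam[OF b F(1,3)] by simp
  then show "\<exists>h. is_function h (pairs X b) \<and> f = rep h"
    using is_function_lam[OF u] h_def by blast
next
  assume "\<exists>h. is_function h (pairs X b) \<and> f = rep h"
  then obtain h where h: "f = rep h" by blast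
  have H: "definable_op (\<lambda>a y. ap h (pair a y))" unfolding definable_defs by (intro definable_intros)
  have "definable_fun (\<lambda>a. lam (b a) (\<lambda>y. ap h (pair a y)))"
    unfolding definable_defs by (intro definable_intros definable_funD[OF b])
  then show "f \<in> ult_functions (Ult UNIV U c) (U.cls w)"
    using U.is_function_cls_lam[OF b H] unfolding ult_functions_def union_W Ult_iff U.is_cls_def h rep_def
    by blast
qed

lemma ult_mem_rep: "ult_mem (U.cls w) (rep f) (rep g) \<longleftrightarrow> aae (\<lambda>p. ap f p \<epsilon> ap g p)"
proof -
  have H: "definable_op (\<lambda>a y. ap h (pair a y))" for h unfolding definable_defs by (intro definable_intros)
  have app: "app (rep h) (U.cls y) = U.cls (\<lambda>a. ap h (pair a (y a)))"
    if y: "definable_fun y" "U.cls y \<epsilon> U.cls b" for h y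
  proof -
    have "is_function (rep h) (U.cls b)" unfolding rep_def by (rule U.is_function_cls_lam[OF b H])
    from is_functionD(2)[OF this y(2)] show ?thesis
      unfolding rep_def using U.ap_cls_lam[OF b H y(1)] y(2) U.cls_mem[OF y(1) b] by simp
  qed
  have P: "definable_pred (\<lambda>p. ap f p \<epsilon> ap g p)" unfolding definable_defs by (intro definable_intros)
  have "mkset {x. x \<epsilon> union (U.cls w) \<and> app (rep f) x \<epsilon> app (rep g) x} = ext (\<lambda>p. ap f p \<epsilon> ap g p)"
  proof (rule mkset_eqI, rule set_eqI)
    fix x
    show "x \<in> elts (ext (\<lambda>p. ap f p \<epsilon> ap g p))
      \<longleftrightarrow> x \<in> {x. x \<epsilon> union (U.cls w) \<and> app (rep f) x \<epsilon> app (rep g) x}"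
    proof (cases "x \<epsilon> U.cls b")
      case False
      then show ?thesis using ext_subset[OF P] by (auto simp: union_W)
    next
      case True
      then obtain y where y: "definable_fun y" "x = U.cls y" "ae (\<lambda>a. y a \<epsilon> b a)"
        using U.mem_cls[OF b] by blast
      have ap: "definable_fun (\<lambda>a. ap h (pair a (y a)))" for h
        unfolding definable_defs by (intro definable_intros definable_funD[OF y(1)])
      have "app (rep f) x \<epsilon> app (rep g) x \<longleftrightarrow> ae (\<lambda>a. ap f (pair a (y a)) \<epsilon> ap g (pair a (y a)))"
        using True unfolding y(2) by (simp add: app[OF y(1)] U.cls_mem[OF ap ap])
      also have "\<dots> \<longleftrightarrow> ae (\<lambda>a. y a \<epsilon> b a \<and> ap f (pair a (y a)) \<epsilon> ap g (pair a (y a)))"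
        using U.A_conj[OF y(3) _ definable_ext_pred(3)[OF P y(1)] definable_ext_pred(2)[OF P y(1)]]
          U.A_mono[OF _ _ definable_ext_pred(1)[OF P y(1)] definable_ext_pred(2)[OF P y(1)]] by blast
      finally show ?thesis using True mem_ext[OF P y(1)] y(2) by (simp add: union_W)
    qed
  qed
  then show ?thesis unfolding ult_mem_def using aae_iff[OF P] by simp
qed

text \<open>The iterated ultrapower becomes a single ultrapower on \<open>pairs X b\<close>, so all
  results on quantifiers apply to it. The laws of \<open>aae\<close> reduce to those of the
  represented ultrafilter, because \<open>ext\<close> turns conjunction and negation into
  intersection and complement.\<close>

sublocale W: ultra_quantifier mem "pairs X b" aae "\<lambda>h. d (rep h)"
proof unfold_locales
  note W = cc_ultrafilterD[OF cc_W]
  show mono: "aae Q"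
    if PQ: "aae P" "\<And>i. i \<epsilon> pairs X b \<Longrightarrow> P i \<Longrightarrow> Q i" "definable_pred P" "definable_pred Q" for P Q
  proof -
    have "elts (ext P) \<subseteq> elts (ext Q)"
    proof
      fix x assume "x \<in> elts (ext P)"
      then obtain y where y: "definable_fun y" "x = U.cls y" "ae (\<lambda>a. y a \<epsilon> b a \<and> P (pair a (y a)))"
        using mem_ext_iff[OF PQ(3)] by auto
      have "ae (\<lambda>a. y a \<epsilon> b a \<and> Q (pair a (y a)))"
        by (rule U.A_mono[OF y(3)]) (use PQ(2) mem_pairs[OF b] in blast,
            (intro definable_ext_pred(1) PQ(3,4) y(1))+)
      then show "x \<in> elts (ext Q)" using mem_ext[OF PQ(4) y(1)] y(2) by simp
    qed
    then show ?thesis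
      using W(6)[OF _ ext_in_Ult[OF PQ(4)] _ ext_subset[OF PQ(4)]] PQ aae_iff by blast
  qed
  show "aae (\<lambda>i. P i \<and> Q i)" if PQ: "aae P" "aae Q" "definable_pred P" "definable_pred Q" for P Q
  proof -
    have d: "definable_pred (\<lambda>i. P i \<and> Q i)"
      using PQ(3,4) unfolding definable_pred_def by (rule definable_And)
    have "mkset (elts (ext P) \<inter> elts (ext Q)) = ext (\<lambda>i. P i \<and> Q i)"
    proof (rule mkset_eqI, rule set_eqI)
      fix x
      show "x \<in> elts (ext (\<lambda>i. P i \<and> Q i)) \<longleftrightarrow> x \<in> elts (ext P) \<inter> elts (ext Q)"
      proof (cases "\<exists>y. definable_fun y \<and> x = U.cls y")
        case False
        then show ?thesis using mem_ext_iff[OF d] mem_ext_iff[OF PQ(3)] by simp blast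
      next
        case True
        then obtain y where y: "definable_fun y" "x = U.cls y" by blast
        note e = definable_ext_pred(1)[OF _ y(1)]
        have "ae (\<lambda>a. y a \<epsilon> b a \<and> P (pair a (y a)) \<and> Q (pair a (y a))) \<longleftrightarrow>
          ae (\<lambda>a. (y a \<epsilon> b a \<and> P (pair a (y a))) \<and> (y a \<epsilon> b a \<and> Q (pair a (y a))))"
          by (rule arg_cong[of _ _ ae]) auto
        also have "\<dots> \<longleftrightarrow> ae (\<lambda>a. y a \<epsilon> b a \<and> P (pair a (y a))) \<and> ae (\<lambda>a. y a \<epsilon> b a \<and> Q (pair a (y a)))"
        proof -
          have "definable_pred (\<lambda>a. (y a \<epsilon> b a \<and> P (pair a (y a))) \<and> (y a \<epsilon> b a \<and> Q (pair a (y a))))"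
            using e[OF PQ(3)] e[OF PQ(4)] unfolding definable_pred_def by (rule definable_And)
          then show ?thesis
            using U.A_conj[OF _ _ e[OF PQ(3)] e[OF PQ(4)]] U.A_mono[OF _ _ _ e[OF PQ(3)]]
              U.A_mono[OF _ _ _ e[OF PQ(4)]] by blast
        qed
        finally show ?thesis using mem_ext[OF d y(1)] mem_ext[OF PQ(3) y(1)] mem_ext[OF PQ(4) y(1)] y(2)
          by simp
      qed
    qed
    then show ?thesis using W(7)[of "ext P" "ext Q"] PQ aae_iff[OF d] aae_iff by simp
  qed
  show "aae (\<lambda>i. \<not> P i) \<longleftrightarrow> \<not> aae P" if P: "definable_pred P" for P
  proof -
    have nP: "definable_pred (\<lambda>i. \<not> P i)" using P unfolding definable_pred_def by (rule definable_Not)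
    have mem: "x \<epsilon> ext (\<lambda>i. \<not> P i) \<longleftrightarrow> x \<epsilon> U.cls b \<and> \<not> x \<epsilon> ext P" for x
    proof (cases "x \<epsilon> U.cls b")
      case False
      then show ?thesis using ext_subset[OF nP] by auto
    next
      case True
      then obtain y where y: "definable_fun y" "x = U.cls y" "ae (\<lambda>a. y a \<epsilon> b a)"
        using U.mem_cls[OF b] by blast
      have *: "ae (\<lambda>a. y a \<epsilon> b a \<and> Q (pair a (y a))) \<longleftrightarrow> ae (\<lambda>a. Q (pair a (y a)))"
        if "definable_pred Q" for Q
        using U.A_conj[OF y(3) _ definable_ext_pred(3)[OF that y(1)] definable_ext_pred(2)[OF that y(1)]]
          U.A_mono[OF _ _ definable_ext_pred(1)[OF that y(1)] definable_ext_pred(2)[OF that y(1)]] by blast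
      show ?thesis
        using True U.A_not[OF definable_ext_pred(2)[OF P y(1)]]
        unfolding y(2) mem_ext[OF P y(1)] mem_ext[OF nP y(1)] *[OF P] *[OF nP] by blast
    qed
    have "mkset (elts (U.cls b) - elts (ext P)) = ext (\<lambda>i. \<not> P i)"
      by (rule mkset_eqI, rule set_eqI) (simp add: mem)
    moreover have "mkset (elts (ext P) \<inter> elts (ext (\<lambda>i. \<not> P i))) = empty"
      by (rule mkset_eqI) (auto simp: mem)
    ultimately show ?thesis
      using W(5) W(7)[of "ext P" "ext (\<lambda>i. \<not> P i)"] W(8)[OF ext_in_Ult[OF P] ext_subset[OF P]]
      unfolding aae_iff[OF P] aae_iff[OF nP] by metis
  qed
  show "definable (\<lambda>e. aae (P e))" if P: "definable (\<lambda>e. P (\<lambda>i. e (Suc i)) (e 0))" for P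
    unfolding aae_def
  proof (intro U.A_definable definable_intros definable_funD[OF b] definable_funD[OF w])
    have "definable (\<lambda>e. P (\<lambda>i. e (Suc (Suc i))) (e 0))" by (rule definable_shift1[OF P])
    then have "definable (\<lambda>e. P (\<lambda>i. e (Suc (Suc (Suc i)))) (e 0))"
      by (rule definable_shift1[where P = "\<lambda>e x. P (\<lambda>i. e (Suc i)) x" for P])
    then show "definable (\<lambda>e. P (\<lambda>i. e (Suc (Suc i))) (pair (e (Suc 0)) (e 0)))"
      by (rule definable_let[where P = "\<lambda>e x. P (\<lambda>i. e (Suc (Suc i))) x" for P]) (intro definable_intros)
  qed
  have dd: "definable_fun d"
    using collapse_d unfolding ult_collapse_def by (blast intro: class_function_definable)
  show "definable_fun (\<lambda>h. d (rep h))"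
    unfolding definable_defs rep_def
    by (intro definable_funD[OF dd] U.definable_cls definable_intros definable_funD[OF b])
  show "elts (d (rep g)) = (\<lambda>h. d (rep h)) ` {f. is_function f (pairs X b) \<and> aae (\<lambda>i. ap f i \<epsilon> ap g i)}"
    if g: "is_function g (pairs X b)" for g
  proof -
    have "rep g \<in> ult_functions (Ult UNIV U c) (U.cls w)" using ult_functions_rep g by blast
    then have "elts (d (rep g)) = d ` {f \<in> ult_functions (Ult UNIV U c) (U.cls w). ult_mem (U.cls w) f (rep g)}"
      using collapse_d unfolding ult_collapse_def by blast
    also have "{f \<in> ult_functions (Ult UNIV U c) (U.cls w). ult_mem (U.cls w) f (rep g)}
        = rep ` {f. is_function f (pairs X b) \<and> aae (\<lambda>i. ap f i \<epsilon> ap g i)}"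
      using ult_functions_rep ult_mem_rep by auto
    finally show ?thesis by (simp add: image_image)
  qed
qed

lemma Ult_Ult: "x \<in> Ult (Ult UNIV U c) (U.cls w) d \<Longrightarrow> \<exists>F. definable_fun F \<and> x = W.cls F"
proof -
  assume "x \<in> Ult (Ult UNIV U c) (U.cls w) d"
  then obtain h where h: "is_function h (pairs X b)" "x = d (rep h)"
    unfolding Ult_def[of "Ult UNIV U c"] using ult_functions_rep by auto
  have "x = W.cls (ap h)"
    unfolding W.cls_def by (subst is_function_eq_lam[OF h(1), symmetric]) (rule h(2))
  then show ?thesis using W.definable_ap_fun by blast
qed

text \<open>The image of \<open>cls g\<close> is the class of a constant function on
  \<open>cls b\<close>, whose uncurried form depends on \<open>a\<close> only.\<close>

lemma embedding_cls:
  assumes g: "definable_fun g"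
  shows "ult_embedding (U.cls w) d (U.cls g) = W.cls (unc (\<lambda>a _. g a))"
proof -
  have u: "definable_fun (unc (\<lambda>a _. g a))"
    by (rule definable_unc) (unfold definable_defs, intro definable_intros definable_funD[OF g])
  have "ap (lam (pairs X b) (unc (\<lambda>a _. g a))) (pair a y) = g a" if "a \<epsilon> X" "y \<epsilon> b a" for a y
    using that by (subst ap_lam[OF u]) (auto simp: mem_pairs[OF b])
  then have "lam (b a) (\<lambda>y. ap (lam (pairs X b) (unc (\<lambda>a _. g a))) (pair a y)) = lam (b a) (\<lambda>_. g a)"
    if "a \<epsilon> X" for a
    using that by (intro lam_cong) simp
  then have "rep (lam (pairs X b) (unc (\<lambda>a _. g a))) = U.cls (\<lambda>a. lam (b a) (\<lambda>_. g a))"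
    unfolding rep_def U.cls_def by (intro arg_cong[of _ _ c], rule lam_cong) simp
  then show ?thesis
    unfolding W.cls_def ult_embedding_def union_W U.const_fun_cls[OF b g] by simp
qed

text \<open>
  The kernel consists of the images \<open>K a\<close> of the ultrafilters \<open>w a\<close> under \<open>y \<mapsto> F (a, y)\<close>, where \<open>F\<close>
  represents the image of the seed of \<open>U'\<close>. A counterexample to the countable completeness of almost
  all \<open>K a\<close> would be represented by a sequence in \<open>Ult(V, U)\<close> refuting that of \<open>W\<close>.
\<close>
lemma kernel_exists:
  assumes F: "definable_fun F"
    and less: "fso_less (W.cls F) (ult_embedding (U.cls w) d (id_class U c))"
    and mem: "\<And>A. A \<epsilon> U' \<Longrightarrow> W.cls F \<epsilon> ult_embedding (U.cls w) d (ult_embedding U c A)"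
    and sub: "\<And>A. A \<epsilon> U' \<Longrightarrow> elts A \<subseteq> elts X'"
  shows "\<exists>K. K \<epsilon> powset (cart X (powset X')) \<and> kernel U' U K"
proof -
  note d0 = definable_intros definable_funD[OF F] definable_funD[OF b] definable_funD[OF w]
  define K where "K = sep (cart X (powset X'))
    (\<lambda>p. \<exists>a A. p = pair a A \<and> sep (b a) (\<lambda>y. F (pair a y) \<epsilon> A) \<epsilon> w a)"
  have K: "pair a A \<epsilon> K \<longleftrightarrow> a \<epsilon> X \<and> elts A \<subseteq> elts X' \<and> sep (b a) (\<lambda>y. F (pair a y) \<epsilon> A) \<epsilon> w a" for a A
    unfolding K_def by (subst mem_sep) (unfold definable_defs, intro d0, auto)
  have const: "definable_fun (\<lambda>_. A)" and ident: "definable_fun (\<lambda>a. a)" for A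
    unfolding definable_defs by (intro definable_intros)+
  \<comment> \<open>The seed of \<open>U\<close> is represented by the identity, hence its image by
    the projection to \<open>a\<close>; Los's theorem turns \<open>less\<close> into a statement
    about almost all pairs.\<close>
  have seed: "aae (\<lambda>p. \<exists>a y. p = pair a y \<and> fso_less (F p) a)"
  proof -
    have u: "definable_fun (unc (\<lambda>a _. a))"
      by (rule definable_unc) (unfold definable_defs, intro definable_intros)
    have "aae (\<lambda>p. fso_less (F p) (unc (\<lambda>a _. a) p))"
      using less unfolding id_class_eq embedding_cls[OF ident] by (intro W.fso_less_cls F u)
    then show ?thesis by (simp add: aae_def)
  qed
  have mem_K: "ae (\<lambda>a. pair a A \<epsilon> K)" if A: "A \<epsilon> U'" for A
  proof -
    have u: "definable_fun (unc (\<lambda>_ _. A))"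
      by (rule definable_unc) (unfold definable_defs, intro definable_intros)
    have "aae (\<lambda>p. F p \<epsilon> unc (\<lambda>_ _. A) p)"
      using mem[OF A] unfolding embedding_eq embedding_cls[OF const] W.cls_mem[OF F u] .
    then have "ae (\<lambda>a. sep (b a) (\<lambda>y. F (pair a y) \<epsilon> A) \<epsilon> w a)" by (simp add: aae_def)
    then show ?thesis
      by (rule U.A_mono) (simp add: K sub[OF A], unfold definable_defs, (intro d0)+)
  qed
  have "ae (good K)"
  proof (rule ccontr)
    assume "\<not> ae (good K)"
    moreover have "definable_pred (good K)" unfolding definable_defs by (intro d0)
    ultimately have "ae (\<lambda>a. \<not> good K a)" using U.A_not[of "good K"] by simp
    then have "ae (\<lambda>a. \<exists>s. s \<epsilon> powset (cart omega (powset X')) \<and> ((\<forall>i\<in>elts omega. pair a (ap s i) \<epsilon> K) \<and>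
        \<not> (\<exists>z. fso_less z a \<and> (\<forall>i\<in>elts omega. z \<epsilon> ap s i))))"
    proof (rule U.A_mono)
      fix a assume "\<not> good K a"
      then obtain s where s: "\<forall>i\<in>elts omega. pair a (ap s i) \<epsilon> K"
        "\<not> (\<exists>z. fso_less z a \<and> (\<forall>i\<in>elts omega. z \<epsilon> ap s i))" unfolding good_def by blast
      have ds: "definable_fun (ap s)" by (rule U.definable_ap_fun)
      \<comment> \<open>Restricting \<open>s\<close> to \<omega> keeps its values there and brings
        it into the set that bounds the choice.\<close>
      have "lam omega (ap s) \<epsilon> powset (cart omega (powset X'))"
        using s(1) K by (auto simp: mem_lam[OF ds])
      moreover have "ap (lam omega (ap s)) i = ap s i" if "i \<in> elts omega" for i
        using that ap_lam[OF ds] by simp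
      ultimately show "\<exists>s. s \<epsilon> powset (cart omega (powset X')) \<and> ((\<forall>i\<in>elts omega. pair a (ap s i) \<epsilon> K) \<and>
        \<not> (\<exists>z. fso_less z a \<and> (\<forall>i\<in>elts omega. z \<epsilon> ap s i)))"
        using s by (intro exI[of _ "lam omega (ap s)"]) simp
    qed (unfold definable_defs, (intro d0)+)
    then have "\<exists>\<sigma>. definable_fun \<sigma> \<and> ae (\<lambda>a. \<sigma> a \<epsilon> powset (cart omega (powset X')) \<and>
      ((\<forall>i\<in>elts omega. pair a (ap (\<sigma> a) i) \<epsilon> K) \<and>
        \<not> (\<exists>z. fso_less z a \<and> (\<forall>i\<in>elts omega. z \<epsilon> ap (\<sigma> a) i))))"
      by (rule U.A_choice[rotated 2]) (unfold definable_defs, (intro d0)+)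
    then obtain \<sigma> where \<sigma>: "definable_fun \<sigma>" "ae (\<lambda>a. \<sigma> a \<epsilon> powset (cart omega (powset X')) \<and>
      ((\<forall>i\<in>elts omega. pair a (ap (\<sigma> a) i) \<epsilon> K) \<and>
        \<not> (\<exists>z. fso_less z a \<and> (\<forall>i\<in>elts omega. z \<epsilon> ap (\<sigma> a) i))))" by blast
    note d1 = d0 definable_funD[OF \<sigma>(1)]
    \<comment> \<open>The preimage of the \<open>i\<close>-th set under \<open>F\<close>, cut down
      to points whose image lies below \<open>a\<close>, so that a common point of these sets has an
      image with both properties denied by \<open>\<sigma> a\<close>.\<close>
    define S where "S a i = sep (b a) (\<lambda>y. F (pair a y) \<epsilon> ap (\<sigma> a) i \<and> fso_less (F (pair a y)) a)" for a i
    have S: "definable_op S" unfolding definable_defs S_def by (intro d1)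
    have Si: "definable_fun (\<lambda>a. S a i)" for i unfolding definable_defs S_def by (intro d1)
    have memS: "y \<epsilon> S a i \<longleftrightarrow> y \<epsilon> b a \<and> F (pair a y) \<epsilon> ap (\<sigma> a) i \<and> fso_less (F (pair a y)) a" for y a i
      unfolding S_def by (rule mem_sep) (unfold definable_defs, intro d1)
    \<comment> \<open>This class is again a sequence indexed by \<omega>, since the embedding fixes
      \<omega> and its elements; completeness of the represented ultrafilter inside the ultrapower
      therefore applies to it.\<close>
    define t where "t = U.cls (\<lambda>a. lam omega (S a))"
    have "definable_fun (\<lambda>a. lam omega (S a))" unfolding definable_defs by (intro d1 definable_opD[OF S])
    then have tM: "t \<in> Ult UNIV U c" unfolding Ult_iff U.is_cls_def t_def by blast
    have tf: "is_function t omega"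
      using U.is_function_cls_lam[OF const[of omega] S] unfolding t_def cls_const_omega .
    have ti: "ap t i = U.cls (\<lambda>a. S a i)" if i: "i \<epsilon> omega" for i
    proof -
      have "ae (\<lambda>_. i \<epsilon> omega)" by (rule U.A_all) (simp add: i, unfold definable_defs, intro definable_intros)
      from U.ap_cls_lam[OF const S const this] show ?thesis
        unfolding t_def cls_const_omega_mem[OF i] .
    qed
    have tW: "ap t i \<epsilon> U.cls w" if i: "i \<epsilon> omega" for i
    proof -
      have "ae (\<lambda>a. sep (b a) (\<lambda>y. F (pair a y) \<epsilon> ap (\<sigma> a) i) \<epsilon> w a)"
        by (rule U.A_mono[OF \<sigma>(2)]) (use i K in force, unfold definable_defs, (intro d1)+)
      then have "aae (\<lambda>p. \<exists>a y. p = pair a y \<and> F p \<epsilon> ap (\<sigma> a) i)" by (simp add: aae_def)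
      from W.A_conj[OF this seed]
      have "aae (\<lambda>p. (\<exists>a y. p = pair a y \<and> F p \<epsilon> ap (\<sigma> a) i) \<and> (\<exists>a y. p = pair a y \<and> fso_less (F p) a))"
        by this (unfold definable_defs, (intro d1)+)
      then have "ae (\<lambda>a. S a i \<epsilon> w a)" by (simp add: aae_def S_def)
      then show ?thesis unfolding ti[OF i] using U.cls_mem[OF Si w] by blast
    qed
    have "sep (U.cls b) (\<lambda>x. \<forall>i\<in>elts omega. x \<epsilon> ap t i) \<epsilon> U.cls w"
      by (rule cc_ultrafilter_sequence[OF cc_W tM tf tW])
    then have "sep (U.cls b) (\<lambda>x. \<forall>i\<in>elts omega. x \<epsilon> ap t i) \<noteq> empty"
      using cc_ultrafilterD(5)[OF cc_W] by auto
    then obtain x where x: "x \<epsilon> sep (U.cls b) (\<lambda>x. \<forall>i\<in>elts omega. x \<epsilon> ap t i)"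
      using extensionality[of _ empty] by auto
    have "definable_pred (\<lambda>x. \<forall>i\<in>elts omega. x \<epsilon> ap t i)" unfolding definable_defs by (intro d0)
    from x[unfolded mem_sep[OF this]] have xb: "x \<epsilon> U.cls b" and xt: "\<And>i. i \<epsilon> omega \<Longrightarrow> x \<epsilon> ap t i" by auto
    obtain \<eta> where \<eta>: "definable_fun \<eta>" "x = U.cls \<eta>" using U.mem_cls[OF b] xb by blast
    note d2 = d1 definable_funD[OF \<eta>(1)] definable_opD[OF S]
    have "ae (\<lambda>a. \<eta> a \<epsilon> S a i)" if i: "i \<epsilon> omega" for i
      using xt[OF i] unfolding \<eta>(2) ti[OF i] using U.cls_mem[OF \<eta>(1) Si] by blast
    \<comment> \<open>For each \<open>i\<close> the exceptional set may be different; completeness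
      of \<open>U\<close> makes one large set of \<open>a\<close> serve all
      \<open>i\<close>.\<close>
    then have "ae (\<lambda>a. \<forall>i\<in>elts omega. \<eta> a \<epsilon> S a i)"
      by (intro ae_omega) (unfold definable_defs, (intro d2)+)
    from U.A_conj[OF this \<sigma>(2)]
    have "ae (\<lambda>a. (\<forall>i\<in>elts omega. \<eta> a \<epsilon> S a i) \<and> (\<sigma> a \<epsilon> powset (cart omega (powset X')) \<and>
      ((\<forall>i\<in>elts omega. pair a (ap (\<sigma> a) i) \<epsilon> K) \<and>
        \<not> (\<exists>z. fso_less z a \<and> (\<forall>i\<in>elts omega. z \<epsilon> ap (\<sigma> a) i)))))"
      by this (unfold definable_defs, (intro d2)+)
    from U.A_ex[OF this] have "\<exists>a. a \<epsilon> X \<and> (\<forall>i\<in>elts omega. \<eta> a \<epsilon> S a i) \<and> (\<sigma> a \<epsilon> powset (cart omega (powset X')) \<and>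
      ((\<forall>i\<in>elts omega. pair a (ap (\<sigma> a) i) \<epsilon> K) \<and>
        \<not> (\<exists>z. fso_less z a \<and> (\<forall>i\<in>elts omega. z \<epsilon> ap (\<sigma> a) i))))"
      by this (unfold definable_defs, intro d2)
    then obtain a where a: "\<forall>i\<in>elts omega. \<eta> a \<epsilon> S a i"
      "\<not> (\<exists>z. fso_less z a \<and> (\<forall>i\<in>elts omega. z \<epsilon> ap (\<sigma> a) i))" by blast
    \<comment> \<open>Every \<open>S a i\<close> carries the condition that the image is below
      \<open>a\<close>; index 0 is used to read it off.\<close>
    have "fso_less (F (pair a (\<eta> a))) a" using bspec[OF a(1), of empty] memS by simp
    then show False using a memS by blast
  qed
  moreover have "K \<epsilon> powset (cart X (powset X'))"
    unfolding K_def by (simp only: mem_powset subset_iff elts_iff) (subst mem_sep, unfold definable_defs, intro d0, blast)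
  ultimately show ?thesis
    using mem_K unfolding kernel_def union_U ae_def by blast
qed

end

context zfc_model
begin

text \<open>If \<open>A\<close> is in \<open>U'\<close>, the seed of \<open>U'\<close> belongs to
  the image of \<open>A\<close>. Applying the second embedding and commutation, the image
  \<open>s\<close> of the seed belongs to the image of \<open>A\<close> along the other side, and
  equality of the targets gives \<open>s\<close> a representing function there.\<close>

lemma E_less_kernel:
  assumes less: "E_less U' U" and U': "uniform_ultrafilter U'" and U: "uniform_ultrafilter U"
  shows "\<exists>K. K \<epsilon> powset (cart (union U) (powset (union U'))) \<and> kernel U' U K"
proof -
  obtain c0 c1 W0 d0 W1 d1 where ec: "external_comparison U' c0 U c1 W0 d0 W1 d1"
    and W1: "W1 \<in> Ult UNIV U c1"
    and fso: "fso_less (ult_embedding W0 d0 (id_class U' c0)) (ult_embedding W1 d1 (id_class U c1))"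
    using less unfolding E_less_def by blast
  obtain X' where X': "cc_ultrafilter UNIV X' U'" using U' unfolding uniform_ultrafilter_def by blast
  obtain X where X: "cc_ultrafilter UNIV X U" using U unfolding uniform_ultrafilter_def by blast
  note ec = ec[unfolded external_comparison_def]
  obtain Y0 where Y0: "cc_ultrafilter (Ult UNIV U' c0) Y0 W0" using ec by blast
  obtain Y1 where Y1: "cc_ultrafilter (Ult UNIV U c1) Y1 W1" using ec by blast
  have c: "ult_collapse UNIV U' c0" "ult_collapse UNIV U c1" using ec by blast+
  have d: "ult_collapse (Ult UNIV U' c0) W0 d0" "ult_collapse (Ult UNIV U c1) W1 d1" using ec by blast+
  have N: "Ult (Ult UNIV U' c0) W0 d0 = Ult (Ult UNIV U c1) W1 d1" using ec by blast
  have j: "ult_embedding W0 d0 (ult_embedding U' c0 A) = ult_embedding W1 d1 (ult_embedding U c1 A)" for A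
    using ec by (metis comp_apply)
  interpret U': ultrapower mem X' U' c0 by unfold_locales (rule X' c)+
  interpret U: ultrapower mem X U c1 by unfold_locales (rule X c)+
  obtain b where b: "definable_fun b" "Y1 = U.U.cls b"
    using cc_ultrafilterD(1)[OF Y1] unfolding U.Ult_iff U.U.is_cls_def by blast
  obtain w where w: "definable_fun w" "W1 = U.U.cls w"
    using W1 unfolding U.Ult_iff U.U.is_cls_def by blast
  interpret I: iterated_ultrapower mem X U c1 b w d1
    using b w Y1 d by unfold_locales auto
  have ident: "definable_fun (\<lambda>a. a)" and const: "\<And>A. definable_fun (\<lambda>_. A)"
    unfolding definable_defs by (intro definable_intros)+
  obtain b0 where b0: "definable_fun b0" "Y0 = U'.U.cls b0"
    using cc_ultrafilterD(1)[OF Y0] unfolding U'.Ult_iff U'.U.is_cls_def by blast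
  have Y0u: "union W0 = U'.U.cls b0" using cc_ultrafilter_union[OF Y0] b0(2) by simp
  \<comment> \<open>The ultrapower by \<open>W0\<close> is formed with functions of the first
    ultrapower, so the constant functions have to be found in it.\<close>
  have cf: "const_fun (U'.U.cls b0) (U'.U.cls g) \<in> ult_functions (Ult UNIV U' c0) W0"
    if g: "definable_fun g" for g
  proof -
    have "definable_fun (\<lambda>a. lam (b0 a) (\<lambda>_. g a))"
      unfolding definable_defs by (intro definable_intros definable_funD[OF b0(1)] definable_funD[OF g])
    then have "const_fun (U'.U.cls b0) (U'.U.cls g) \<in> Ult UNIV U' c0"
      unfolding U'.Ult_iff U'.U.is_cls_def U'.U.const_fun_cls[OF b0(1) g] by blast
    then show ?thesis
      unfolding ult_functions_def Y0u const_fun_eq_lam using is_function_lam[OF const] by blast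
  qed
  define s where "s = ult_embedding W0 d0 (id_class U' c0)"
  have s: "s = d0 (const_fun (U'.U.cls b0) (U'.U.cls (\<lambda>a. a)))"
    unfolding s_def ult_embedding_def Y0u U'.id_class_eq ..
  have "s \<in> Ult (Ult UNIV U' c0) W0 d0" unfolding s Ult_def[of "Ult UNIV U' c0"] by (rule imageI[OF cf[OF ident]])
  then have "s \<in> Ult (Ult UNIV U c1) (U.U.cls w) d1" using N w(2) by simp
  then obtain F where F: "definable_fun F" "s = I.W.cls F" using I.Ult_Ult by blast
  have mem: "s \<epsilon> ult_embedding W0 d0 (ult_embedding U' c0 A)" if A: "A \<epsilon> U'" for A
  proof -
    have dA: "definable_pred (\<lambda>a. a \<epsilon> A)" unfolding definable_defs by (intro definable_intros)
    have "mkset (elts A) = sep X' (\<lambda>a. a \<epsilon> A)"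
      by (rule sep_eqI[OF dA]) (use cc_ultrafilterD(3)[OF X' A] in auto)
    then have "sep X' (\<lambda>a. a \<epsilon> A) = A" by simp
    then have "U'.ae (\<lambda>a. a \<epsilon> A)" using A unfolding U'.ae_def by simp
    then have sA: "U'.U.cls (\<lambda>a. a) \<epsilon> U'.U.cls (\<lambda>_. A)" using U'.U.cls_mem[OF ident const] by blast
    have app: "app (const_fun Y a) x = a" if "x \<epsilon> Y" for Y a x
      unfolding const_fun_eq_lam by (rule app_lam[OF const that])
    \<comment> \<open>Membership between values of constant functions holds everywhere or nowhere;
      here it holds on all of \<open>Y0\<close>. No representing function for the possibly external
      \<open>W0\<close> is involved.\<close>
    have "mkset {x. x \<epsilon> union W0 \<and> app (const_fun (U'.U.cls b0) (U'.U.cls (\<lambda>a. a))) x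
        \<epsilon> app (const_fun (U'.U.cls b0) (U'.U.cls (\<lambda>_. A))) x} = Y0"
      by (rule mkset_eqI, rule set_eqI) (simp add: Y0u b0(2) app sA cong: conj_cong)
    then have "ult_mem W0 (const_fun (U'.U.cls b0) (U'.U.cls (\<lambda>a. a)))
        (const_fun (U'.U.cls b0) (U'.U.cls (\<lambda>_. A)))"
      unfolding ult_mem_def using cc_ultrafilterD(4)[OF Y0] by simp
    then have "s \<in> elts (d0 (const_fun (U'.U.cls b0) (U'.U.cls (\<lambda>_. A))))"
      using d(1) cf[OF const] cf[OF ident] unfolding ult_collapse_def s by blast
    then show ?thesis unfolding ult_embedding_def[of W0] Y0u U'.embedding_eq by simp
  qed
  have "\<exists>K. K \<epsilon> powset (cart X (powset X')) \<and> kernel U' U K"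
  proof (rule I.kernel_exists[OF F(1)])
    show "fso_less (I.W.cls F) (ult_embedding (U.U.cls w) d1 (id_class U c1))"
      using fso F(2) w(2) unfolding s_def by simp
    show "I.W.cls F \<epsilon> ult_embedding (U.U.cls w) d1 (ult_embedding U c1 A)" if "A \<epsilon> U'" for A
      using mem[OF that] F(2) w(2) j by simp
    show "elts A \<subseteq> elts X'" if "A \<epsilon> U'" for A using cc_ultrafilterD(3)[OF X' that] .
  qed
  then show ?thesis using U.union_U U'.union_U by simp
qed

end

section \<open>Finite sets of ordinals\<close>

context zfc_model
begin

lemma definable_transitive_set [definable_intros]:
  assumes "definable_term s" shows "definable (\<lambda>e. transitive_set (s e))"
  unfolding transitive_set_def by (intro definable_intros assms assms[THEN definable_term_shift])

lemma definable_ordinal [definable_intros]: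
  assumes "definable_term s" shows "definable (\<lambda>e. ordinal (s e))"
  unfolding ordinal_def by (intro definable_intros assms assms[THEN definable_term_shift])

lemma ordinal_mem: "ordinal \<alpha> \<Longrightarrow> \<beta> \<epsilon> \<alpha> \<Longrightarrow> ordinal \<beta>"
  unfolding ordinal_def transitive_set_def by (meson elts_iff subsetD)

lemma ordinal_transitive: "ordinal \<alpha> \<Longrightarrow> \<beta> \<epsilon> \<alpha> \<Longrightarrow> \<gamma> \<epsilon> \<beta> \<Longrightarrow> \<gamma> \<epsilon> \<alpha>"
  unfolding ordinal_def transitive_set_def by (meson elts_iff subsetD)

text \<open>Nested \<in>-induction, on \<open>\<alpha>\<close> and then on \<open>\<beta>\<close>:
  if the two are incomparable, every element of each belongs to the other, so they are
  equal.\<close>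

lemma ordinal_linear:
  assumes "ordinal \<alpha>" "ordinal \<beta>"
  shows "\<alpha> \<epsilon> \<beta> \<or> \<alpha> = \<beta> \<or> \<beta> \<epsilon> \<alpha>"
proof -
  have "ordinal \<alpha> \<longrightarrow> (\<forall>\<beta>. ordinal \<beta> \<longrightarrow> \<alpha> \<epsilon> \<beta> \<or> \<alpha> = \<beta> \<or> \<beta> \<epsilon> \<alpha>)"
  proof (rule class_induct)
    show "definable_pred (\<lambda>\<alpha>. ordinal \<alpha> \<longrightarrow> (\<forall>\<beta>. ordinal \<beta> \<longrightarrow> \<alpha> \<epsilon> \<beta> \<or> \<alpha> = \<beta> \<or> \<beta> \<epsilon> \<alpha>))"
      unfolding definable_defs by (intro definable_intros)
    fix \<alpha> assume IH1: "\<And>\<alpha>'. \<alpha>' \<epsilon> \<alpha> \<Longrightarrow> ordinal \<alpha>' \<longrightarrow> (\<forall>\<beta>. ordinal \<beta> \<longrightarrow> \<alpha>' \<epsilon> \<beta> \<or> \<alpha>' = \<beta> \<or> \<beta> \<epsilon> \<alpha>')"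
    show "ordinal \<alpha> \<longrightarrow> (\<forall>\<beta>. ordinal \<beta> \<longrightarrow> \<alpha> \<epsilon> \<beta> \<or> \<alpha> = \<beta> \<or> \<beta> \<epsilon> \<alpha>)"
    proof
      assume \<alpha>: "ordinal \<alpha>"
      have "ordinal \<beta> \<longrightarrow> \<alpha> \<epsilon> \<beta> \<or> \<alpha> = \<beta> \<or> \<beta> \<epsilon> \<alpha>" for \<beta>
      proof (rule class_induct[where P = "\<lambda>\<beta>. ordinal \<beta> \<longrightarrow> \<alpha> \<epsilon> \<beta> \<or> \<alpha> = \<beta> \<or> \<beta> \<epsilon> \<alpha>"])
        show "definable_pred (\<lambda>\<beta>. ordinal \<beta> \<longrightarrow> \<alpha> \<epsilon> \<beta> \<or> \<alpha> = \<beta> \<or> \<beta> \<epsilon> \<alpha>)"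
          unfolding definable_defs by (intro definable_intros)
        fix \<beta> assume IH2: "\<And>\<beta>'. \<beta>' \<epsilon> \<beta> \<Longrightarrow> ordinal \<beta>' \<longrightarrow> \<alpha> \<epsilon> \<beta>' \<or> \<alpha> = \<beta>' \<or> \<beta>' \<epsilon> \<alpha>"
        show "ordinal \<beta> \<longrightarrow> \<alpha> \<epsilon> \<beta> \<or> \<alpha> = \<beta> \<or> \<beta> \<epsilon> \<alpha>"
        proof (intro impI, rule ccontr)
          assume \<beta>: "ordinal \<beta>" and no: "\<not> (\<alpha> \<epsilon> \<beta> \<or> \<alpha> = \<beta> \<or> \<beta> \<epsilon> \<alpha>)"
          have "\<beta>' \<epsilon> \<alpha>" if "\<beta>' \<epsilon> \<beta>" for \<beta>'
            using IH2[OF that] ordinal_mem[OF \<beta> that] ordinal_transitive[OF \<beta> that] no that by blast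
          moreover have "\<alpha>' \<epsilon> \<beta>" if "\<alpha>' \<epsilon> \<alpha>" for \<alpha>'
            using IH1[OF that] ordinal_mem[OF \<alpha> that] ordinal_transitive[OF \<alpha> that] \<beta> no that by blast
          ultimately have "\<alpha> = \<beta>" by (intro extensionality) blast
          with no show False by simp
        qed
      qed
      then show "\<forall>\<beta>. ordinal \<beta> \<longrightarrow> \<alpha> \<epsilon> \<beta> \<or> \<alpha> = \<beta> \<or> \<beta> \<epsilon> \<alpha>" by blast
    qed
  qed
  then show ?thesis using assms by blast
qed

definition is_max :: "'v \<Rightarrow> 'v \<Rightarrow> bool" where
  "is_max m a \<longleftrightarrow> m \<epsilon> a \<and> (\<forall>x. x \<epsilon> a \<longrightarrow> x \<epsilon> m \<or> x = m)"

text \<open>The only consequence of finiteness that is needed: every nonempty subset has a maximum.\<close>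
definition fso :: "'v \<Rightarrow> bool" where
  "fso a \<longleftrightarrow> (\<forall>x. x \<epsilon> a \<longrightarrow> ordinal x) \<and> (\<forall>b. elts b \<subseteq> elts a \<and> b \<noteq> empty \<longrightarrow> (\<exists>m. is_max m b))"

lemma definable_is_max [definable_intros]:
  assumes "definable_term s" "definable_term t" shows "definable (\<lambda>e. is_max (s e) (t e))"
  unfolding is_max_def by (intro definable_intros assms assms[THEN definable_term_shift])

lemma definable_fso [definable_intros]:
  assumes "definable_term s" shows "definable (\<lambda>e. fso (s e))"
  unfolding fso_def by (intro definable_intros assms assms[THEN definable_term_shift])

lemma nonempty_iff: "b \<noteq> empty \<longleftrightarrow> (\<exists>x. x \<epsilon> b)"
  using extensionality[of b empty] by auto

lemma fso_subset: "fso a \<Longrightarrow> elts b \<subseteq> elts a \<Longrightarrow> fso b"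
  unfolding fso_def by (auto simp: subset_iff)

lemma fso_n_subset:
  assumes n: "n \<epsilon> omega" and a: "a \<epsilon> n_subsets \<kappa> n" and \<kappa>: "ordinal \<kappa>"
  shows "fso a"
proof -
  \<comment> \<open>\<open>is_bijection\<close> is stated with \<open>app\<close>, for which there
    is no definability rule; rewritten with \<open>ap\<close> it is definable.\<close>
  have bij: "is_bijection f n a \<longleftrightarrow> is_function f n \<and>
     (\<forall>x. x \<epsilon> n \<longrightarrow> ap f x \<epsilon> a) \<and> (\<forall>x y. x \<epsilon> n \<and> y \<epsilon> n \<and> ap f x = ap f y \<longrightarrow> x = y)
     \<and> (\<forall>y. y \<epsilon> a \<longrightarrow> (\<exists>x. x \<epsilon> n \<and> ap f x = y))" for f a
  proof (cases "is_function f n")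
    case True
    then have "bij_betw (app f) (elts n) (elts a) \<longleftrightarrow> bij_betw (ap f) (elts n) (elts a)"
      using is_functionD(2) by (intro bij_betw_cong) auto
    moreover have "inj_on (ap f) (elts n) \<longleftrightarrow> (\<forall>x y. x \<epsilon> n \<and> y \<epsilon> n \<and> ap f x = ap f y \<longrightarrow> x = y)"
      unfolding inj_on_def Ball_def elts_iff by blast
    moreover have "ap f ` elts n = elts a \<longleftrightarrow>
        (\<forall>x. x \<epsilon> n \<longrightarrow> ap f x \<epsilon> a) \<and> (\<forall>y. y \<epsilon> a \<longrightarrow> (\<exists>x. x \<epsilon> n \<and> ap f x = y))"
      unfolding set_eq_iff image_iff Bex_def elts_iff by metis
    ultimately show ?thesis using True unfolding is_bijection_def bij_betw_def by blast
  qed (simp add: is_bijection_def)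
  have "definable_pred (\<lambda>a. elts a \<subseteq> elts \<kappa> \<and> (\<exists>f. is_bijection f n a))"
    unfolding definable_defs bij by (intro definable_intros)
  from small_sep[OF this, of "powset \<kappa>"]
  have "small {a. elts a \<subseteq> elts \<kappa> \<and> (\<exists>f. is_bijection f n a)}" by (rule back_subst[of small]) auto
  then obtain f where sub: "elts a \<subseteq> elts \<kappa>" and f: "is_bijection f n a"
    using a unfolding n_subsets_def by (auto simp: mem_mkset)
  \<comment> \<open>The induction is on the \<open>n\<close> whose values under the fixed
    \<open>f\<close> cover \<open>b\<close>. At \<open>succ n\<close>, the value
    \<open>ap f n\<close> is removed and then compared with the maximum of the rest.\<close>
  have max: "\<forall>b. (\<forall>y. y \<epsilon> b \<longrightarrow> ordinal y \<and> (\<exists>i. i \<epsilon> n \<and> ap f i = y)) \<and> b \<noteq> empty \<longrightarrow> (\<exists>m. is_max m b)"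
    using n
  proof (rule omega_induct)
    show "definable_pred (\<lambda>n. \<forall>b. (\<forall>y. y \<epsilon> b \<longrightarrow> ordinal y \<and> (\<exists>i. i \<epsilon> n \<and> ap f i = y)) \<and> b \<noteq> empty
        \<longrightarrow> (\<exists>m. is_max m b))"
      unfolding definable_defs by (intro definable_intros)
    show "\<forall>b. (\<forall>y. y \<epsilon> b \<longrightarrow> ordinal y \<and> (\<exists>i. i \<epsilon> empty \<and> ap f i = y)) \<and> b \<noteq> empty \<longrightarrow> (\<exists>m. is_max m b)"
      using nonempty_iff by auto
    fix n
    assume IH: "\<forall>b. (\<forall>y. y \<epsilon> b \<longrightarrow> ordinal y \<and> (\<exists>i. i \<epsilon> n \<and> ap f i = y)) \<and> b \<noteq> empty \<longrightarrow> (\<exists>m. is_max m b)"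
    show "\<forall>b. (\<forall>y. y \<epsilon> b \<longrightarrow> ordinal y \<and> (\<exists>i. i \<epsilon> succ n \<and> ap f i = y)) \<and> b \<noteq> empty \<longrightarrow> (\<exists>m. is_max m b)"
    proof (intro allI impI)
      fix b assume b: "(\<forall>y. y \<epsilon> b \<longrightarrow> ordinal y \<and> (\<exists>i. i \<epsilon> succ n \<and> ap f i = y)) \<and> b \<noteq> empty"
      define b' where "b' = sep b (\<lambda>y. y \<noteq> ap f n)"
      have b': "y \<epsilon> b' \<longleftrightarrow> y \<epsilon> b \<and> y \<noteq> ap f n" for y
        unfolding b'_def by (rule mem_sep) (unfold definable_defs, intro definable_intros)
      have IHb: "\<exists>m. is_max m b'" if "b' \<noteq> empty"
      proof -
        have "\<forall>y. y \<epsilon> b' \<longrightarrow> ordinal y \<and> (\<exists>i. i \<epsilon> n \<and> ap f i = y)"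
          using b b' unfolding mem_succ by metis
        then show ?thesis using IH that by blast
      qed
      show "\<exists>m. is_max m b"
      proof (cases "b' = empty")
        case True
        then have "\<And>y. y \<epsilon> b \<Longrightarrow> y = ap f n" using b' by (metis mem_empty)
        then have "is_max (ap f n) b" using b nonempty_iff unfolding is_max_def by metis
        then show ?thesis by blast
      next
        case False
        then obtain m where m: "is_max m b'" using IHb by blast
        then have mb: "m \<epsilon> b" "ordinal m" using b b' unfolding is_max_def by blast+
        show ?thesis
        proof (cases "ap f n \<epsilon> b \<and> m \<epsilon> ap f n")
          case True
          then have "ordinal (ap f n)" using b by blast
          then have "is_max (ap f n) b"
            using True m b' ordinal_transitive unfolding is_max_def by metis
          then show ?thesis by blast
        next
          case False
          then have "is_max m b"
            using m b b' mb ordinal_linear[OF mb(2)] unfolding is_max_def by metis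
          then show ?thesis by blast
        qed
      qed
    qed
  qed
  have "ordinal x" if "x \<epsilon> a" for x using that sub ordinal_mem[OF \<kappa>] by auto
  then show ?thesis
    unfolding fso_def using max f[unfolded bij] by (auto simp: subset_iff) 
qed

text \<open>Induction on the least maximum \<open>\<mu>\<close> of the members of \<open>Z\<close>; remove \<open>\<mu>\<close> from those whose maximum it is.\<close>
lemma fso_wellfounded:
  assumes Z: "\<And>a. a \<epsilon> Z \<Longrightarrow> fso a" and ne: "a \<epsilon> Z"
  shows "\<exists>a. a \<epsilon> Z \<and> (\<forall>b. b \<epsilon> Z \<longrightarrow> \<not> fso_less b a)"
proof -
  define P where "P \<mu> \<longleftrightarrow> (\<forall>Z. (\<forall>a. a \<epsilon> Z \<longrightarrow> fso a) \<and> (\<exists>a. a \<epsilon> Z \<and> is_max \<mu> a)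
    \<longrightarrow> (\<exists>a. a \<epsilon> Z \<and> (\<forall>b. b \<epsilon> Z \<longrightarrow> \<not> fso_less b a)))" for \<mu>
  have empty_min: "\<exists>a. a \<epsilon> Z \<and> (\<forall>b. b \<epsilon> Z \<longrightarrow> \<not> fso_less b a)" if "empty \<epsilon> Z" for Z
    using that by (intro exI[of _ empty]) (auto simp: fso_less_def)
  have max: "\<exists>\<mu>. is_max \<mu> a" if "fso a" "a \<noteq> empty" for a
    using that unfolding fso_def by blast
  have "P \<mu>" for \<mu>
  proof (rule class_induct)
    show "definable_pred P" unfolding definable_defs P_def by (intro definable_intros)
    fix \<mu> assume IH: "\<And>\<nu>. \<nu> \<epsilon> \<mu> \<Longrightarrow> P \<nu>"
    show "P \<mu>"
      unfolding P_def
    proof (intro allI impI, elim conjE exE)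
      fix Z a assume Z: "\<forall>a. a \<epsilon> Z \<longrightarrow> fso a" and a: "a \<epsilon> Z" "is_max \<mu> a"
      show "\<exists>a. a \<epsilon> Z \<and> (\<forall>b. b \<epsilon> Z \<longrightarrow> \<not> fso_less b a)"
      \<comment> \<open>A member with maximum below \<open>\<mu>\<close> is handled by the induction
        hypothesis, and \<open>empty\<close> is itself minimal. What remains is the case where
        \<open>\<mu>\<close> is the least maximum.\<close>
      proof (cases "empty \<epsilon> Z \<or> (\<exists>\<nu> a'. \<nu> \<epsilon> \<mu> \<and> a' \<epsilon> Z \<and> is_max \<nu> a')")
        case True
        then show ?thesis using empty_min IH Z unfolding P_def by blast
      next
        case False
        define cut where "cut a = sep a (\<lambda>x. x \<noteq> \<mu>)" for a
        have cut: "x \<epsilon> cut a \<longleftrightarrow> x \<epsilon> a \<and> x \<noteq> \<mu>" for x a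
          unfolding cut_def by (rule mem_sep) (unfold definable_defs, intro definable_intros)
        have dcut: "definable_fun cut" unfolding definable_defs cut_def by (intro definable_intros)
        have dmax: "definable_pred (is_max \<mu>)" unfolding definable_defs by (intro definable_intros)
        define Z' where "Z' = mkset (cut ` elts (sep Z (is_max \<mu>)))"
        have Z': "x \<epsilon> Z' \<longleftrightarrow> (\<exists>a. a \<epsilon> Z \<and> is_max \<mu> a \<and> x = cut a)" for x
          unfolding Z'_def mem_mkset[OF small_image[OF dcut]] image_iff by (auto simp: mem_sep[OF dmax])
        have "\<exists>x. x \<epsilon> Z' \<and> (\<forall>y. y \<epsilon> Z' \<longrightarrow> \<not> fso_less y x)"
        proof (cases "empty \<epsilon> Z'")
          case True
          then show ?thesis by (rule empty_min)
        next
          case False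
          have f: "\<forall>x. x \<epsilon> Z' \<longrightarrow> fso x"
          proof (intro allI impI)
            fix x assume "x \<epsilon> Z'"
            then obtain a where "a \<epsilon> Z" "x = cut a" using Z' by blast
            then show "fso x" using fso_subset[of a "cut a"] Z cut by (auto simp: subset_iff)
          qed
          have "cut a \<epsilon> Z'" using Z' a by blast
          moreover then have "cut a \<noteq> empty" using False by metis
          ultimately obtain \<nu> where \<nu>: "is_max \<nu> (cut a)" using max f by blast
          then have "\<nu> \<epsilon> \<mu>" using a(2) cut unfolding is_max_def by blast
          from IH[OF this] show ?thesis using f \<nu> \<open>cut a \<epsilon> Z'\<close> unfolding P_def by blast
        qed
        then obtain m where m: "m \<epsilon> Z" "is_max \<mu> m" and mmin: "\<And>b. b \<epsilon> Z \<Longrightarrow> is_max \<mu> b \<Longrightarrow> \<not> fso_less (cut b) (cut m)"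
          using Z' by metis
        \<comment> \<open>A maximum of \<open>b\<close> above \<open>\<mu>\<close> would lie in the
          symmetric difference with \<open>m\<close>, yet not at or below the witness
          \<open>\<xi>\<close>; so \<open>b\<close> too has maximum \<open>\<mu>\<close>.\<close>
        have "\<not> fso_less b m" if b: "b \<epsilon> Z" for b
        proof
          assume "fso_less b m"
          then obtain \<xi> where \<xi>: "\<xi> \<epsilon> m" "\<not> \<xi> \<epsilon> b"
            "\<And>\<eta>. \<eta> \<epsilon> b \<and> \<not> \<eta> \<epsilon> m \<or> \<eta> \<epsilon> m \<and> \<not> \<eta> \<epsilon> b \<Longrightarrow> \<eta> \<epsilon> \<xi> \<or> \<eta> = \<xi>"
            unfolding fso_less_def by auto
          have \<mu>: "ordinal \<mu>" using m Z unfolding is_max_def fso_def by blast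
          have \<xi>\<mu>: "\<xi> \<epsilon> \<mu> \<or> \<xi> = \<mu>" using \<xi>(1) m(2) unfolding is_max_def by blast
          have "b \<noteq> empty" using False b by blast
          then obtain \<nu> where \<nu>: "is_max \<nu> b" using max Z b by blast
          then have \<nu>o: "ordinal \<nu>" using Z b unfolding is_max_def fso_def by blast
          have "\<not> \<nu> \<epsilon> \<mu>" using False \<nu> b by blast
          then have "\<mu> \<epsilon> \<nu> \<or> \<mu> = \<nu>" using ordinal_linear[OF \<mu> \<nu>o] by blast
          moreover have "\<not> \<mu> \<epsilon> \<nu>"
          proof
            assume \<mu>\<nu>: "\<mu> \<epsilon> \<nu>"
            then have "\<not> \<nu> \<epsilon> m" using m(2) mem_asym[OF \<mu>\<nu>] mem_irrefl unfolding is_max_def by metis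
            then have "\<nu> \<epsilon> \<xi> \<or> \<nu> = \<xi>" using \<xi>(3) \<nu> unfolding is_max_def by blast
            then have "\<nu> \<epsilon> \<mu> \<or> \<nu> = \<mu>" using \<xi>\<mu> ordinal_transitive[OF \<mu>] by blast
            then show False using mem_asym[OF \<mu>\<nu>] mem_irrefl \<mu>\<nu> by blast
          qed
          ultimately have b\<mu>: "is_max \<mu> b" using \<nu> by simp
          \<comment> \<open>\<open>\<mu>\<close> belongs to \<open>b\<close> and
            \<open>\<xi>\<close> does not, so \<open>\<xi>\<close> survives the removal of
            \<open>\<mu>\<close> and still witnesses the order.\<close>
          then have "\<xi> \<noteq> \<mu>" using \<xi>(2) unfolding is_max_def by blast
          then have "fso_less (cut b) (cut m)"
            unfolding fso_less_iff using \<xi> cut by (intro exI[of _ \<xi>]) blast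
          then show False using mmin[OF b b\<mu>] by blast
        qed
        then show ?thesis using m(1) by blast
      qed
    qed
  qed
  then show ?thesis using max[OF Z[OF ne]] ne Z empty_min unfolding P_def by metis
qed

lemma uniform_fso: "uniform_ultrafilter U \<Longrightarrow> a \<epsilon> union U \<Longrightarrow> fso a"
  unfolding uniform_ultrafilter_def using cc_ultrafilter_union fso_n_subset by metis

end

section \<open>Wellfoundedness\<close>

context zfc_model
begin

text \<open>
  \<open>R n a\<close> says that \<open>a\<close> is \<open>m\<close> times hereditarily good at stage \<open>n\<close>, for all \<open>m\<close>. Then \<open>R 0\<close> is nonempty by the
  countable completeness of \<open>U 0\<close>, and for \<open>R n a\<close> that of the \<open>n\<close>-th kernel at \<open>a\<close> yields some
  \<open>b\<close> below \<open>a\<close> with \<open>R (n + 1) b\<close>.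
\<close>
lemma no_descending_kernels:
  assumes U: "definable_fun U"
    and unif: "\<And>n. n \<epsilon> omega \<Longrightarrow> uniform_ultrafilter (U n)"
    and ker: "\<And>n. n \<epsilon> omega \<Longrightarrow> \<exists>K. K \<epsilon> powset (cart (union (U n)) (powset (union (U (succ n)))))
      \<and> kernel (U (succ n)) (U n) K"
  shows False
proof -
  note d0 = definable_intros definable_funD[OF U]
  define X where "X n = union (U n)" for n
  have X: "definable_fun X" unfolding definable_defs X_def by (intro d0)
  \<comment> \<open>All kernels are chosen at once by choice in the model, which applies because
    \<open>kernel\<close> is definable and the candidates at each stage form a set.\<close>
  obtain k where k: "definable_fun k" "\<And>n. n \<epsilon> omega \<Longrightarrow> kernel (U (succ n)) (U n) (k n)"
  proof -
    have "definable_rel (\<lambda>n K. kernel (U (succ n)) (U n) K)"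
      "definable_fun (\<lambda>n. powset (cart (union (U n)) (powset (union (U (succ n))))))"
      unfolding definable_defs by (intro d0)+
    then obtain k where "definable_fun k" "\<And>n. n \<epsilon> omega \<Longrightarrow>
        \<exists>K. K \<epsilon> powset (cart (union (U n)) (powset (union (U (succ n))))) \<and> kernel (U (succ n)) (U n) K
        \<Longrightarrow> k n \<epsilon> powset (cart (union (U n)) (powset (union (U (succ n))))) \<and> kernel (U (succ n)) (U n) (k n)"
      by (rule choice_fun[where X = omega]) blast
    then show ?thesis using ker that by blast
  qed
  note d1 = d0 definable_funD[OF X] definable_funD[OF k(1)]
  have cc: "cc_ultrafilter UNIV (X n) (U n)" if n: "n \<epsilon> omega" for n
    using unif[OF n] cc_ultrafilter_union unfolding uniform_ultrafilter_def X_def by metis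
  define sec where "sec S n = sep (X n) (\<lambda>a. pair n a \<epsilon> S)" for S n
  have sec: "a \<epsilon> sec S n \<longleftrightarrow> a \<epsilon> X n \<and> pair n a \<epsilon> S" for a S n
    unfolding sec_def by (rule mem_sep) (unfold definable_defs, intro d1)
  \<comment> \<open>One set codes a subset of \<open>X n\<close> for every \<open>n\<close>, its
    \<open>n\<close>-th section. Since stage \<open>n\<close> refers to stage \<open>n + 1\<close>,
    the recursion is on depth and treats all stages at once: \<open>G0\<close> is depth 0, and
    \<open>\<Phi>\<close> adds one level.\<close>
  define G0 where "G0 = sep (pairs omega X) (\<lambda>p. \<exists>n a. p = pair n a \<and> good (k n) a)"
  define \<Phi> where "\<Phi> S = sep (pairs omega X)
    (\<lambda>p. \<exists>n a. p = pair n a \<and> good (k n) a \<and> pair a (sec S (succ n)) \<epsilon> k n)" for S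
  have G0: "pair n a \<epsilon> G0 \<longleftrightarrow> n \<epsilon> omega \<and> a \<epsilon> X n \<and> good (k n) a" for n a
    unfolding G0_def by (subst mem_sep) (unfold definable_defs, intro d1, auto simp: mem_pairs[OF X])
  have \<Phi>: "pair n a \<epsilon> \<Phi> S \<longleftrightarrow> n \<epsilon> omega \<and> a \<epsilon> X n \<and> good (k n) a \<and> pair a (sec S (succ n)) \<epsilon> k n" for n a S
    unfolding \<Phi>_def by (subst mem_sep) (unfold definable_defs sec_def, intro d1, auto simp: mem_pairs[OF X])
  have d\<Phi>: "definable_fun \<Phi>"
    unfolding definable_defs \<Phi>_def pairs_def sec_def by (intro d1)
  from omega_recursion[OF d\<Phi>, of G0] obtain g where g: "definable_fun g" "g empty = G0"
    "\<And>m. m \<epsilon> omega \<Longrightarrow> g (succ m) = \<Phi> (g m)" by metis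
  note d2 = d1 definable_funD[OF g(1)]
  have dsec: "definable_fun (\<lambda>m. sec (g m) n)" for n unfolding definable_defs sec_def by (intro d2)
  have large: "\<forall>n\<in>elts omega. sec (g m) n \<epsilon> U n" if m: "m \<epsilon> omega" for m
    using m
  proof (rule omega_induct)
    show "definable_pred (\<lambda>m. \<forall>n\<in>elts omega. sec (g m) n \<epsilon> U n)"
      unfolding definable_defs sec_def by (intro d2)
    have good: "sep (X n) (good (k n)) \<epsilon> U n" if "n \<epsilon> omega" for n
      using k(2)[OF that] unfolding kernel_def X_def by blast
    have dgood: "definable_pred (good (k n))" for n unfolding definable_defs by (intro d2)
    have "sec (g empty) n = sep (X n) (good (k n))" if "n \<epsilon> omega" for n
      by (rule extensionality) (use that in \<open>auto simp: sec g(2) G0 mem_sep[OF dgood]\<close>)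
    then show "\<forall>n\<in>elts omega. sec (g empty) n \<epsilon> U n" using good by simp
    fix m assume m: "m \<epsilon> omega" and IH: "\<forall>n\<in>elts omega. sec (g m) n \<epsilon> U n"
    show "\<forall>n\<in>elts omega. sec (g (succ m)) n \<epsilon> U n"
    proof
      fix n assume "n \<in> elts omega"
      then have n: "n \<epsilon> omega" by simp
      let ?A = "sec (g m) (succ n)"
      have "?A \<epsilon> U (succ n)" using IH succ_omega[OF n] by simp
      then have "sep (X n) (\<lambda>a. pair a ?A \<epsilon> k n) \<epsilon> U n"
        using k(2)[OF n] unfolding kernel_def X_def by blast
      from cc_ultrafilterD(7)[OF cc[OF n] good[OF n] this]
      have "mkset (elts (sep (X n) (good (k n))) \<inter> elts (sep (X n) (\<lambda>a. pair a ?A \<epsilon> k n))) \<epsilon> U n" .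
      moreover have "mkset (elts (sep (X n) (good (k n))) \<inter> elts (sep (X n) (\<lambda>a. pair a ?A \<epsilon> k n)))
        = sec (g (succ m)) n"
      proof (rule mkset_eqI, rule set_eqI)
        have "definable_pred (\<lambda>a. pair a ?A \<epsilon> k n)" unfolding definable_defs by (intro d2)
        note s = mem_sep[OF this]
        show "x \<in> elts (sec (g (succ m)) n) \<longleftrightarrow>
            x \<in> elts (sep (X n) (good (k n))) \<inter> elts (sep (X n) (\<lambda>a. pair a ?A \<epsilon> k n))" for x
          unfolding Int_iff elts_iff s mem_sep[OF dgood] g(3)[OF m] sec \<Phi> using n by blast
      qed
      ultimately show "sec (g (succ m)) n \<epsilon> U n" by simp
    qed
  qed
  define R where "R n a \<longleftrightarrow> a \<epsilon> X n \<and> (\<forall>m\<in>elts omega. pair n a \<epsilon> g m)" for n a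
  have R: "R n a \<longleftrightarrow> (\<forall>m\<in>elts omega. a \<epsilon> sec (g m) n)" for n a
    unfolding R_def Ball_def elts_iff sec using empty_omega by blast
  have "\<exists>a. R empty a"
  proof -
    define s where "s = lam omega (\<lambda>m. sec (g m) empty)"
    have s: "ap s m = sec (g m) empty" if "m \<epsilon> omega" for m unfolding s_def by (rule ap_lam[OF dsec that])
    have "sep (X empty) (\<lambda>x. \<forall>i\<in>elts omega. x \<epsilon> ap s i) \<epsilon> U empty"
    proof (rule cc_ultrafilter_sequence[OF cc[OF empty_omega]])
      show "is_function s omega" unfolding s_def by (rule is_function_lam[OF dsec])
      show "ap s i \<epsilon> U empty" if "i \<epsilon> omega" for i using large[OF that] s[OF that] by simp
    qed simp
    then have "sep (X empty) (\<lambda>x. \<forall>i\<in>elts omega. x \<epsilon> ap s i) \<noteq> empty"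
      using cc_ultrafilterD(5)[OF cc[OF empty_omega]] by metis
    moreover have "definable_pred (\<lambda>x. \<forall>i\<in>elts omega. x \<epsilon> ap s i)" unfolding definable_defs by (intro d0)
    ultimately obtain a where "\<forall>i\<in>elts omega. a \<epsilon> ap s i" unfolding nonempty_iff using mem_sep by metis
    then show ?thesis using R s by auto
  qed
  \<comment> \<open>Membership at depth \<open>m + 1\<close> puts the depth-\<open>m\<close> section
    of the next stage into the kernel at \<open>a\<close>; goodness then gives a point below
    \<open>a\<close> common to all depths.\<close>
  moreover have step: "\<exists>b. fso_less b a \<and> R (succ n) b" if n: "n \<epsilon> omega" and a: "R n a" for n a
  proof -
    define s where "s = lam omega (\<lambda>m. sec (g m) (succ n))"
    have s: "ap s m = sec (g m) (succ n)" if "m \<epsilon> omega" for m unfolding s_def by (rule ap_lam[OF dsec that])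
    have "good (k n) a" using a empty_omega unfolding R_def Ball_def elts_iff by (metis G0 g(2))
    moreover have "\<forall>m\<in>elts omega. pair a (ap s m) \<epsilon> k n"
    proof
      fix m assume "m \<in> elts omega"
      then have m: "m \<epsilon> omega" by simp
      then have "pair n a \<epsilon> \<Phi> (g m)" using a succ_omega[OF m] unfolding R_def g(3)[OF m, symmetric] by simp
      then show "pair a (ap s m) \<epsilon> k n" using \<Phi> s[OF m] by simp
    qed
    ultimately obtain b where "fso_less b a" "\<forall>m\<in>elts omega. b \<epsilon> ap s m" unfolding good_def by blast
    then show ?thesis using R s by auto
  qed
  \<comment> \<open>The stages are pooled into one nonempty set: its minimal element lies in some
    \<open>R n\<close>, and \<open>step\<close> gives a smaller member at the next stage, so no
    descending sequence has to be chosen.\<close>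
  define Z where "Z = sep (iun omega X) (\<lambda>a. \<exists>n. n \<epsilon> omega \<and> R n a)"
  have Z: "a \<epsilon> Z \<longleftrightarrow> (\<exists>n. n \<epsilon> omega \<and> R n a)" for a
  proof -
    have "definable_pred (\<lambda>a. \<exists>n. n \<epsilon> omega \<and> R n a)" unfolding definable_defs R_def by (intro d2)
    then show ?thesis unfolding Z_def mem_iun[OF X] by (auto simp: mem_sep mem_iun[OF X] R_def)
  qed
  have "fso a" if "a \<epsilon> Z" for a using that uniform_fso[OF unif] unfolding Z R_def X_def by blast
  moreover obtain a0 where "a0 \<epsilon> Z" using \<open>\<exists>a. R empty a\<close> Z empty_omega by blast
  ultimately obtain a where a: "a \<epsilon> Z" "\<And>b. b \<epsilon> Z \<Longrightarrow> \<not> fso_less b a" using fso_wellfounded[of Z a0] by blast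
  then show False using step succ_omega unfolding Z by blast
qed

end

theorem theorem7p13:
  fixes mem :: "'v \<Rightarrow> 'v \<Rightarrow> bool"
  assumes "zfc_model mem"
  shows "\<not> (\<exists>u. set_structure.is_function mem u (set_structure.omega mem)
    \<and> (\<forall>i. mem i (set_structure.omega mem) \<longrightarrow>
         set_structure.uniform_ultrafilter mem (set_structure.app mem u i)
         \<and> set_structure.E_less mem
             (set_structure.app mem u (set_structure.succ mem i)) (set_structure.app mem u i)))"
proof -
  interpret zfc_model mem by (rule assms)
  show ?thesis
  proof
    assume "\<exists>u. is_function u omega \<and> (\<forall>i. mem i omega \<longrightarrow>
      uniform_ultrafilter (app u i) \<and> E_less (app u (succ i)) (app u i))"
    then obtain u where u: "is_function u omega"
      "\<And>i. mem i omega \<Longrightarrow> uniform_ultrafilter (app u i)"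
      "\<And>i. mem i omega \<Longrightarrow> E_less (app u (succ i)) (app u i)" by blast
    \<comment> \<open>\<open>ap u\<close> agrees with \<open>app u\<close> on \<omega> and is
      definable on all arguments, as the recursion requires.\<close>
    have app: "app u i = ap u i" if "mem i omega" for i using is_functionD(2)[OF u(1) that] .
    show False
    proof (rule no_descending_kernels)
      show "definable_fun (ap u)" unfolding definable_defs by (intro definable_intros)
      show unif: "uniform_ultrafilter (ap u n)" if "mem n omega" for n using u(2)[OF that] app[OF that] by simp
      show "\<exists>K. mem K (powset (cart (union (ap u n)) (powset (union (ap u (succ n))))))
          \<and> kernel (ap u (succ n)) (ap u n) K" if n: "mem n omega" for n
        using E_less_kernel[OF _ unif[OF succ_omega[OF n]] unif[OF n]] u(3)[OF n] app[OF n] app[OF succ_omega[OF n]]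
        by simp
    qed
  qed
qed

end
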